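(* Let $\tau\in\mathcal B_n$ and let $\lambda^{(1)}/\mu^{(1)},\ldots,\lambda^{(k)}/\mu^{(k)}$ be skew shapes, none containing a $3\times2$ block of cells, with $\ell(\lambda^{(i)})\le n$ for all $i$. If $\tau=\tau(I)$ for some $I\subseteq[n-1]$, then \[\mathrm{Imm}_\tau\left(\mathrm{JT}^n_{\lambda^{(1)}/\mu^{(1)}}(\mathbf x^{(1)})*\cdots*\mathrm{JT}^n_{\lambda^{(k)}/\mu^{(k)}}(\mathbf x^{(k)})\right)=\sum_{\vec H}2^{\epsilon(\vec H)}\,\mathrm{wt}(\vec H),\] the sum over all $(\underline\lambda,\underline\mu)$-multinetworks $\vec H$ with $\beta(\vec H)=2^{\epsilon(\vec H)}\mathbb B(I)$. If $\tau$ is not of the form $\tau(I)$, the immanant is $0$. In particular the immanant is always monomial positive.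
   Context: $e_d$ elementary symmetric functions ($e_0=1$, $e_d=0$ for $d<0$). For partitions $\mu\subseteq\lambda$ with $\ell(\lambda)\le n$, $\mathrm{JT}^n_{\lambda/\mu}(\mathbf x)=(e_{\lambda_i-\mu_j-i+j}(\mathbf x))_{i,j=1}^n$; $\lambda/\mu$ (cells $(i,j)$ with $\mu_i<j\le\lambda_i$) contains a $3\times2$ block iff $\lambda_{i+2}\ge\mu_i+2$ for some $i$. $*$ is the entrywise (Hadamard) product, with entries in $\Lambda(\mathbf x^{(1)})\otimes\cdots\otimes\Lambda(\mathbf x^{(k)})$ for distinct variable sets. Immanants: $\mathrm{Imm}_f(M)=\sum_{w\in\mathfrak S_n}f(w)M_{1,w(1)}\cdots M_{n,w(n)}$. $\mathrm{TL}_n(2)$: generators $t_1,\dots,t_{n-1}$, relations $t_i^2=2t_i$, $t_it_jt_i=t_i$ ($|i-j|=1$), $t_it_j=t_jt_i$ ($|i-j|\ge2$), basis $\mathcal B_n$ of Kauffman diagrams. $\theta:\mathbb C[\mathfrak S_n]\to\mathrm{TL}_n(2)$ the algebra map with $\theta(s_i)=t_i-1$, $s_i=(i,i+1)$. $f_\tau(w)$ = coefficient of $\tau$ in $\theta(w)$; $\mathrm{Imm}_\tau=\mathrm{Imm}_{f_\tau}$. For $I\subseteq[n-1]$, $\tau(I)=\prod_{i\in I}t_i\in\mathcal B_n$ and $\mathbb B(I)=\prod_{i\in I}(1+s_i)\in\mathbb C[\mathfrak S_n]$ (increasing order). Lattice paths: graph on $\mathbb Z^2$ with south steps $(a,b)\to(a,b-1)$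 and southwest steps $(a,b)\to(a-1,b-1)$, the latter having $\mathbf x$-weight $x_b$; paths from $(a,\infty)$ start with infinitely many south steps on $x=a$. $A(\lambda)_i=(\lambda_i+n-i,\infty)$, $B(\mu)_i=(\mu_i+n-i,0)$. A $(\lambda,\mu)$-path family is $(p_1,\dots,p_n)$ with $p_i:A(\lambda)_i\to B(\mu)_{\sigma(i)}$ ($\sigma$ the type); its weight is the product of path weights. A $(\lambda,\mu)$-subnetwork $H$ is the multiset union of edges of a path family (covering $H$); $\mathrm{wt}_{\mathbf x}(H)$ is the weight of any covering family. A generalized wiring diagram is a subnetwork in which no vertex lies on three paths of a covering family; then $\theta(\sum_{\vec p\text{ covers }H}\mathrm{type}(\vec p))=2^{\epsilon(H)}\psi(H)$ for a unique integer $\epsilon(H)$ and $\psi(H)\in\mathcal B_n$ (for $3\times2$-avoiding shapes every subnetwork is one). A $(\underline\lambda,\underline\mu)$-multinetwork is $\vec H=(H^{(1)},\dots,H^{(k)})$ with $H^{(i)}$ a $(\lambda^{(i)},\mu^{(i)})$-subnetwork; $\beta(\vec H)=\sum\sigma$ over tuples of covering families $\vec p^{(i)}$ of $H^{(i)}$ all of common type $\sigma$; $\mathrm{wt}(\vec H)=\prod_i\mathrm{wt}_{\mathbf x^{(i)}}(H^{(i)})$; $\epsilon(\vec H)=\sum_i\epsilon(H^{(i)})$. *)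

theory Defs
  imports "HOL-Library.Poly_Mapping" "HOL-Combinatorics.Permutations"
begin

text \<open>The variable x^{(r)}_b is encoded as the pair (r,b). A monomial is a finitely
supported exponent map; a formal power series (with integer coefficients) is its
coefficient function. Lambda(x^{(1)}) tensor ... tensor Lambda(x^{(k)}) embeds in this ring.\<close>

type_synonym monom = "(nat \<times> nat) \<Rightarrow>\<^sub>0 nat"
type_synonym fps = "monom \<Rightarrow> int"

definition fps_one :: fps where
  "fps_one m = (if m = 0 then 1 else 0)"

definition fps_mult :: "fps \<Rightarrow> fps \<Rightarrow> fps" where
  "fps_mult f g m = (\<Sum>(a, b) \<in> {(a, b). a + b = m}. f a * g b)"

definition fps_prod_list :: "fps list \<Rightarrow> fps" where
  "fps_prod_list fs = foldr fps_mult fs fps_one"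

definition elem_sym :: "nat \<Rightarrow> int \<Rightarrow> fps" where
  "elem_sym r d m =
     (if (\<forall>v. Poly_Mapping.lookup m v \<le> 1) \<and> (\<forall>v. Poly_Mapping.lookup m v \<noteq> 0 \<longrightarrow> fst v = r \<and> snd v \<ge> 1)
         \<and> int (\<Sum>v\<in>Poly_Mapping.keys m. Poly_Mapping.lookup m v) = d then 1 else 0)"

definition is_partition :: "nat list \<Rightarrow> bool" where
  "is_partition l \<longleftrightarrow> sorted (rev l) \<and> 0 \<notin> set l"

definition part :: "nat list \<Rightarrow> nat \<Rightarrow> nat" where
  "part l i = (if 1 \<le> i \<and> i \<le> length l then l ! (i - 1) else 0)"

definition subpart :: "nat list \<Rightarrow> nat list \<Rightarrow> bool" where
  "subpart mu lam \<longleftrightarrow> (\<forall>i. part mu i \<le> part lam i)"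

definition skew_cells :: "nat list \<Rightarrow> nat list \<Rightarrow> (nat \<times> nat) set" where
  "skew_cells lam mu = {(i, j). i \<ge> 1 \<and> part mu i < j \<and> j \<le> part lam i}"

definition contains_3x2 :: "nat list \<Rightarrow> nat list \<Rightarrow> bool" where
  "contains_3x2 lam mu \<longleftrightarrow>
     (\<exists>i j. i \<ge> 1 \<and> j \<ge> 1 \<and> (\<forall>a<3. \<forall>b<2. (i + a, j + b) \<in> skew_cells lam mu))"

definition JT :: "nat list \<Rightarrow> nat list \<Rightarrow> nat \<Rightarrow> nat \<Rightarrow> nat \<Rightarrow> fps" where
  "JT lam mu r i j = elem_sym r (int (part lam i) - int (part mu j) - int i + int j)"

definition hadamard_JT :: "nat \<Rightarrow> (nat \<Rightarrow> nat list) \<Rightarrow> (nat \<Rightarrow> nat list) \<Rightarrow> nat \<Rightarrow> nat \<Rightarrow> fps" where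
  "hadamard_JT k lam mu i j = fps_prod_list (map (\<lambda>r. JT (lam r) (mu r) r i j) [1..<k+1])"

definition perms :: "nat \<Rightarrow> (nat \<Rightarrow> nat) set" where
  "perms n = {w. w permutes {1..n}}"

definition Imm :: "nat \<Rightarrow> ((nat \<Rightarrow> nat) \<Rightarrow> int) \<Rightarrow> (nat \<Rightarrow> nat \<Rightarrow> fps) \<Rightarrow> fps" where
  "Imm n f M m = (\<Sum>w\<in>perms n. f w * fps_prod_list (map (\<lambda>i. M i (w i)) [1..<n+1]) m)"

text \<open>Convention: permutations are multiplied left to right, u v = v \<circ> u
 (apply u first); so the word s_{i_1} s_{i_2} ... s_{i_l} is the function s_{i_l} \<circ> ... \<circ> s_{i_1}.\<close>

type_synonym galg = "(nat \<Rightarrow> nat) \<Rightarrow> int"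

definition galg_basis :: "(nat \<Rightarrow> nat) \<Rightarrow> galg" where
  "galg_basis w = (\<lambda>s. if s = w then 1 else 0)"

definition galg_mult :: "nat \<Rightarrow> galg \<Rightarrow> galg \<Rightarrow> galg" where
  "galg_mult n a b s = (if s \<in> perms n then (\<Sum>p\<in>perms n. a p * b (s \<circ> inv p)) else 0)"

definition sadj :: "nat \<Rightarrow> nat \<Rightarrow> nat" where
  "sadj i = transpose i (i + 1)"

definition BB :: "nat \<Rightarrow> nat set \<Rightarrow> galg" where
  "BB n I = foldr (\<lambda>i a. galg_mult n (\<lambda>s. galg_basis id s + galg_basis (sadj i) s) a)
              (sorted_list_of_set I) (galg_basis id)"

text \<open>Boundary points: (True,i) = i-th top point, (False,i) = i-th bottom point, 1 <= i <= n.
 A Kauffman diagram is a noncrossing perfect matching of these 2n points, encoded as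
 a fixed-point-free involution on them (identity elsewhere).\<close>

type_synonym pt = "bool \<times> nat"

definition pts :: "nat \<Rightarrow> pt set" where
  "pts n = UNIV \<times> {1..n}"

text \<open>position of a point when going around the boundary (top left-to-right, then bottom right-to-left)\<close>
definition ppos :: "nat \<Rightarrow> pt \<Rightarrow> nat" where
  "ppos n p = (if fst p then snd p else 2 * n + 1 - snd p)"

definition is_diagram :: "nat \<Rightarrow> (pt \<Rightarrow> pt) \<Rightarrow> bool" where
  "is_diagram n d \<longleftrightarrow>
     (\<forall>p\<in>pts n. d p \<in> pts n \<and> d p \<noteq> p \<and> d (d p) = p) \<and> (\<forall>p. p \<notin> pts n \<longrightarrow> d p = p) \<and>
     (\<forall>p\<in>pts n. \<forall>q\<in>pts n.
        \<not> (ppos n p < ppos n q \<and> ppos n q < ppos n (d p) \<and> ppos n (d p) < ppos n (d q)))"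

definition diagrams :: "nat \<Rightarrow> (pt \<Rightarrow> pt) set" where
  "diagrams n = {d. is_diagram n d}"

text \<open>Stacking d1 on top of d2: levels 0 (top of d1), 1 (middle), 2 (bottom of d2).\<close>
definition lift1 :: "pt \<Rightarrow> nat \<times> nat" where
  "lift1 p = (if fst p then (0, snd p) else (1, snd p))"

definition lift2 :: "pt \<Rightarrow> nat \<times> nat" where
  "lift2 p = (if fst p then (1, snd p) else (2, snd p))"

definition outer :: "pt \<Rightarrow> nat \<times> nat" where
  "outer p = (if fst p then (0, snd p) else (2, snd p))"

definition stack_conn :: "nat \<Rightarrow> (pt \<Rightarrow> pt) \<Rightarrow> (pt \<Rightarrow> pt) \<Rightarrow> ((nat \<times> nat) \<times> (nat \<times> nat)) set" where
  "stack_conn n d1 d2 =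
     ({(lift1 p, lift1 (d1 p)) | p. p \<in> pts n} \<union> {(lift2 p, lift2 (d2 p)) | p. p \<in> pts n})\<^sup>*"

definition dcomp :: "nat \<Rightarrow> (pt \<Rightarrow> pt) \<Rightarrow> (pt \<Rightarrow> pt) \<Rightarrow> (pt \<Rightarrow> pt)" where
  "dcomp n d1 d2 = (\<lambda>p. if p \<in> pts n
       then (THE q. q \<in> pts n \<and> q \<noteq> p \<and> (outer p, outer q) \<in> stack_conn n d1 d2) else p)"

definition dloops :: "nat \<Rightarrow> (pt \<Rightarrow> pt) \<Rightarrow> (pt \<Rightarrow> pt) \<Rightarrow> nat" where
  "dloops n d1 d2 =
     card (({1} \<times> {1..n} - {v. \<exists>p\<in>pts n. (outer p, v) \<in> stack_conn n d1 d2}) // stack_conn n d1 d2)"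

type_synonym tl = "(pt \<Rightarrow> pt) \<Rightarrow> int"

definition tl_basis :: "(pt \<Rightarrow> pt) \<Rightarrow> tl" where
  "tl_basis d = (\<lambda>D. if D = d then 1 else 0)"

definition tl_mult :: "nat \<Rightarrow> tl \<Rightarrow> tl \<Rightarrow> tl" where
  "tl_mult n a b D = (\<Sum>d1\<in>diagrams n. \<Sum>d2\<in>diagrams n.
       if dcomp n d1 d2 = D then a d1 * b d2 * 2 ^ dloops n d1 d2 else 0)"

definition id_diag :: "nat \<Rightarrow> pt \<Rightarrow> pt" where
  "id_diag n p = (if p \<in> pts n then (\<not> fst p, snd p) else p)"

definition gen_diag :: "nat \<Rightarrow> nat \<Rightarrow> pt \<Rightarrow> pt" where
  "gen_diag n i p = (if p \<notin> pts n then p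
      else if snd p = i then (fst p, i + 1)
      else if snd p = i + 1 then (fst p, i)
      else (\<not> fst p, snd p))"

definition tl_one :: "nat \<Rightarrow> tl" where
  "tl_one n = tl_basis (id_diag n)"

definition tl_gen :: "nat \<Rightarrow> nat \<Rightarrow> tl" where
  "tl_gen n i = tl_basis (gen_diag n i)"

definition tauI :: "nat \<Rightarrow> nat set \<Rightarrow> tl" where
  "tauI n I = foldr (\<lambda>i a. tl_mult n (tl_gen n i) a) (sorted_list_of_set I) (tl_one n)"

text \<open>theta(w) for w in S_n: the algebra map with theta(s_i) = t_i - 1, evaluated on w via any
 word s_{i_1} ... s_{i_l} = w.\<close>
definition theta_perm :: "nat \<Rightarrow> (nat \<Rightarrow> nat) \<Rightarrow> tl" where
  "theta_perm n w = (THE x. \<forall>ws. set ws \<subseteq> {1..<n} \<and> foldr (\<lambda>i v. v \<circ> sadj i) ws id = w \<longrightarrow>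
       x = foldr (\<lambda>i a. tl_mult n (\<lambda>D. tl_gen n i D - tl_one n D) a) ws (tl_one n))"

definition theta_lin :: "nat \<Rightarrow> galg \<Rightarrow> tl" where
  "theta_lin n a = (\<lambda>D. \<Sum>w\<in>perms n. a w * theta_perm n w D)"

definition f_tau :: "nat \<Rightarrow> (pt \<Rightarrow> pt) \<Rightarrow> (nat \<Rightarrow> nat) \<Rightarrow> int" where
  "f_tau n \<tau> w = theta_perm n w \<tau>"

text \<open>A path from (a,infinity) to (c,0) is encoded by X, where X y is the x-coordinate of its
 vertex at height y; between heights y and y-1 it takes a south step (X(y-1) = X y) or a
 southwest step (X(y-1) = X y - 1, weight x_y).\<close>
definition is_path :: "int \<Rightarrow> int \<Rightarrow> (nat \<Rightarrow> int) \<Rightarrow> bool" where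
  "is_path a c X \<longleftrightarrow> (\<forall>y\<ge>1. X (y - 1) = X y \<or> X (y - 1) = X y - 1) \<and>
      (\<exists>Y. \<forall>y\<ge>Y. X y = a) \<and> X 0 = c"

type_synonym edge = "(int \<times> int) \<times> (int \<times> int)"

definition path_edges :: "(nat \<Rightarrow> int) \<Rightarrow> edge set" where
  "path_edges X = {((X y, int y), (X (y - 1), int y - 1)) | y. y \<ge> 1}"

definition path_monom :: "nat \<Rightarrow> (nat \<Rightarrow> int) \<Rightarrow> monom" where
  "path_monom r X = (\<Sum>y\<in>{y. y \<ge> 1 \<and> X (y - 1) = X y - 1}. Poly_Mapping.single (r, y) 1)"

definition Acoord :: "nat \<Rightarrow> nat list \<Rightarrow> nat \<Rightarrow> int" where
  "Acoord n lam i = int (part lam i) + int n - int i"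

definition Bcoord :: "nat \<Rightarrow> nat list \<Rightarrow> nat \<Rightarrow> int" where
  "Bcoord n mu j = int (part mu j) + int n - int j"

definition is_family :: "nat \<Rightarrow> nat list \<Rightarrow> nat list \<Rightarrow> (nat \<Rightarrow> nat) \<Rightarrow> (nat \<Rightarrow> nat \<Rightarrow> int) \<Rightarrow> bool" where
  "is_family n lam mu \<sigma> P \<longleftrightarrow> \<sigma> permutes {1..n} \<and>
     (\<forall>i\<in>{1..n}. is_path (Acoord n lam i) (Bcoord n mu (\<sigma> i)) (P i)) \<and>
     (\<forall>i. i \<notin> {1..n} \<longrightarrow> P i = (\<lambda>_. 0))"

definition fam_edges :: "nat \<Rightarrow> (nat \<Rightarrow> nat \<Rightarrow> int) \<Rightarrow> edge \<Rightarrow> nat" where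
  "fam_edges n P e = card {i\<in>{1..n}. e \<in> path_edges (P i)}"

definition subnetwork :: "nat \<Rightarrow> nat list \<Rightarrow> nat list \<Rightarrow> (edge \<Rightarrow> nat) \<Rightarrow> bool" where
  "subnetwork n lam mu H \<longleftrightarrow> (\<exists>\<sigma> P. is_family n lam mu \<sigma> P \<and> fam_edges n P = H)"

definition fam_monom :: "nat \<Rightarrow> nat \<Rightarrow> (nat \<Rightarrow> nat \<Rightarrow> int) \<Rightarrow> monom" where
  "fam_monom r n P = (\<Sum>i\<in>{1..n}. path_monom r (P i))"

text \<open>wt_{x^{(r)}}(H): the weight of any covering family\<close>
definition wt_monom :: "nat \<Rightarrow> nat \<Rightarrow> nat list \<Rightarrow> nat list \<Rightarrow> (edge \<Rightarrow> nat) \<Rightarrow> monom" where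
  "wt_monom r n lam mu H =
     fam_monom r n (SOME P. \<exists>\<sigma>. is_family n lam mu \<sigma> P \<and> fam_edges n P = H)"

definition type_sum :: "nat \<Rightarrow> nat list \<Rightarrow> nat list \<Rightarrow> (edge \<Rightarrow> nat) \<Rightarrow> galg" where
  "type_sum n lam mu H = (\<lambda>\<sigma>. int (card {P. is_family n lam mu \<sigma> P \<and> fam_edges n P = H}))"

definition eps :: "nat \<Rightarrow> nat list \<Rightarrow> nat list \<Rightarrow> (edge \<Rightarrow> nat) \<Rightarrow> nat" where
  "eps n lam mu H = (THE e. \<exists>\<psi>\<in>diagrams n.
       theta_lin n (type_sum n lam mu H) = (\<lambda>D. 2 ^ e * tl_basis \<psi> D))"

definition is_multinetwork :: "nat \<Rightarrow> nat \<Rightarrow> (nat \<Rightarrow> nat list) \<Rightarrow> (nat \<Rightarrow> nat list) \<Rightarrow> (nat \<Rightarrow> edge \<Rightarrow> nat) \<Rightarrow> bool" where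
  "is_multinetwork n k lam mu Hs \<longleftrightarrow>
     (\<forall>r\<in>{1..k}. subnetwork n (lam r) (mu r) (Hs r)) \<and> (\<forall>r. r \<notin> {1..k} \<longrightarrow> Hs r = (\<lambda>_. 0))"

text \<open>beta(H) = sum of sigma over tuples of covering families all of common type sigma\<close>
definition beta :: "nat \<Rightarrow> nat \<Rightarrow> (nat \<Rightarrow> nat list) \<Rightarrow> (nat \<Rightarrow> nat list) \<Rightarrow> (nat \<Rightarrow> edge \<Rightarrow> nat) \<Rightarrow> galg" where
  "beta n k lam mu Hs = (\<lambda>\<sigma>. \<Prod>r\<in>{1..k}. type_sum n (lam r) (mu r) (Hs r) \<sigma>)"

definition multi_monom :: "nat \<Rightarrow> nat \<Rightarrow> (nat \<Rightarrow> nat list) \<Rightarrow> (nat \<Rightarrow> nat list) \<Rightarrow> (nat \<Rightarrow> edge \<Rightarrow> nat) \<Rightarrow> monom" where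
  "multi_monom n k lam mu Hs = (\<Sum>r\<in>{1..k}. wt_monom r n (lam r) (mu r) (Hs r))"

definition multi_eps :: "nat \<Rightarrow> nat \<Rightarrow> (nat \<Rightarrow> nat list) \<Rightarrow> (nat \<Rightarrow> nat list) \<Rightarrow> (nat \<Rightarrow> edge \<Rightarrow> nat) \<Rightarrow> nat" where
  "multi_eps n k lam mu Hs = (\<Sum>r\<in>{1..k}. eps n (lam r) (mu r) (Hs r))"

definition network_sum :: "nat \<Rightarrow> nat \<Rightarrow> (nat \<Rightarrow> nat list) \<Rightarrow> (nat \<Rightarrow> nat list) \<Rightarrow> nat set \<Rightarrow> fps" where
  "network_sum n k lam mu I m =
     (\<Sum>Hs\<in>{Hs. is_multinetwork n k lam mu Hs \<and>
               beta n k lam mu Hs = (\<lambda>\<sigma>. 2 ^ multi_eps n k lam mu Hs * BB n I \<sigma>) \<and>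
               multi_monom n k lam mu Hs = m}.
        2 ^ multi_eps n k lam mu Hs)"

end

theory Submission
  imports Defs
begin

text \<open>
  A path from the \<open>i\<close>-th source to the \<open>j\<close>-th sink exists only if \<open>i \<le> j + 1\<close> when the shape has no
  \<open>3 \<times> 2\<close> block, so the matrices are Hessenberg and only the \<open>2 ^ (n - 1)\<close> permutations
  \<open>w(J) = \<Prod>\<^sub>j\<^sub>\<in>\<^sub>J s\<^sub>j\<close> (increasing order, \<open>J \<subseteq> [n - 1]\<close>) contribute. For these \<open>\<theta>(w(J))\<close> is the alternating
  sum of the \<open>\<tau>(K)\<close> with \<open>K \<subseteq> J\<close>.

  In a subnetwork \<open>H\<close> two paths can only meet in one of \<open>n - 1\<close> disjoint vertical strips, and in
  the \<open>j\<close>-th strip one of the two paths is always the one starting at the \<open>(j + 1)\<close>-st source. A covering family is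
  determined by the choice, at each vertex where two paths part, of the path that goes south, and every
  choice occurs because tails may be exchanged. The lowest choice in the \<open>j\<close>-th strip decides whether
  \<open>j\<close> lies in the set \<open>J\<close> of the type. Hence \<open>\<Sum> type = 2 ^ \<epsilon>(H) B(I)\<close>, where \<open>I\<close> is the set of strips in
  which paths part. The theorem follows by inclusion-exclusion.
\<close>

section \<open>Noncrossing matchings and their hooks\<close>

text \<open>The map \<open>theta_perm\<close> is a definite description over all words of a
  permutation, and \<open>dcomp\<close> is defined by connectivity, so nothing about theta can be
  computed before independence of the word is known. Both \<open>tauI\<close> and
  \<open>theta_perm\<close> multiply only by generators or the identity on the left. It is therefore
  enough to know how t_i acts on diagrams from the left (the hook operation, with a factor 2 when a
  loop closes), to check the Temperley-Lieb relations for these operators, and to derive a word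
  problem solution for operators that satisfy the Coxeter relations; associativity of
  \<open>tl_mult\<close> is never touched.

  On the path side, exchanging tails at one parting vertex reverses all lower choices in the same
  strip. An induction on the height undoes the lower ones, which makes the choices independent. The
  lowest choice of each strip is fixed by the type, all others are free; their number is the
  exponent epsilon(H).

  As a function on permutations, B(I) is an indicator function, so the pointwise product defining
  beta intersects the sets I of the components and adds the exponents. This is why a Hadamard
  product behaves like a single matrix.\<close>

definition hk :: "'a \<Rightarrow> 'a \<Rightarrow> ('a \<Rightarrow> 'a) \<Rightarrow> 'a \<Rightarrow> 'a" where
  "hk a b D p = (if p = a then b else if p = b then a else if p = D a then D b
     else if p = D b then D a else D p)"

definition matching_on :: "'a set \<Rightarrow> ('a \<Rightarrow> 'a) \<Rightarrow> bool" where
  "matching_on S D \<longleftrightarrow> (\<forall>p\<in>S. D p \<in> S \<and> D p \<noteq> p \<and> D (D p) = p) \<and> (\<forall>p. p \<notin> S \<longrightarrow> D p = p)"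

lemma matching_onD:
  assumes "matching_on S D"
  shows "D (D p) = p" "p \<in> S \<Longrightarrow> D p \<noteq> p" "D p = D q \<longleftrightarrow> p = q" "D p \<in> S \<longleftrightarrow> p \<in> S"
  using assms unfolding matching_on_def by metis+

lemma matching_hk:
  assumes "matching_on S D" "a \<in> S" "b \<in> S" "a \<noteq> b"
  shows "matching_on S (hk a b D)"
  using assms(2-4) matching_onD[OF assms(1)] assms(1)[unfolded matching_on_def]
  unfolding matching_on_def hk_def by (smt (verit))

lemma hk_commute:
  assumes "matching_on S D" "a \<in> S" "b \<in> S" "a \<noteq> b"
  shows "hk a b D = hk b a D"
  using assms(2-4) matching_onD[OF assms(1)] 
  unfolding hk_def by (intro ext) auto

lemma hk_idem:
  assumes "matching_on S D" "a \<in> S" "b \<in> S" "a \<noteq> b"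
  shows "hk a b (hk a b D) = hk a b D"
  using assms(2-4) matching_onD[OF assms(1)] 
  unfolding hk_def by (intro ext) auto

text \<open>The middle hook hands the partner of \<open>c\<close> to \<open>a\<close>, and the last
  hook joins it to \<open>c\<close> again. This is the diagram part of t_i t_j t_i = t_i.\<close>

lemma hk_braid:
  assumes "matching_on S D" "a \<in> S" "b \<in> S" "c \<in> S" "a \<noteq> b" "a \<noteq> c" "b \<noteq> c"
  shows "hk a b (hk b c (hk a b D)) = hk a b D"
proof
  fix p
  show "hk a b (hk b c (hk a b D)) p = hk a b D p"
  using assms(2-) matching_onD[OF assms(1)] 
  unfolding hk_def by (smt (verit))
qed

lemma hk_far:
  assumes "matching_on S D" "a \<in> S" "b \<in> S" "c \<in> S" "d \<in> S" "distinct [a,b,c,d]"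
  shows "hk a b (hk c d D) = hk c d (hk a b D)"
proof
  fix p
  show "hk a b (hk c d D) p = hk c d (hk a b D) p"
  using assms(2-) matching_onD[OF assms(1)] 
  unfolding hk_def by (smt (verit) distinct_length_2_or_more)
qed

text \<open>For \<open>x\<close> other than \<open>p\<close> and \<open>q\<close> this says that
  \<open>x\<close> lies between them in the boundary order. In contrast to the crossing inequalities
  it is symmetric in \<open>p\<close> and \<open>q\<close>, and it is additive modulo 2 when chords
  are concatenated.\<close>

definition sep :: "('a \<Rightarrow> nat) \<Rightarrow> 'a \<Rightarrow> 'a \<Rightarrow> 'a \<Rightarrow> bool" where
  "sep f p q x \<longleftrightarrow> (f p < f x) \<noteq> (f q < f x)"

lemma noncrossing_iff_sep:
  assumes D: "matching_on S D" and f: "inj_on f S"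
  shows "(\<forall>p\<in>S. \<forall>q\<in>S. \<not> (f p < f q \<and> f q < f (D p) \<and> f (D p) < f (D q))) \<longleftrightarrow>
         (\<forall>p\<in>S. \<forall>q\<in>S. q \<noteq> p \<longrightarrow> q \<noteq> D p \<longrightarrow> sep f p (D p) q = sep f p (D p) (D q))"
    (is "?nc \<longleftrightarrow> ?sep")
proof
  assume nc: ?nc
  show ?sep
  proof (intro ballI impI)
    fix p q assume pq: "p \<in> S" "q \<in> S" "q \<noteq> p" "q \<noteq> D p"
    have S: "D p \<in> S" "D q \<in> S" "D (D p) = p" "D (D q) = q"
      using D pq by (auto simp: matching_on_def)
    have ne: "f p \<noteq> f q" "f p \<noteq> f (D q)" "f (D p) \<noteq> f q" "f (D p) \<noteq> f (D q)"
      using f pq S D unfolding inj_on_def by (metis matching_onD(3))+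
    show "sep f p (D p) q = sep f p (D p) (D q)"
      using nc[rule_format, of p q] nc[rule_format, of q p] nc[rule_format, of "D p" q]
        nc[rule_format, of q "D p"] nc[rule_format, of p "D q"] nc[rule_format, of "D q" p]
        nc[rule_format, of "D p" "D q"] nc[rule_format, of "D q" "D p"] pq S ne
      unfolding sep_def by (smt (verit) linorder_neqE_nat)
  qed
next
  assume sep: ?sep
  show ?nc
  proof (intro ballI notI)
    fix p q assume "p \<in> S" "q \<in> S" "f p < f q \<and> f q < f (D p) \<and> f (D p) < f (D q)"
    with sep show False unfolding sep_def
      by (metis less_irrefl less_trans not_less_iff_gr_or_eq)
  qed
qed

text \<open>The arc from \<open>a\<close> to \<open>b\<close> has neighbouring ends, so nothing lies
  between them. An untouched chord has \<open>a\<close> and \<open>b\<close> on one side, hence also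
  their former partners, and re-pairing these is harmless. The bridge between the former partners is
  a concatenation of two old chords.\<close>

lemma noncrossing_hk:
  assumes D: "matching_on S D" and f: "inj_on f S" and ab: "a \<in> S" "b \<in> S" "f b = f a + 1"
    and nc: "\<forall>p\<in>S. \<forall>q\<in>S. q \<noteq> p \<longrightarrow> q \<noteq> D p \<longrightarrow> sep f p (D p) q = sep f p (D p) (D q)"
  shows "\<forall>p\<in>S. \<forall>q\<in>S. q \<noteq> p \<longrightarrow> q \<noteq> hk a b D p \<longrightarrow>
      sep f p (hk a b D p) q = sep f p (hk a b D p) (hk a b D q)"
proof (intro ballI impI)
  fix p q assume pq: "p \<in> S" "q \<in> S" "q \<noteq> p" "q \<noteq> hk a b D p"
  have ne: "a \<noteq> b" using ab by auto
  have DS: "\<And>x. D (D x) = x" "\<And>x. D x \<in> S \<longleftrightarrow> x \<in> S" "\<And>x. x \<in> S \<Longrightarrow> D x \<noteq> x"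
    using matching_onD[OF D] by auto
  have fne: "f x \<noteq> f a" "f x \<noteq> f b" if "x \<in> S" "x \<noteq> a" "x \<noteq> b" for x
    using that ab(1,2) inj_onD[OF f] by blast+
  have adj1: "f a < f x \<longleftrightarrow> f b < f x" and adj2: "f x < f a \<longleftrightarrow> f x < f b"
    if "x \<in> S" "x \<noteq> a" "x \<noteq> b" for x
    using fne[OF that] ab(3) by linarith+
  consider (arc) "p = a \<or> p = b" | (bridge) "p \<noteq> a" "p \<noteq> b" "p = D a \<or> p = D b"
    | (old) "p \<noteq> a" "p \<noteq> b" "p \<noteq> D a" "p \<noteq> D b" by blast
  then show "sep f p (hk a b D p) q = sep f p (hk a b D p) (hk a b D q)"
  proof cases
    case arc
    then have q: "q \<noteq> a" "q \<noteq> b" using pq ne by (auto simp: hk_def)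
    then have h: "hk a b D q \<noteq> a" "hk a b D q \<noteq> b" "hk a b D q \<in> S"
    proof -
      note M = matching_onD[OF matching_hk[OF D ab(1,2) ne]]
      have "hk a b D a = b" "hk a b D b = a" using ne by (auto simp: hk_def)
      then show "hk a b D q \<noteq> a" "hk a b D q \<noteq> b" using q M(1) by metis+
      show "hk a b D q \<in> S" using pq(2) M(4) by blast
    qed
    have "hk a b D p = (if p = a then b else a)" using arc by (auto simp: hk_def)
    with arc show ?thesis using adj1[OF pq(2) q] adj1[OF h(3,1,2)] unfolding sep_def by auto
  next
    case bridge
    have Dab: "D a \<noteq> b" "D b \<noteq> a" "D a \<noteq> a" "D b \<noteq> b" "D a \<in> S" "D b \<in> S"
      using DS ab(1,2) bridge by metis+
    have hp: "sep f p (hk a b D p) x = sep f (D a) (D b) x" for x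
      using bridge by (auto simp: hk_def sep_def)
    have q: "q \<noteq> D a \<and> q \<noteq> D b" using pq(3,4) bridge by (auto simp: hk_def)
    have "sep f (D a) (D b) q = sep f (D a) (D b) (hk a b D q)"
    proof (cases "q = a \<or> q = b")
      case True
      then have "hk a b D q = (if q = a then b else a)" by (auto simp: hk_def)
      with True show ?thesis
        using adj2[OF Dab(5,3,1)] adj2[OF Dab(6,2,4)] unfolding sep_def by auto
    next
      case False
      with q have h: "hk a b D q = D q" by (simp add: hk_def)
      have Dq: "D q \<noteq> a" "D q \<noteq> b" "D q \<in> S" using q DS(1) DS(2)[of q] pq(2) by metis+
      \<comment> \<open>Being between \<open>D a\<close> and \<open>D b\<close> is the exclusive or
        of being between \<open>a\<close> and \<open>D a\<close> and between \<open>b\<close> and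
        \<open>D b\<close>, because \<open>a\<close> and \<open>b\<close> compare alike with every
        other point.\<close>
      have "sep f a (D a) q = sep f a (D a) (D q)" "sep f b (D b) q = sep f b (D b) (D q)"
        using nc ab pq(2) q False by blast+
      moreover have "f a < f q \<longleftrightarrow> f b < f q" "f a < f (D q) \<longleftrightarrow> f b < f (D q)"
        using adj1[OF pq(2)] adj1[OF Dq(3,1,2)] False by blast+
      ultimately show ?thesis unfolding sep_def h by blast
    qed
    with hp show ?thesis by simp
  next
    case old
    then have h: "hk a b D p = D p" by (simp add: hk_def)
    have Dp: "D p \<noteq> a" "D p \<noteq> b" "D p \<in> S" using old DS(1) DS(2)[of p] pq(1) by metis+
    have eq: "sep f p (D p) a = sep f p (D p) b"
      using adj2[OF pq(1) old(1,2)] adj2[OF Dp(3,1,2)] by (simp add: sep_def)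
    have nc': "sep f p (D p) x = sep f p (D p) (D x)" if "x \<in> S" "x \<noteq> p" "x \<noteq> D p" for x
      using nc pq that by blast
    have "sep f p (D p) a = sep f p (D p) (D a)" "sep f p (D p) b = sep f p (D p) (D b)"
      using nc' ab(1,2) old Dp by metis+
    moreover have "sep f p (D p) q = sep f p (D p) (D q)"
      using nc' pq h by metis
    ultimately show ?thesis using eq unfolding h by (simp add: hk_def DS(1))
  qed
qed

lemma inj_ppos: "inj_on (ppos n) (pts n)"
  by (auto simp: inj_on_def ppos_def pts_def split: if_splits)

lemma is_diagram_iff:
  "is_diagram n D \<longleftrightarrow> matching_on (pts n) D \<and> (\<forall>p\<in>pts n. \<forall>q\<in>pts n. q \<noteq> p \<longrightarrow> q \<noteq> D p \<longrightarrow>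
     sep (ppos n) p (D p) q = sep (ppos n) p (D p) (D q))"
proof -
  have "is_diagram n D \<longleftrightarrow> matching_on (pts n) D \<and> (\<forall>p\<in>pts n. \<forall>q\<in>pts n.
      \<not> (ppos n p < ppos n q \<and> ppos n q < ppos n (D p) \<and> ppos n (D p) < ppos n (D q)))"
    unfolding is_diagram_def matching_on_def by (simp only: conj_assoc)
  then show ?thesis using noncrossing_iff_sep[OF _ inj_ppos, of n D] by metis
qed

text \<open>The result of stacking t_i on top of a diagram, with loops forgotten. If the top points
  i and i + 1 are already joined, the clauses of \<open>hk\<close> return the diagram itself; the
  loop that closes then is accounted for by \<open>loopfac\<close>.\<close>

definition hook :: "nat \<Rightarrow> (pt \<Rightarrow> pt) \<Rightarrow> pt \<Rightarrow> pt" where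
  "hook i = hk (True, i) (True, i + 1)"

lemma diagrams_matching: "D \<in> diagrams n \<Longrightarrow> matching_on (pts n) D"
  by (simp add: diagrams_def is_diagram_iff)

lemma hook_diagram:
  assumes "D \<in> diagrams n" "i \<in> {1..<n}" shows "hook i D \<in> diagrams n"
proof -
  have "(True, i) \<in> pts n" "(True, i + 1) \<in> pts n" using assms by (auto simp: pts_def)
  with assms show ?thesis
    unfolding diagrams_def hook_def mem_Collect_eq is_diagram_iff
    by (intro conjI matching_hk noncrossing_hk) (auto simp: inj_ppos ppos_def)
qed

lemma id_diag_diagram: "id_diag n \<in> diagrams n"
proof -
  have [simp]: "id_diag n (c, j) = (\<not> c, j)" if "(c, j) \<in> pts n" for c j
    using that by (simp add: id_diag_def)
  have [simp]: "(\<not> c, j) \<in> pts n \<longleftrightarrow> (c, j) \<in> pts n" for c j by (auto simp: pts_def)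
  have "\<not> (ppos n (c, j) < ppos n (c', l) \<and> ppos n (c', l) < ppos n (\<not> c, j) \<and>
      ppos n (\<not> c, j) < ppos n (\<not> c', l))" if "(c, j) \<in> pts n" "(c', l) \<in> pts n" for c j c' l
    using that by (cases c; cases c') (auto simp: ppos_def pts_def)
  then show ?thesis by (auto simp: diagrams_def is_diagram_def) (auto simp: id_diag_def)
qed

lemma finite_diagrams: "finite (diagrams n)"
proof (rule finite_subset)
  show "diagrams n \<subseteq> {D. D permutes pts n}"
  proof
    fix D assume "D \<in> diagrams n"
    then have D: "matching_on (pts n) D" by (rule diagrams_matching)
    have "\<exists>!x. D x = y" for y
      by (rule ex1I[of _ "D y"]) (metis matching_onD(1)[OF D])+
    with D show "D \<in> {D. D permutes pts n}"
      unfolding permutes_def matching_on_def by simp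
  qed
  show "finite {D. D permutes pts n}" by (rule finite_permutations) (simp add: pts_def)
qed

section \<open>Stacking a generator on a Kauffman diagram\<close>

context
  fixes n i :: nat and D :: "pt \<Rightarrow> pt"
  assumes D: "matching_on (pts n) D" and i: "i \<in> {1..<n}"
begin

private abbreviation "a \<equiv> (True, i)"
private abbreviation "b \<equiv> (True, i + 1)"
private abbreviation "R \<equiv> stack_conn n (gen_diag n i) D"

private lemma Dinv: "D (D p) = p" "p \<in> pts n \<Longrightarrow> D p \<noteq> p" "D p = D q \<longleftrightarrow> p = q" "D p \<in> pts n \<longleftrightarrow> p \<in> pts n"
  using matching_onD[OF D] by auto

private lemma ab: "a \<in> pts n" "b \<in> pts n"
  using i by (auto simp: pts_def)

private lemma R1: "p \<in> pts n \<Longrightarrow> (lift1 p, lift1 (gen_diag n i p)) \<in> R"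
  and R2: "p \<in> pts n \<Longrightarrow> (lift2 p, lift2 (D p)) \<in> R"
  unfolding stack_conn_def by (rule r_into_rtrancl; blast)+

private lemma Rt: "(u, v) \<in> R \<Longrightarrow> (v, w) \<in> R \<Longrightarrow> (u, w) \<in> R"
  unfolding stack_conn_def by (rule rtrancl_trans)

private lemma Rr: "(u, u) \<in> R"
  unfolding stack_conn_def by simp

private lemma R_lift2: "p \<in> pts n \<Longrightarrow> p \<noteq> a \<Longrightarrow> p \<noteq> b \<Longrightarrow> (outer p, lift2 p) \<in> R"
  using R1[of p] by (cases p) (auto simp: outer_def lift1_def lift2_def gen_diag_def Rr split: if_splits)

text \<open>\<open>stack_conn\<close> is a closure of ordered pairs without a symmetry clause, so
  the way back from the middle row is read off from the bottom end of the same strand.\<close>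

private lemma R_lift2': "p \<in> pts n \<Longrightarrow> p \<noteq> a \<Longrightarrow> p \<noteq> b \<Longrightarrow> (lift2 p, outer p) \<in> R"
  using R1[of "(False, snd p)"] 
  by (cases p) (auto simp: outer_def lift1_def lift2_def gen_diag_def Rr pts_def split: if_splits)

private lemma R_ab: "(outer a, outer b) \<in> R" "(outer b, outer a) \<in> R"
    "(lift2 a, lift2 b) \<in> R" "(lift2 b, lift2 a) \<in> R"
  using R1[of a] R1[of b] R1[of "(False, i)"] R1[of "(False, i + 1)"] i
  by (auto simp: outer_def lift1_def lift2_def gen_diag_def pts_def)

private lemma hook_simps: "hook i D a = b" "hook i D b = a"
    "D a \<noteq> b \<Longrightarrow> hook i D (D a) = D b" "D a \<noteq> b \<Longrightarrow> hook i D (D b) = D a"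
    "p \<noteq> a \<Longrightarrow> p \<noteq> b \<Longrightarrow> D p \<noteq> a \<Longrightarrow> D p \<noteq> b \<Longrightarrow> hook i D p = D p"
  using ab Dinv(1) Dinv(2)[of a] Dinv(2)[of b] unfolding hook_def hk_def by metis+

text \<open>Existence for the description in \<open>dcomp\<close>; uniqueness comes from the label
  defined next.\<close>

private lemma hook_conn: assumes p: "p \<in> pts n" shows "(outer p, outer (hook i D p)) \<in> R"
proof -
  have out: "(outer p, lift2 (D p)) \<in> R" if "p \<noteq> a" "p \<noteq> b"
    by (rule Rt[OF R_lift2[OF p that] R2[OF p]])
  have far: "(lift2 q, outer (D q)) \<in> R" if "q \<in> pts n" "D q \<noteq> a" "D q \<noteq> b" for q
    using Rt[OF R2[OF that(1)] R_lift2'[OF _ that(2,3)]] that(1) Dinv(4) by blast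
  show ?thesis
  proof (cases "p = a \<or> p = b")
    case True then show ?thesis using R_ab(1,2) hook_simps(1,2) by metis
  next
    case False
    have "(outer p, outer (D b)) \<in> R" if "p = D a"
    proof -
      have "D p = a" "D b \<noteq> a" "D b \<noteq> b" using that False Dinv(1) Dinv(2)[OF ab(2)] by metis+
      with out False have "(outer p, lift2 a) \<in> R" by simp
      from Rt[OF Rt[OF this R_ab(3)] far[OF ab(2)]] \<open>D b \<noteq> a\<close> \<open>D b \<noteq> b\<close> show ?thesis .
    qed
    moreover have "(outer p, outer (D a)) \<in> R" if "p = D b"
    proof -
      have "D p = b" "D a \<noteq> b" "D a \<noteq> a" using that False Dinv(1) Dinv(2)[OF ab(1)] by metis+
      with out False have "(outer p, lift2 b) \<in> R" by simp
      from Rt[OF Rt[OF this R_ab(4)] far[OF ab(1)]] \<open>D a \<noteq> a\<close> \<open>D a \<noteq> b\<close> show ?thesis .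
    qed
    moreover have "(outer p, outer (D p)) \<in> R" if "p \<noteq> D a" "p \<noteq> D b"
    proof -
      have "D p \<noteq> a" "D p \<noteq> b" using that Dinv(1) by metis+
      with Rt[OF R_lift2[OF p] far[OF p]] False show ?thesis by simp
    qed
    ultimately show ?thesis using False unfolding hook_def hk_def by presburger
  qed
qed

text \<open>A label of the vertices of the stacked picture that is constant on components: the pair of
  boundary points of the component, or the empty set for the closed loop.\<close>

private definition lab :: "nat \<times> nat \<Rightarrow> pt set" where
  "lab v = (if v = (1, i) \<or> v = (1, i + 1) then (if D a = b then {} else {D a, D b})
     else {(fst v \<le> 1, snd v), hook i D (fst v \<le> 1, snd v)})"

private lemma lab_outer: "lab (outer p) = {p, hook i D p}"
  by (cases p; cases "fst p") (simp_all add: lab_def outer_def)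

private lemma lab_lift2: "lab (lift2 p) = (if p = a \<or> p = b then (if D a = b then {} else {D a, D b})
     else {p, hook i D p})"
  by (cases p; cases "fst p") (simp_all add: lab_def lift2_def)

private lemma lab_lift1: "lab (lift1 p) = (if p = (False, i) \<or> p = (False, i + 1) then
     (if D a = b then {} else {D a, D b}) else {(True, snd p), hook i D (True, snd p)})"
  by (cases p; cases "fst p") (simp_all add: lab_def lift1_def)

private lemma lab_conn: "(u, v) \<in> R \<Longrightarrow> lab u = lab v"
  unfolding stack_conn_def
proof (induction rule: rtrancl_induct)
  case (step v w)
  have 1: "lab (lift1 p) = lab (lift1 (gen_diag n i p))" if "p \<in> pts n" for p
    using that hook_simps(1,2) unfolding lab_lift1
    by (cases p) (simp add: gen_diag_def insert_commute)
  have 2: "lab (lift2 p) = lab (lift2 (D p))" if p: "p \<in> pts n" for p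
  proof -
    consider "p = a" | "p = b" | "p \<noteq> a" "p \<noteq> b" "D p = a" | "p \<noteq> a" "p \<noteq> b" "D p = b"
      | "p \<noteq> a" "p \<noteq> b" "D p \<noteq> a" "D p \<noteq> b" by blast
    then show ?thesis
    proof cases
      case 1
      have "D a \<noteq> a" using Dinv(2) ab by blast
      with 1 show ?thesis using hook_simps(3) unfolding lab_lift2 by simp
    next
      case 2
      have "D b \<noteq> b" "D b = a \<longleftrightarrow> D a = b" using Dinv(1,2) ab by metis+
      with 2 show ?thesis using hook_simps(4) unfolding lab_lift2 by (simp add: insert_commute)
    next
      case 3
      then have "p = D a" using Dinv(1) by metis
      with 3 show ?thesis using hook_simps(3) Dinv(1) unfolding lab_lift2 by (simp add: insert_commute)
    next
      case 4
      then have "p = D b" "D a \<noteq> b" using Dinv(1) by metis+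
      with 4 show ?thesis using hook_simps(4) Dinv(1) unfolding lab_lift2 by (simp add: insert_commute)
    next
      case 5
      then have "hook i D p = D p" "hook i D (D p) = p"
        using hook_simps(5)[of p] hook_simps(5)[of "D p"] Dinv(1) by metis+
      with 5 show ?thesis unfolding lab_lift2 by (simp add: insert_commute)
    qed
  qed
  from step 1 2 show ?case by auto
qed simp

lemma dcomp_gen: "dcomp n (gen_diag n i) D = hook i D"
proof
  fix p
  have M: "matching_on (pts n) (hook i D)"
    using matching_hk[OF D ab] by (simp add: hook_def)
  show "dcomp n (gen_diag n i) D p = hook i D p"
  proof (cases "p \<in> pts n")
    case True
    have "(THE q. q \<in> pts n \<and> q \<noteq> p \<and> (outer p, outer q) \<in> R) = hook i D p"
    proof (rule the_equality)
      show "hook i D p \<in> pts n \<and> hook i D p \<noteq> p \<and> (outer p, outer (hook i D p)) \<in> R"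
        using hook_conn True M by (auto simp: matching_on_def)
      fix q assume "q \<in> pts n \<and> q \<noteq> p \<and> (outer p, outer q) \<in> R"
      then show "q = hook i D p"
        using lab_conn[of "outer p" "outer q"] unfolding lab_outer by auto
    qed
    with True show ?thesis by (simp add: dcomp_def)
  next
    case False
    with M have "hook i D p = p" unfolding matching_on_def by blast
    with False show ?thesis by (simp add: dcomp_def)
  qed
qed

text \<open>Every middle point reaches the boundary, except that i and i + 1 are cut off when
  \<open>D\<close> joins them; then the two form one class, which the empty label separates from the
  boundary.\<close>

lemma dloops_gen: "dloops n (gen_diag n i) D = (if D (True, i) = (True, i + 1) then 1 else 0)"
proof -
  have mid: "\<exists>p\<in>pts n. (outer p, (1, j)) \<in> R" if "j \<in> {1..n}" "D a \<noteq> b \<or> j \<noteq> i \<and> j \<noteq> i + 1" for j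
  proof (cases "j = i \<or> j = i + 1")
    case False
    then show ?thesis using R_lift2[of "(True, j)"] that
      by (intro bexI[of _ "(True, j)"]) (auto simp: lift2_def pts_def)
  next
    case True
    with that have ne: "D a \<noteq> b" "D a \<noteq> a" "D a \<in> pts n" using Dinv ab by auto
    have "(outer (D a), lift2 a) \<in> R"
      using Rt[OF R_lift2[OF ne(3,2,1)] R2[OF ne(3)]] by (simp add: Dinv)
    then have "(outer (D a), lift2 a) \<in> R" "(outer (D a), lift2 b) \<in> R"
      using Rt R_ab by blast+
    with True ne show ?thesis by (intro bexI[of _ "D a"]) (auto simp: lift2_def)
  qed
  show ?thesis
  proof (cases "D a = b")
    case False
    then have X: "{1} \<times> {1..n} - {v. \<exists>p\<in>pts n. (outer p, v) \<in> R} = {}" using mid by auto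
    from False show ?thesis unfolding dloops_def X by (simp add: quotient_def)
  next
    case True
    have "(outer p, v) \<notin> R" if "v = (1, i) \<or> v = (1, i + 1)" for p v
      using lab_conn[of "outer p" v] that True unfolding lab_outer by (auto simp: lab_def)
    then have Z: "(\<exists>p\<in>pts n. (outer p, (1, j)) \<in> R) \<longleftrightarrow> j \<noteq> i \<and> j \<noteq> i + 1" if "j \<in> {1..n}" for j
      using mid[OF that] by blast
    have X: "{1} \<times> {1..n} - {v. \<exists>p\<in>pts n. (outer p, v) \<in> R} = {(1, i), (1, i + 1)}"
    proof (rule set_eqI)
      fix x :: "nat \<times> nat"
      obtain l j where x: "x = (l, j)" by (cases x)
      show "x \<in> {1} \<times> {1..n} - {v. \<exists>p\<in>pts n. (outer p, v) \<in> R} \<longleftrightarrow> x \<in> {(1, i), (1, i + 1)}"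
        using Z[of j] i unfolding x by (cases "l = 1 \<and> j \<in> {1..n}") (simp, auto)
    qed
    have "((1, i), (1, i + 1)) \<in> R" "((1, i + 1), (1, i)) \<in> R"
      using R_ab(3,4) by (simp_all add: lift2_def)
    then have "R `` {(1, i)} = R `` {(1, i + 1)}" using Rt by blast
    with True show ?thesis unfolding dloops_def X by (simp add: quotient_def)
  qed
qed

end

section \<open>Stacking the identity diagram\<close>

lemma stack_id_conn: assumes D: "matching_on (pts n) D" and p: "p \<in> pts n" shows "(outer p, outer (D p)) \<in> stack_conn n (id_diag n) D"
    "(outer p, lift2 p) \<in> stack_conn n (id_diag n) D"
proof -
  let ?R = "stack_conn n (id_diag n) D"
  have R1: "(lift1 q, lift1 (id_diag n q)) \<in> ?R" and R2: "(lift2 q, lift2 (D q)) \<in> ?R" if "q \<in> pts n" for q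
    using that unfolding stack_conn_def by (rule_tac r_into_rtrancl, blast)+
  have Rr: "(u, u) \<in> ?R" for u unfolding stack_conn_def by simp
  have up: "(outer q, lift2 q) \<in> ?R" if "q \<in> pts n" for q
    using R1[OF that] that
    by (cases q) (auto simp: outer_def lift1_def lift2_def id_diag_def Rr split: if_splits)
  have down: "(lift2 q, outer q) \<in> ?R" if "q \<in> pts n" for q
    using R1[of "(False, snd q)"] that
    by (cases q) (auto simp: outer_def lift1_def lift2_def id_diag_def Rr pts_def split: if_splits)
  show "(outer p, lift2 p) \<in> ?R" using up p by blast
  have "(outer p, lift2 (D p)) \<in> ?R"
    using up[OF p] R2[OF p] unfolding stack_conn_def by (rule rtrancl_trans)
  then show "(outer p, outer (D p)) \<in> ?R"
    using down[of "D p"] matching_onD(4)[OF D] p unfolding stack_conn_def by (meson rtrancl_trans)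
qed

text \<open>A middle vertex stands for the top point above it. With this reading the pair of end
  points is an invariant of the component.\<close>

lemma stack_id_lab:
  assumes D: "matching_on (pts n) D" and "(u, v) \<in> stack_conn n (id_diag n) D"
  shows "{(fst u \<le> 1, snd u), D (fst u \<le> 1, snd u)} = {(fst v \<le> 1, snd v), D (fst v \<le> 1, snd v)}"
  using assms(2) unfolding stack_conn_def
proof (induction rule: rtrancl_induct)
  case (step v w)
  have lift1: "(fst (lift1 p) \<le> 1, snd (lift1 p)) = (True, snd p)"
    and lift2: "(fst (lift2 p) \<le> 1, snd (lift2 p)) = p" for p
    by (auto simp: lift1_def lift2_def prod_eq_iff)
  from step.hyps(2) consider p where "p \<in> pts n" "v = lift1 p" "w = lift1 (id_diag n p)"
    | p where "v = lift2 p" "w = lift2 (D p)" by blast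
  then have "{(fst v \<le> 1, snd v), D (fst v \<le> 1, snd v)} = {(fst w \<le> 1, snd w), D (fst w \<le> 1, snd w)}"
  proof cases
    case 1
    then have "snd (id_diag n p) = snd p" by (simp add: id_diag_def)
    with 1 show ?thesis by (simp only: lift1)
  next
    case 2
    then show ?thesis by (simp only: lift2 matching_onD(1)[OF D] insert_commute)
  qed
  with step.IH show ?case by simp
qed simp

lemma dcomp_id:
  assumes D: "matching_on (pts n) D" shows "dcomp n (id_diag n) D = D"
proof
  fix p
  show "dcomp n (id_diag n) D p = D p"
  proof (cases "p \<in> pts n")
    case True
    have "(THE q. q \<in> pts n \<and> q \<noteq> p \<and> (outer p, outer q) \<in> stack_conn n (id_diag n) D) = D p"
    proof (rule the_equality)
      show "D p \<in> pts n \<and> D p \<noteq> p \<and> (outer p, outer (D p)) \<in> stack_conn n (id_diag n) D"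
        using stack_id_conn(1)[OF D True] True D by (auto simp: matching_on_def)
      fix q assume q: "q \<in> pts n \<and> q \<noteq> p \<and> (outer p, outer q) \<in> stack_conn n (id_diag n) D"
      have "(fst (outer r) \<le> 1, snd (outer r)) = r" for r by (auto simp: outer_def prod_eq_iff)
      then show "q = D p"
        using stack_id_lab[OF D, of "outer p" "outer q"] q by auto
    qed
    with True show ?thesis by (simp add: dcomp_def)
  next
    case False
    with D have "D p = p" unfolding matching_on_def by blast
    with False show ?thesis by (simp add: dcomp_def)
  qed
qed

lemma dloops_id:
  assumes D: "matching_on (pts n) D" shows "dloops n (id_diag n) D = 0"
proof -
  have "\<exists>p\<in>pts n. (outer p, (1, j)) \<in> stack_conn n (id_diag n) D" if "j \<in> {1..n}" for j
    using stack_id_conn(2)[OF D, of "(True, j)"] that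
    by (intro bexI[of _ "(True, j)"]) (auto simp: lift2_def pts_def)
  then have X: "{1} \<times> {1..n} - {v. \<exists>p\<in>pts n. (outer p, v) \<in> stack_conn n (id_diag n) D} = {}"
    by auto
  show ?thesis unfolding dloops_def X by (simp add: quotient_def)
qed

section \<open>Coxeter presentation of the symmetric group\<close>

definition word_perm :: "nat list \<Rightarrow> nat \<Rightarrow> nat" where
  "word_perm ws = foldr (\<lambda>i v. v \<circ> sadj i) ws id"

lemma word_perm_simps [simp]:
  "word_perm [] = id" "word_perm (i # ws) = word_perm ws \<circ> sadj i"
  by (simp_all add: word_perm_def)

lemma word_perm_append: "word_perm (us @ ws) = word_perm ws \<circ> word_perm us"
  by (induction us) (auto simp: fun_eq_iff)

lemma sadj_sadj [simp]: "sadj i (sadj i x) = x"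
  by (simp add: sadj_def)

lemma word_perm_rev: "word_perm (ws @ rev ws) = id" "word_perm (rev ws @ ws) = id"
  by (induction ws rule: rev_induct) (auto simp: word_perm_append fun_eq_iff)

lemma word_perm_permutes: "set ws \<subseteq> {1..<n} \<Longrightarrow> word_perm ws permutes {1..n}"
proof (induction ws)
  case (Cons i ws)
  then have "sadj i permutes {1..n}"
    unfolding sadj_def by (intro permutes_swap_id) auto
  with Cons show ?case by (auto simp: o_def intro: permutes_compose[unfolded o_def])
qed (auto simp: permutes_id)

text \<open>Operators of this kind factor through the symmetric group. This is the word independence
  that the description in \<open>theta_perm\<close> requires.\<close>

locale coxeter_ops =
  fixes V :: "'v set" and L :: "nat \<Rightarrow> 'v \<Rightarrow> 'v" and N :: nat
  assumes closed: "i \<in> {1..<N} \<Longrightarrow> v \<in> V \<Longrightarrow> L i v \<in> V"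
    and invol: "i \<in> {1..<N} \<Longrightarrow> v \<in> V \<Longrightarrow> L i (L i v) = v"
    and far: "i \<in> {1..<N} \<Longrightarrow> j \<in> {1..<N} \<Longrightarrow> i + 1 < j \<Longrightarrow> v \<in> V \<Longrightarrow> L i (L j v) = L j (L i v)"
    and braid: "i \<in> {1..<N} \<Longrightarrow> Suc i \<in> {1..<N} \<Longrightarrow> v \<in> V \<Longrightarrow>
       L i (L (Suc i) (L i v)) = L (Suc i) (L i (L (Suc i) v))"
begin

definition ok :: "nat list \<Rightarrow> bool" where "ok ws \<longleftrightarrow> set ws \<subseteq> {1..<N}"

text \<open>Operator and permutation are tracked together: each rewriting step is done once, and the
  permutation later tells which normal form has been reached.\<close>

definition eqv :: "nat list \<Rightarrow> nat list \<Rightarrow> bool" (infix "\<approx>" 50) where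
  "us \<approx> ws \<longleftrightarrow> ok us \<and> ok ws \<and> (\<forall>v\<in>V. foldr L us v = foldr L ws v) \<and>
     word_perm us = word_perm ws"

lemma act_closed: "ok ws \<Longrightarrow> v \<in> V \<Longrightarrow> foldr L ws v \<in> V"
  by (induction ws) (auto simp: ok_def closed)

lemma ok_append [simp]: "ok (us @ ws) \<longleftrightarrow> ok us \<and> ok ws"
  by (auto simp: ok_def)

lemma eqv_refl: "ok ws \<Longrightarrow> ws \<approx> ws"
  and eqv_trans [trans]: "us \<approx> ws \<Longrightarrow> ws \<approx> xs \<Longrightarrow> us \<approx> xs"
  by (auto simp: eqv_def)

lemma eqv_append: "us \<approx> us' \<Longrightarrow> ws \<approx> ws' \<Longrightarrow> us @ ws \<approx> us' @ ws'"
  by (auto simp: eqv_def act_closed word_perm_append)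

lemma eqv_inner: "us \<approx> ws \<Longrightarrow> ok xs \<Longrightarrow> ok ys \<Longrightarrow> xs @ us @ ys \<approx> xs @ ws @ ys"
  by (intro eqv_append eqv_refl)

lemma eqv_commute_word:
  assumes "ok (i # ws)" "\<forall>j\<in>set ws. i + 1 < j \<or> j + 1 < i"
  shows "ws @ [i] \<approx> i # ws"
  using assms
proof (induction ws)
  case Nil then show ?case by (simp add: eqv_refl)
next
  case (Cons j ws)
  then have "[j] @ (ws @ [i]) \<approx> [j] @ (i # ws)"
    by (intro eqv_append eqv_refl) (auto simp: ok_def)
  also have "[j, i] \<approx> [i, j]"
    using Cons.prems by (auto simp: eqv_def ok_def fun_eq_iff sadj_def transpose_def intro: far far[symmetric])
  then have "[j] @ (i # ws) \<approx> i # j # ws"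
    using Cons.prems eqv_append[of "[j, i]" "[i, j]" ws ws] by (auto simp: ok_def eqv_refl)
  finally show ?case by simp
qed

text \<open>The words \<open>s\<^sub>m \<dots> s\<^sub>j\<close> represent the cosets of \<open>S\<^sub>m\<close> in \<open>S\<^sub>m\<^sub>+\<^sub>1\<close>.\<close>

definition down :: "nat \<Rightarrow> nat \<Rightarrow> nat list" where "down m j = rev [j..<Suc m]"

lemma ok_down: "1 \<le> j \<Longrightarrow> m < N \<Longrightarrow> ok (down m j)"
  by (auto simp: ok_def down_def)

lemma down_split: "j \<le> i \<Longrightarrow> i \<le> m \<Longrightarrow> down m j = down m (Suc i) @ down i j"
  unfolding down_def rev_append[symmetric] using upt_add_eq_append[of j "Suc i" "m - i"] by auto

lemma down_Cons: "1 \<le> j \<Longrightarrow> j \<le> m \<Longrightarrow> down m j = m # down (m - 1) j"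
  by (cases m) (auto simp: down_def)

lemma down_snoc: "j \<le> m \<Longrightarrow> down m j = down m (Suc j) @ [j]"
  by (simp add: down_def upt_conv_Cons)

text \<open>A letter i with i + 1 < j commutes to the left, i = j - 1 lengthens the coset word, and
  i = j cancels its last letter. For j < i a braid move lets s_i leave on the left as the letter i -
  1. The value j = m + 1 is the empty word, the trivial coset.\<close>

lemma down_step:
  assumes "m < N" "1 \<le> j" "j \<le> Suc m" "1 \<le> i" "i \<le> m"
  shows "\<exists>u j'. set u \<subseteq> {1..<m} \<and> 1 \<le> j' \<and> j' \<le> Suc m \<and> down m j @ [i] \<approx> u @ down m j'"
proof -
  consider "i + 1 < j" | "i + 1 = j" | "i = j" | "j < i" by linarith
  then show ?thesis
  proof cases
    case 1
    then have "down m j @ [i] \<approx> [i] @ down m j"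
      using eqv_commute_word[of i "down m j"] assms by (auto simp: down_def ok_def simp del: upt_Suc)
    with 1 assms show ?thesis by (intro exI[of _ "[i]"] exI[of _ j]) auto
  next
    case 2
    then have "down m j @ [i] = down m i" using down_snoc[of i m] assms by auto
    moreover have "down m i \<approx> down m i" using assms by (intro eqv_refl ok_down)
    ultimately show ?thesis using assms by (intro exI[of _ "[]"] exI[of _ i]) auto
  next
    case 3
    have "[i] @ [i] \<approx> []" using assms by (auto simp: eqv_def ok_def invol fun_eq_iff)
    then have "down m (Suc i) @ ([i] @ [i]) \<approx> down m (Suc i) @ []"
      using assms by (intro eqv_append eqv_refl ok_down) auto
    with 3 down_snoc[of i m] assms show ?thesis
      by (intro exI[of _ "[]"] exI[of _ "Suc i"]) auto
  next
    case 4
    then obtain h where h: "i = Suc h" by (cases i) auto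
    have d: "down m j = down m (Suc i) @ [i, h] @ down (h - 1) j"
      using down_split[of j i m] down_Cons[of j i] down_Cons[of j h] 4 assms h by simp
    have oks: "ok (down m (Suc i))" "ok (down (h - 1) j)" "ok [i, h]" "ok [h]" "ok [i]"
      using assms 4 h by (auto simp: ok_def down_def)
    have "down (h - 1) j @ [i] \<approx> i # down (h - 1) j"
      using 4 assms h by (intro eqv_commute_word) (auto simp: ok_def down_def)
    then have "(down m (Suc i) @ [i, h]) @ (down (h - 1) j @ [i])
        \<approx> (down m (Suc i) @ [i, h]) @ (i # down (h - 1) j)"
      using oks by (intro eqv_append eqv_refl) auto
    then have "down m j @ [i] \<approx> down m (Suc i) @ [i, h, i] @ down (h - 1) j"
      by (simp add: d)
    also have "\<dots> \<approx> down m (Suc i) @ [h, i, h] @ down (h - 1) j"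
      using oks braid[of h] h by (intro eqv_inner) (auto simp: ok_def eqv_def fun_eq_iff sadj_def transpose_def)
    also have comm: "down m (Suc i) @ [h] \<approx> [h] @ down m (Suc i)"
      using eqv_commute_word[of h "down m (Suc i)"] 4 assms h by (auto simp: ok_def down_def simp del: upt_Suc)
    have "(down m (Suc i) @ [h]) @ ([i, h] @ down (h - 1) j)
        \<approx> ([h] @ down m (Suc i)) @ ([i, h] @ down (h - 1) j)"
      using oks by (intro eqv_append[OF comm eqv_refl]) (auto simp: ok_def)
    then have "down m (Suc i) @ [h, i, h] @ down (h - 1) j \<approx> [h] @ down m j"
      by (simp add: d)
    finally show ?thesis using 4 assms h by (intro exI[of _ "[h]"] exI[of _ j]) auto
  qed
qed

lemma normal_form:
  assumes "m < N" "set ws \<subseteq> {1..<Suc m}"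
  shows "\<exists>u j. set u \<subseteq> {1..<m} \<and> 1 \<le> j \<and> j \<le> Suc m \<and> ws \<approx> u @ down m j"
  using assms(2)
proof (induction ws rule: rev_induct)
  case Nil
  then show ?case
    by (intro exI[of _ "[]"] exI[of _ "Suc m"]) (auto simp: down_def eqv_def ok_def)
next
  case (snoc i ws)
  then obtain u j where u: "set u \<subseteq> {1..<m}" "1 \<le> j" "j \<le> Suc m" "ws \<approx> u @ down m j"
    by auto
  obtain u' j' where u': "set u' \<subseteq> {1..<m}" "1 \<le> j'" "j' \<le> Suc m" "down m j @ [i] \<approx> u' @ down m j'"
    using down_step[OF assms(1) u(2,3), of i] snoc.prems by auto
  have "ws @ [i] \<approx> (u @ down m j) @ [i]"
    using u(4) snoc.prems assms by (intro eqv_append eqv_refl) (auto simp: ok_def)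
  also have "u @ (down m j @ [i]) \<approx> u @ (u' @ down m j')"
    using u(1) assms(1) by (intro eqv_append[OF eqv_refl u'(4)]) (auto simp: ok_def)
  then have "(u @ down m j) @ [i] \<approx> u @ (u' @ down m j')" by simp
  finally show ?case using u u' by (intro exI[of _ "u @ u'"] exI[of _ j']) auto
qed

lemma word_perm_down: "1 \<le> j \<Longrightarrow> j \<le> Suc m \<Longrightarrow> word_perm (down m j) (Suc m) = j"
proof (induction m arbitrary: j)
  case 0 then show ?case by (cases j) (auto simp: down_def sadj_def)
next
  case (Suc m)
  show ?case
  proof (cases "j \<le> Suc m")
    case True
    with Suc.IH[OF Suc.prems(1)] Suc.prems(1) show ?thesis by (simp add: down_Cons[of j "Suc m"] sadj_def)
  next
    case False
    with Suc.prems have "j = Suc (Suc m)" by simp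
    then show ?thesis by (simp add: down_def)
  qed
qed

text \<open>The prefix \<open>u\<close> fixes m + 1, so the image of m + 1 under the whole word is
  j. For the identity this forces j = m + 1, an empty coset word, and the induction on m takes care
  of \<open>u\<close>.\<close>

lemma eqv_word_perm_id:
  assumes "m \<le> N" "set ws \<subseteq> {1..<m}" "word_perm ws = id"
  shows "ws \<approx> []"
  using assms
proof (induction m arbitrary: ws)
  case 0 then show ?case by (auto simp: eqv_refl ok_def)
next
  case (Suc m)
  obtain u j where u: "set u \<subseteq> {1..<m}" "1 \<le> j" "j \<le> Suc m" "ws \<approx> u @ down m j"
    using normal_form[of m ws] Suc.prems by auto
  have id: "word_perm (down m j) \<circ> word_perm u = id"
    using u(4)[unfolded eqv_def word_perm_append] Suc.prems(3) by metis
  have "word_perm u (Suc m) = Suc m"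
    using word_perm_permutes[OF u(1)] by (intro permutes_not_in) auto
  with id word_perm_down[OF u(2,3)] have "j = Suc m"
    by (metis comp_apply id_apply)
  then have d: "down m j = []" by (simp add: down_def)
  with id have "word_perm u = id" by simp
  with Suc.IH[of u] u Suc.prems have "u \<approx> []" by simp
  with u d show ?case using eqv_trans by auto
qed

lemma act_word_perm_eq:
  assumes "set us \<subseteq> {1..<N}" "set ws \<subseteq> {1..<N}" "word_perm us = word_perm ws" "v \<in> V"
  shows "foldr L us v = foldr L ws v"
proof -
  have "rev us @ ws \<approx> []"
    using assms(1-3) word_perm_append word_perm_rev(2)
    by (intro eqv_word_perm_id[of N]) (simp_all, metis)
  then have "us @ rev us @ ws \<approx> us @ []"
    using assms by (intro eqv_append eqv_refl) (auto simp: ok_def)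
  moreover have "us @ rev us \<approx> []"
    using assms by (intro eqv_word_perm_id[of N]) (auto simp: word_perm_rev)
  then have "(us @ rev us) @ ws \<approx> [] @ ws"
    using assms by (intro eqv_append eqv_refl) (auto simp: ok_def)
  ultimately show ?thesis using assms(4) by (simp add: eqv_def)
qed

end

section \<open>The Temperley-Lieb action and theta\<close>

text \<open>Both sides are 2 to the number of loops closed when two distant hooks are stacked, in
  either order. If neither pair is joined beforehand, the second hook closes a loop exactly when
  \<open>d\<close> matches \<open>{a, b}\<close> with \<open>{c, e}\<close>, which is symmetric in
  the two pairs.\<close>

lemma hk_loops:
  assumes d: "matching_on S d" and ne: "distinct [a, b, c, e]"
  shows "(if d c = e then 2 else 1) * (if hk c e d a = b then 2 else (1 :: int))
       = (if d a = b then 2 else 1) * (if hk a b d c = e then 2 else 1)"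
proof -
  note D = matching_onD(1,3)[OF d]
  have ne: "a \<noteq> b" "a \<noteq> c" "a \<noteq> e" "b \<noteq> c" "b \<noteq> e" "c \<noteq> e" using ne by auto
  have 1: "hk c e d a = b" if "d a = b" using that ne D unfolding hk_def by metis
  have 2: "hk a b d c = e" if "d c = e" using that ne D unfolding hk_def by metis
  have 4: "hk a b d c \<noteq> e" if "d a = b" "d c \<noteq> e" using that ne D unfolding hk_def by metis
  have 5: "hk c e d a \<noteq> b" if "d a \<noteq> b" "d c = e" using that ne D unfolding hk_def by metis
  have 6: "hk c e d a = b \<longleftrightarrow> hk a b d c = e" if "d a \<noteq> b" "d c \<noteq> e"
  proof -
    have "hk c e d a = b \<longleftrightarrow> a = d c \<and> d e = b \<or> a = d e \<and> d c = b"
      by (cases "a = d c"; cases "a = d e") (use that ne D(2)[of c e] in \<open>simp_all add: hk_def\<close>)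
    moreover have "hk a b d c = e \<longleftrightarrow> c = d a \<and> d b = e \<or> c = d b \<and> d a = e"
      by (cases "c = d a"; cases "c = d b") (use that ne D(2)[of a b] in \<open>simp_all add: hk_def\<close>)
    moreover have "a = d c \<longleftrightarrow> c = d a" "d e = b \<longleftrightarrow> d b = e" "a = d e \<longleftrightarrow> d a = e" "d c = b \<longleftrightarrow> c = d b"
      using D by metis+
    ultimately show ?thesis by blast
  qed
  show ?thesis
    by (cases "d a = b"; cases "d c = e") (simp_all add: 1 2 4 5 6)
qed

lemma gen_diag_eq_hook:
  assumes "i \<in> {1..<n}" shows "gen_diag n i = hook i (id_diag n)"
proof
  fix p :: pt
  obtain c j where p: "p = (c, j)" by (cases p)
  show "gen_diag n i p = hook i (id_diag n) p"
    using assms unfolding p by (cases c) (simp_all add: gen_diag_def hook_def hk_def id_diag_def pts_def)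
qed

lemma gen_diag_diagram: "i \<in> {1..<n} \<Longrightarrow> gen_diag n i \<in> diagrams n"
  using gen_diag_eq_hook hook_diagram id_diag_diagram by metis

text \<open>The linear operator sending the basis diagram \<open>d\<close> to \<open>c d\<close>
  times \<open>h d\<close>. Left multiplication by a diagram has this form, so relations between
  such operators reduce to identities for the maps on diagrams and for their loop factors.\<close>

definition push :: "nat \<Rightarrow> ((pt \<Rightarrow> pt) \<Rightarrow> pt \<Rightarrow> pt) \<Rightarrow> ((pt \<Rightarrow> pt) \<Rightarrow> int) \<Rightarrow> tl \<Rightarrow> tl" where
  "push n h c a D = (\<Sum>d\<in>diagrams n. if h d = D then c d * a d else 0)"

lemma push_push:
  assumes "\<And>d. d \<in> diagrams n \<Longrightarrow> h d \<in> diagrams n"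
  shows "push n h' c' (push n h c a) = push n (\<lambda>d. h' (h d)) (\<lambda>d. c d * c' (h d)) a"
proof
  fix D
  have "push n h' c' (push n h c a) D =
      (\<Sum>e\<in>diagrams n. \<Sum>d\<in>diagrams n. if h d = e then (if h' e = D then c' e * (c d * a d) else 0) else 0)"
    unfolding push_def by (intro sum.cong refl) (simp add: sum_distrib_left if_distrib cong: if_cong)
  also have "\<dots> = (\<Sum>d\<in>diagrams n. \<Sum>e\<in>diagrams n. if h d = e then (if h' e = D then c' e * (c d * a d) else 0) else 0)"
    by (rule sum.swap)
  also have "\<dots> = push n (\<lambda>d. h' (h d)) (\<lambda>d. c d * c' (h d)) a D"
    unfolding push_def using assms finite_diagrams by (intro sum.cong refl) (simp add: algebra_simps)
  finally show "push n h' c' (push n h c a) D = push n (\<lambda>d. h' (h d)) (\<lambda>d. c d * c' (h d)) a D" .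
qed

lemma push_cong:
  assumes "\<And>d. d \<in> diagrams n \<Longrightarrow> h d = h' d" "\<And>d. d \<in> diagrams n \<Longrightarrow> c d = c' d"
  shows "push n h c a = push n h' c' a"
  unfolding push_def using assms by (intro ext sum.cong) auto

lemma push_lin: "push n h c (\<lambda>D. \<Sum>k\<in>S. x k * g k D) = (\<lambda>D. \<Sum>k\<in>S. x k * push n h c (g k) D)"
proof
  fix D
  have "push n h c (\<lambda>D. \<Sum>k\<in>S. x k * g k D) D = (\<Sum>d\<in>diagrams n. \<Sum>k\<in>S. if h d = D then c d * (x k * g k d) else 0)"
    unfolding push_def by (intro sum.cong refl) (simp add: sum_distrib_left)
  also have "\<dots> = (\<Sum>k\<in>S. \<Sum>d\<in>diagrams n. if h d = D then c d * (x k * g k d) else 0)"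
    by (rule sum.swap)
  also have "\<dots> = (\<Sum>k\<in>S. x k * push n h c (g k) D)"
    unfolding push_def by (intro sum.cong refl) (simp add: sum_distrib_left if_distrib algebra_simps cong: if_cong)
  finally show "push n h c (\<lambda>D. \<Sum>k\<in>S. x k * g k D) D = (\<Sum>k\<in>S. x k * push n h c (g k) D)" .
qed

lemma push_diff: "push n h c (\<lambda>D. x D - y D) D = push n h c x D - push n h c y D"
  unfolding push_def by (simp add: sum_subtractf[symmetric] algebra_simps if_distrib cong: if_cong)

lemma push_basis:
  assumes "d \<in> diagrams n"
  shows "push n h c (tl_basis d) = (\<lambda>D. c d * tl_basis (h d) D)"
proof
  fix D
  have "push n h c (tl_basis d) D = (\<Sum>e\<in>diagrams n. if e = d then (if h d = D then c d else 0) else 0)"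
    unfolding push_def tl_basis_def by (intro sum.cong refl) auto
  also have "\<dots> = (if h d = D then c d else 0)"
    using assms finite_diagrams by simp
  finally show "push n h c (tl_basis d) D = c d * tl_basis (h d) D"
    by (auto simp: tl_basis_def)
qed

text \<open>\<open>tl_mult\<close> discards coefficients at functions that are not diagrams, so
  \<open>tl_one\<close> is a left unit on this space only.\<close>

definition tl_space :: "nat \<Rightarrow> tl set" where
  "tl_space n = {a. \<forall>D. D \<notin> diagrams n \<longrightarrow> a D = 0}"

lemma push_space:
  assumes "\<And>d. d \<in> diagrams n \<Longrightarrow> h d \<in> diagrams n" shows "push n h c a \<in> tl_space n"
  unfolding tl_space_def push_def using assms by (auto intro!: sum.neutral)

lemma tl_mult_basis:
  assumes "g \<in> diagrams n"
  shows "tl_mult n (tl_basis g) a = push n (dcomp n g) (\<lambda>d. 2 ^ dloops n g d) a"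
proof
  fix D
  have "tl_mult n (tl_basis g) a D = (\<Sum>d1\<in>diagrams n. if d1 = g then
      (\<Sum>d2\<in>diagrams n. if dcomp n g d2 = D then 2 ^ dloops n g d2 * a d2 else 0) else 0)"
    unfolding tl_mult_def tl_basis_def by (intro sum.cong refl) (auto intro!: sum.cong sum.neutral)
  then show "tl_mult n (tl_basis g) a D = push n (dcomp n g) (\<lambda>d. 2 ^ dloops n g d) a D"
    using assms finite_diagrams by (simp add: push_def)
qed

definition loopfac :: "nat \<Rightarrow> (pt \<Rightarrow> pt) \<Rightarrow> int" where
  "loopfac i d = (if d (True, i) = (True, i + 1) then 2 else 1)"

lemma tl_mult_gen:
  assumes "i \<in> {1..<n}" shows "tl_mult n (tl_gen n i) a = push n (hook i) (loopfac i) a"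
  unfolding tl_gen_def tl_mult_basis[OF gen_diag_diagram[OF assms]]
  using assms by (intro push_cong) (simp_all add: dcomp_gen dloops_gen diagrams_matching loopfac_def)

lemma tl_mult_one:
  assumes "a \<in> tl_space n" shows "tl_mult n (tl_one n) a = a"
proof -
  have "tl_mult n (tl_one n) a = push n (\<lambda>d. d) (\<lambda>d. 1) a"
    unfolding tl_one_def tl_mult_basis[OF id_diag_diagram]
    by (intro push_cong) (simp_all add: dcomp_id dloops_id diagrams_matching)
  also have "\<dots> = a"
    using assms finite_diagrams by (auto simp: push_def tl_space_def)
  finally show ?thesis .
qed

abbreviation tl_refl :: "nat \<Rightarrow> nat \<Rightarrow> tl \<Rightarrow> tl" where
  "tl_refl n i a \<equiv> tl_mult n (\<lambda>D. tl_gen n i D - tl_one n D) a"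

lemma tl_refl_eq:
  assumes "i \<in> {1..<n}" "a \<in> tl_space n"
  shows "tl_refl n i a = (\<lambda>D. push n (hook i) (loopfac i) a D - a D)"
proof
  fix D
  have "tl_refl n i a D = tl_mult n (tl_gen n i) a D - tl_mult n (tl_one n) a D"
    unfolding tl_mult_def sum_subtractf[symmetric]
    by (intro sum.cong refl) (simp add: algebra_simps)
  then show "tl_refl n i a D = push n (hook i) (loopfac i) a D - a D"
    using assms by (simp add: tl_mult_gen tl_mult_one)
qed

context
  fixes n :: nat
begin

private abbreviation "T i \<equiv> push n (hook i) (loopfac i)"

lemma hook_pts: "i \<in> {1..<n} \<Longrightarrow> (True, i) \<in> pts n \<and> (True, i + 1) \<in> pts n"
  by (auto simp: pts_def)

lemma push_hook:
  assumes "i \<in> {1..<n}"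
  shows "push n h c (T i a) = push n (\<lambda>d. h (hook i d)) (\<lambda>d. loopfac i d * c (hook i d)) a"
  using assms by (intro push_push hook_diagram)

lemma tl_quad:
  assumes "i \<in> {1..<n}" shows "T i (T i a) D = 2 * T i a D"
proof -
  have "T i (T i a) = push n (\<lambda>d. hook i (hook i d)) (\<lambda>d. loopfac i d * loopfac i (hook i d)) a"
    by (rule push_hook[OF assms])
  also have "\<dots> = push n (hook i) (\<lambda>d. 2 * loopfac i d) a"
  proof (rule push_cong)
    fix d assume "d \<in> diagrams n"
    then show "hook i (hook i d) = hook i d"
      unfolding hook_def using hook_pts[OF assms] by (intro hk_idem[OF diagrams_matching]) auto
    show "loopfac i d * loopfac i (hook i d) = 2 * loopfac i d"
      by (simp add: hook_def loopfac_def hk_def)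
  qed
  finally show ?thesis by (simp add: push_def sum_distrib_left if_distrib mult.assoc cong: if_cong)
qed

text \<open>The hook joins i with i + 1, and the pair j, j + 1 shares exactly one of these points,
  so it cannot be joined.\<close>

lemma loopfac_hook_adjacent:
  assumes "i \<in> {1..<n}" "j = i + 1 \<or> i = j + 1" "d \<in> diagrams n"
  shows "loopfac j (hook i d) = 1"
proof -
  note m = matching_onD(1)[OF diagrams_matching[OF hook_diagram[OF assms(3,1)]]]
  have "hook i d (True, i) = (True, i + 1)" "hook i d (True, i + 1) = (True, i)"
    by (simp_all add: hook_def hk_def)
  moreover from this have "hook i d (True, j) \<noteq> (True, j + 1)" if "i = j + 1"
    using m[of "(True, j)"] that by auto
  ultimately show ?thesis using assms(2) by (auto simp: loopfac_def)
qed

lemma tl_braid: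
  assumes i: "i \<in> {1..<n}" "j \<in> {1..<n}" "j = i + 1 \<or> i = j + 1"
  shows "T i (T j (T i a)) = T i a"
proof -
  have "T i (T j (T i a)) = push n (\<lambda>d. hook i (hook j (hook i d)))
      (\<lambda>d. loopfac i d * loopfac j (hook i d) * loopfac i (hook j (hook i d))) a"
    by (subst push_hook[OF i(2)], subst push_hook[OF i(1)], simp only: mult.assoc)
  also have "\<dots> = T i a"
  proof (rule push_cong)
    fix d assume dd: "d \<in> diagrams n"
    then have d: "matching_on (pts n) d" by (rule diagrams_matching)
    from i(3) show "hook i (hook j (hook i d)) = hook i d"
    proof
      assume j: "j = i + 1"
      have "hk (True, i) (True, i + 1) (hk (True, i + 1) (True, i + 2) (hk (True, i) (True, i + 1) d))
          = hk (True, i) (True, i + 1) d"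
        using hook_pts[OF i(1)] hook_pts[OF i(2)] j by (intro hk_braid[OF d]) auto
      then show ?thesis by (simp add: hook_def j)
    next
      assume j: "i = j + 1"
      have p: "(True, j) \<in> pts n" "(True, j + 1) \<in> pts n" "(True, j + 2) \<in> pts n"
        using hook_pts[OF i(1)] hook_pts[OF i(2)] j by auto
      have m: "matching_on (pts n) (hk (True, j + 2) (True, j + 1) d)"
        using p by (intro matching_hk[OF d]) auto
      then have m': "matching_on (pts n) (hk (True, j + 1) (True, j) (hk (True, j + 2) (True, j + 1) d))"
        using p by (intro matching_hk[OF m]) auto
      have "hk (True, j + 2) (True, j + 1) (hk (True, j + 1) (True, j) (hk (True, j + 2) (True, j + 1) d))
          = hk (True, j + 2) (True, j + 1) d"
        using p by (intro hk_braid[OF d]) auto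
      then show ?thesis
        using hk_commute[OF d p(3,2)] hk_commute[OF m p(2,1)] hk_commute[OF m' p(3,2)]
        by (simp add: hook_def j)
    qed
    show "loopfac i d * loopfac j (hook i d) * loopfac i (hook j (hook i d)) = loopfac i d"
      using i dd by (simp add: loopfac_hook_adjacent hook_diagram disj_commute)
  qed
  finally show ?thesis .
qed

lemma tl_far:
  assumes i: "i \<in> {1..<n}" "j \<in> {1..<n}" "i + 1 < j"
  shows "T i (T j a) = T j (T i a)"
proof -
  have "T i (T j a) = push n (\<lambda>d. hook i (hook j d)) (\<lambda>d. loopfac j d * loopfac i (hook j d)) a"
    by (simp only: push_hook[OF i(1)] push_hook[OF i(2)] mult.assoc)
  also have "\<dots> = push n (\<lambda>d. hook j (hook i d)) (\<lambda>d. loopfac i d * loopfac j (hook i d)) a"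
  proof (rule push_cong)
    fix d assume "d \<in> diagrams n"
    then have d: "matching_on (pts n) d" by (rule diagrams_matching)
    have p: "(True, i) \<in> pts n" "(True, i + 1) \<in> pts n" "(True, j) \<in> pts n" "(True, j + 1) \<in> pts n"
      using hook_pts[OF i(1)] hook_pts[OF i(2)] by auto
    show "hook i (hook j d) = hook j (hook i d)"
      using i(3) p unfolding hook_def by (intro hk_far[OF d]) auto
    have "distinct [(True, i), (True, i + 1), (True, j), (True, j + 1)]" using i(3) by auto
    from hk_loops[OF d this]
    show "loopfac j d * loopfac i (hook j d) = loopfac i d * loopfac j (hook i d)"
      unfolding loopfac_def hook_def by simp
  qed
  also have "\<dots> = T j (T i a)"
    by (simp only: push_hook[OF i(1)] push_hook[OF i(2)] mult.assoc)
  finally show ?thesis .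
qed

end

text \<open>From t_i^2 = 2 t_i follows (t_i - 1)^2 = 1. For neighbours, (t_i - 1)(t_j - 1)(t_i - 1)
  = t_i + t_j - t_i t_j - t_j t_i - 1, which is symmetric in i and j and so gives the braid
  relation.\<close>

lemma tl_refl_coxeter: "coxeter_ops (tl_space n) (tl_refl n) n"
proof -
  let ?T = "\<lambda>i. push n (hook i) (loopfac i)"
  have V: "?T i a \<in> tl_space n" if "i \<in> {1..<n}" for i a
    using that hook_diagram by (intro push_space) blast
  have Vd: "(\<lambda>D. x D - y D) \<in> tl_space n" if "x \<in> tl_space n" "y \<in> tl_space n" for x y
    using that by (simp add: tl_space_def)
  have closed: "tl_refl n i v \<in> tl_space n" if "i \<in> {1..<n}" "v \<in> tl_space n" for i v
    unfolding tl_refl_eq[OF that] by (intro Vd V that)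
  have two: "tl_refl n i (tl_refl n j v) = (\<lambda>D. ?T i (?T j v) D - ?T i v D - ?T j v D + v D)"
    if "i \<in> {1..<n}" "j \<in> {1..<n}" "v \<in> tl_space n" for i j v
    unfolding tl_refl_eq[OF that(1) closed[OF that(2,3)]] unfolding tl_refl_eq[OF that(2,3)]
    by (simp add: push_diff fun_eq_iff algebra_simps)
  have push_diff': "push n h c (\<lambda>D. x D - y D - z D + w D) D
      = push n h c x D - push n h c y D - push n h c z D + push n h c w D" for h c x y z w D
    unfolding push_def by (simp add: sum_subtractf[symmetric] sum.distrib[symmetric] algebra_simps if_distrib cong: if_cong)
  have three: "tl_refl n i (tl_refl n j (tl_refl n i v)) = (\<lambda>D. ?T i v D + ?T j v D - ?T i (?T j v) D - ?T j (?T i v) D - v D)"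
    if "i \<in> {1..<n}" "j \<in> {1..<n}" "v \<in> tl_space n" "j = i + 1 \<or> i = j + 1" for i j v
    unfolding tl_refl_eq[OF that(1) closed[OF that(2) closed[OF that(1,3)]]]
    unfolding two[OF that(2,1,3)]
    by (rule ext) (subst push_diff', subst tl_quad[OF that(1)], subst tl_braid[OF that(1,2,4)], simp)
  show ?thesis
  proof
    fix i v assume iv: "i \<in> {1..<n}" "v \<in> tl_space n"
    show "tl_refl n i v \<in> tl_space n" by (rule closed[OF iv])
    show "tl_refl n i (tl_refl n i v) = v"
      unfolding two[OF iv(1,1,2)] by (simp add: tl_quad[OF iv(1)])
  next
    fix i j v assume ij: "i \<in> {1..<n}" "j \<in> {1..<n}" "i + 1 < j" and v: "v \<in> tl_space n"
    show "tl_refl n i (tl_refl n j v) = tl_refl n j (tl_refl n i v)"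
      unfolding two[OF ij(1,2) v] two[OF ij(2,1) v] tl_far[OF ij] by (intro ext) simp
  next
    fix i v assume ij: "i \<in> {1..<n}" "Suc i \<in> {1..<n}" and v: "v \<in> tl_space n"
    show "tl_refl n i (tl_refl n (Suc i) (tl_refl n i v)) = tl_refl n (Suc i) (tl_refl n i (tl_refl n (Suc i) v))"
      using three[OF ij v] three[OF ij(2,1) v] by (simp add: algebra_simps)
  qed
qed

lemma theta_perm_word:
  assumes "set ws \<subseteq> {1..<n}" shows "theta_perm n (word_perm ws) = foldr (tl_refl n) ws (tl_one n)"
proof -
  have one: "tl_one n \<in> tl_space n"
    using id_diag_diagram by (auto simp: tl_space_def tl_one_def tl_basis_def)
  show ?thesis
    unfolding theta_perm_def word_perm_def[symmetric]
  proof (rule the_equality)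
    show "\<forall>us. set us \<subseteq> {1..<n} \<and> word_perm us = word_perm ws \<longrightarrow>
        foldr (tl_refl n) ws (tl_one n) = foldr (tl_refl n) us (tl_one n)"
      using coxeter_ops.act_word_perm_eq[OF tl_refl_coxeter assms _ _ one] by simp
  qed (use assms in simp)
qed

section \<open>The diagrams tau(I) and the expansion of theta on increasing words\<close>

lemma sorted_list_insert_min:
  assumes "finite A" "\<forall>a\<in>A. b < a"
  shows "sorted_list_of_set (insert b A) = b # sorted_list_of_set A"
  using assms by (subst sorted_list_of_set_insert) (auto intro!: insort_is_Cons order.strict_implies_order)

definition tau_diag :: "nat \<Rightarrow> nat set \<Rightarrow> pt \<Rightarrow> pt" where
  "tau_diag n I = foldr hook (sorted_list_of_set I) (id_diag n)"

lemma tau_diag_insert: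
  assumes "finite A" "\<forall>a\<in>A. b < a" shows "tau_diag n (insert b A) = hook b (tau_diag n A)"
  using sorted_list_insert_min[OF assms] by (simp add: tau_diag_def)

text \<open>Determines \<open>I\<close> from the bottom row of \<open>\<tau>(I)\<close>; the clauses on the top row only serve the induction.\<close>

definition tau_shape :: "nat \<Rightarrow> nat set \<Rightarrow> (pt \<Rightarrow> pt) \<Rightarrow> bool" where
  "tau_shape n I d \<longleftrightarrow> d \<in> diagrams n
     \<and> (\<forall>j\<in>{1..n}. (\<forall>i\<in>I. j < i) \<longrightarrow> d (True, j) = (False, j))
     \<and> (\<forall>j\<in>I. (\<forall>i\<in>I. j \<le> i) \<longrightarrow> d (True, j) = (True, j + 1))
     \<and> (\<forall>i\<in>{1..n}. if i \<in> I then d (False, i) \<in> {(False, i + 1), (True, i + 2)}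
           else d (False, i) \<in> {(False, i - 1), (True, i)})"

text \<open>Since \<open>x\<close> lies below \<open>A\<close>, the top point x is still joined
  straight down to the bottom point x. The hook therefore passes the partner of the top point x + 1
  on to the bottom point x: the bottom point x + 1, or the top point x + 2 if x + 1 is in
  \<open>A\<close>.\<close>

lemma tau_shape_hook:
  assumes d: "tau_shape n A d" and x: "x \<in> {1..<n}" "\<forall>a\<in>A. x < a"
  shows "tau_shape n (insert x A) (hook x d)"
proof -
  have dd: "d \<in> diagrams n" and top: "\<And>j. j \<in> {1..n} \<Longrightarrow> \<forall>i\<in>A. j < i \<Longrightarrow> d (True, j) = (False, j)"
    and mn: "\<And>j. j \<in> A \<Longrightarrow> \<forall>i\<in>A. j \<le> i \<Longrightarrow> d (True, j) = (True, j + 1)"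
    and bot: "\<And>i. i \<in> {1..n} \<Longrightarrow> if i \<in> A then d (False, i) \<in> {(False, i + 1), (True, i + 2)}
           else d (False, i) \<in> {(False, i - 1), (True, i)}"
    using d unfolding tau_shape_def by blast+
  define s where "s = d (True, x + 1)"
  have dx: "d (True, x) = (False, x)" using top[of x] x by auto
  have s: "s = (if x + 1 \<in> A then (True, x + 2) else (False, x + 1))"
  proof (cases "x + 1 \<in> A")
    case True
    have "\<forall>i\<in>A. x + 1 \<le> i" using x by auto
    with mn[OF True] True show ?thesis by (simp add: s_def)
  next
    case False
    have "\<forall>i\<in>A. x + 1 < i" using x False by (metis Suc_eq_plus1 Suc_leI le_neq_implies_less)
    with top[of "x + 1"] False x show ?thesis by (simp add: s_def)
  qed
  have h: "hook x d p = (if p = (True, x) then (True, x + 1) else if p = (True, x + 1) then (True, x)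
      else if p = (False, x) then s else if p = s then (False, x) else d p)" for p
    by (simp add: hook_def hk_def dx s_def)
  have hs: "hook x d (False, i) = (if i = x then s else if (False, i) = s then (False, x) else d (False, i))" for i
    by (simp add: h)
  show ?thesis
    unfolding tau_shape_def
  proof (intro conjI ballI impI)
    show "hook x d \<in> diagrams n" by (rule hook_diagram[OF dd x(1)])
    fix j assume "j \<in> {1..n}" "\<forall>i\<in>insert x A. j < i"
    then show "hook x d (True, j) = (False, j)"
      using top[of j] unfolding h by (auto simp: s)
  next
    fix j assume "j \<in> insert x A" "\<forall>i\<in>insert x A. j \<le> i"
    then have "j = x" using x by auto
    then show "hook x d (True, j) = (True, j + 1)" by (simp add: h)
  next
    fix i assume i: "i \<in> {1..n}"
    show "if i \<in> insert x A then hook x d (False, i) \<in> {(False, i + 1), (True, i + 2)}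
           else hook x d (False, i) \<in> {(False, i - 1), (True, i)}"
    proof (cases "i = x")
      case True then show ?thesis by (simp add: hs s)
    next
      case False
      then show ?thesis using bot[OF i] unfolding hs s by auto
    qed
  qed
qed

lemma tau_diag_shape: "finite I \<Longrightarrow> I \<subseteq> {1..<n} \<Longrightarrow> tau_shape n I (tau_diag n I)"
proof (induction I rule: finite_linorder_min_induct)
  case empty
  have "id_diag n (c, j) = (\<not> c, j)" if "j \<in> {1..n}" for c j
    using that by (simp add: id_diag_def pts_def)
  then show ?case
    using id_diag_diagram by (simp add: tau_shape_def tau_diag_def)
next
  case (insert b A)
  then show ?case using tau_shape_hook[of n A "tau_diag n A" b] by (simp add: tau_diag_insert)
qed

lemma tau_diag_inj:
  assumes "I \<subseteq> {1..<n}" "J \<subseteq> {1..<n}" "tau_diag n I = tau_diag n J" shows "I = J"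
proof -
  let ?R = "\<lambda>d. {i\<in>{1..<n}. d (False, i) \<in> {(False, i + 1), (True, i + 2 :: nat)}}"
  have eq: "?R (tau_diag n I) = I" if I: "I \<subseteq> {1..<n}" for I
  proof -
    have "finite I" using I finite_subset by blast
    then have *: "if i \<in> I then tau_diag n I (False, i) \<in> {(False, i + 1), (True, i + 2)}
           else tau_diag n I (False, i) \<in> {(False, i - 1), (True, i)}" if "i \<in> {1..n}" for i
      using tau_diag_shape[of I n] I that unfolding tau_shape_def by blast
    have "i \<in> I \<longleftrightarrow> tau_diag n I (False, i) \<in> {(False, i + 1), (True, i + 2)}" if "i \<in> {1..<n}" for i
      using *[of i] that by (auto split: if_splits)
    then show ?thesis using I by blast
  qed
  have "?R (tau_diag n I) = ?R (tau_diag n J)" by (simp only: assms(3))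
  then show ?thesis unfolding eq[OF assms(1)] eq[OF assms(2)] .
qed

lemma tau_diag_diagram: "I \<subseteq> {1..<n} \<Longrightarrow> tau_diag n I \<in> diagrams n"
  using tau_diag_shape[of I n] finite_subset[of I "{1..<n}"] by (simp add: tau_shape_def)

text \<open>No loop closes, because the top point b is joined to the bottom row. Hence increasing
  products of generators are single diagrams with coefficient 1.\<close>

lemma push_tau_diag:
  assumes "finite A" "\<forall>a\<in>A. b < a" "insert b A \<subseteq> {1..<n}"
  shows "push n (hook b) (loopfac b) (tl_basis (tau_diag n A)) = tl_basis (tau_diag n (insert b A))"
proof -
  have "tau_diag n A (True, b) = (False, b)"
    using tau_diag_shape[of A n] assms unfolding tau_shape_def by auto
  then show ?thesis
    using assms by (simp add: push_basis tau_diag_diagram tau_diag_insert loopfac_def)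
qed

lemma tauI_eq: "I \<subseteq> {1..<n} \<Longrightarrow> tauI n I = tl_basis (tau_diag n I)"
proof -
  have "finite I \<Longrightarrow> I \<subseteq> {1..<n} \<Longrightarrow> tauI n I = tl_basis (tau_diag n I)"
  proof (induction I rule: finite_linorder_min_induct)
    case empty then show ?case by (simp add: tauI_def tau_diag_def tl_one_def)
  next
    case (insert b A)
    then have "tauI n (insert b A) = tl_mult n (tl_gen n b) (tauI n A)"
      by (simp add: tauI_def sorted_list_insert_min del: sorted_list_of_set_insert_remove)
    with insert show ?case by (simp add: tl_mult_gen push_tau_diag)
  qed
  then show "I \<subseteq> {1..<n} \<Longrightarrow> tauI n I = tl_basis (tau_diag n I)"
    using finite_subset by blast
qed

lemma sum_Pow_insert:
  fixes f :: "nat set \<Rightarrow> int"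
  assumes "finite A" "b \<notin> A"
  shows "(\<Sum>K\<in>Pow (insert b A). f K) = (\<Sum>K\<in>Pow A. f K + f (insert b K))"
proof -
  have "inj_on (insert b) (Pow A)" using assms by (intro inj_onI) (metis Diff_insert_absorb Pow_iff subsetD)
  moreover have "Pow A \<inter> insert b ` Pow A = {}" using assms by auto
  ultimately show ?thesis
    using assms by (simp add: Pow_insert sum.union_disjoint sum.reindex sum.distrib)
qed

definition wperm :: "nat set \<Rightarrow> nat \<Rightarrow> nat" where
  "wperm J = word_perm (sorted_list_of_set J)"

text \<open>Expansion of the product of the factors t_j - 1 in increasing order; \<open>K\<close>
  collects the factors from which t_j is chosen.\<close>

lemma theta_wperm:
  assumes "J \<subseteq> {1..<n}"
  shows "theta_perm n (wperm J) = (\<lambda>D. \<Sum>K\<in>Pow J. (-1) ^ card (J - K) * tl_basis (tau_diag n K) D)"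
proof -
  have fin: "finite J" using assms finite_subset by blast
  have "foldr (tl_refl n) (sorted_list_of_set J) (tl_one n)
      = (\<lambda>D. \<Sum>K\<in>Pow J. (-1) ^ card (J - K) * tl_basis (tau_diag n K) D)"
    using fin assms
  proof (induction J rule: finite_linorder_min_induct)
    case empty
    then show ?case by (simp add: tl_one_def tau_diag_def)
  next
    case (insert b A)
    let ?f = "\<lambda>A K. (-1) ^ card (A - K) :: int"
    have b: "b \<in> {1..<n}" "b \<notin> A" using insert by auto
    have sp: "(\<lambda>D. \<Sum>K\<in>Pow A. ?f A K * tl_basis (tau_diag n K) D) \<in> tl_space n"
      using insert.prems tau_diag_diagram[of _ n]
      by (auto simp: tl_space_def tl_basis_def intro!: sum.neutral)
    have "foldr (tl_refl n) (sorted_list_of_set (insert b A)) (tl_one n)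
      = tl_refl n b (\<lambda>D. \<Sum>K\<in>Pow A. ?f A K * tl_basis (tau_diag n K) D)"
      using insert by (simp add: sorted_list_insert_min del: sorted_list_of_set_insert_remove)
    also have "\<dots> = (\<lambda>D. (\<Sum>K\<in>Pow A. ?f A K * push n (hook b) (loopfac b) (tl_basis (tau_diag n K)) D)
         - (\<Sum>K\<in>Pow A. ?f A K * tl_basis (tau_diag n K) D))"
      unfolding tl_refl_eq[OF b(1) sp] push_lin ..
    also have "\<dots> = (\<lambda>D. \<Sum>K\<in>Pow (insert b A). ?f (insert b A) K * tl_basis (tau_diag n K) D)"
    proof
      fix D
      have "push n (hook b) (loopfac b) (tl_basis (tau_diag n K)) = tl_basis (tau_diag n (insert b K))"
        if "K \<in> Pow A" for K
        using that insert.hyps insert.prems finite_subset[of K A] by (intro push_tau_diag) auto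
      moreover have "?f (insert b A) K = - ?f A K \<and> ?f (insert b A) (insert b K) = ?f A K" if "K \<in> Pow A" for K
      proof -
        have "insert b A - K = insert b (A - K)" "insert b A - insert b K = A - K" using that b(2) by auto
        then show ?thesis using b(2) insert.hyps by simp
      qed
      ultimately show "(\<Sum>K\<in>Pow A. ?f A K * push n (hook b) (loopfac b) (tl_basis (tau_diag n K)) D)
         - (\<Sum>K\<in>Pow A. ?f A K * tl_basis (tau_diag n K) D)
         = (\<Sum>K\<in>Pow (insert b A). ?f (insert b A) K * tl_basis (tau_diag n K) D)"
        unfolding sum_Pow_insert[OF insert.hyps(1) b(2)] sum_subtractf[symmetric]
        by (intro sum.cong refl) simp
    qed
    finally show ?case .
  qed
  moreover have "set (sorted_list_of_set J) \<subseteq> {1..<n}" using fin assms by simp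
  ultimately show ?thesis unfolding wperm_def by (simp add: theta_perm_word)
qed

text \<open>Moebius inversion on the Boolean lattice. For a new element \<open>b\<close>, the terms
  with \<open>b\<close> outside \<open>J\<close> cancel against those with \<open>b\<close> in
  \<open>J\<close> but not in \<open>K\<close>. Applied to \<open>theta_wperm\<close>, this gives
  theta(B(I)) = tau(I).\<close>

lemma sum_Pow_signs:
  fixes g :: "nat set \<Rightarrow> int"
  assumes "finite I"
  shows "(\<Sum>J\<in>Pow I. \<Sum>K\<in>Pow J. (-1) ^ card (J - K) * g K) = g I"
  using assms
proof (induction I arbitrary: g rule: finite_induct)
  case (insert b A)
  have "(\<Sum>K\<in>Pow (insert b J). (-1) ^ card (insert b J - K) * g K)
     = (\<Sum>K\<in>Pow J. (-1) ^ card (J - K) * g (insert b K)) - (\<Sum>K\<in>Pow J. (-1) ^ card (J - K) * g K)"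
    if J: "J \<in> Pow A" for J
  proof -
    have b: "b \<notin> J" "finite J" using J insert.hyps finite_subset by auto
    have "insert b J - K = insert b (J - K)" "insert b J - insert b K = J - K" if "K \<in> Pow J" for K
      using that b by auto
    then show ?thesis
      unfolding sum_Pow_insert[OF b(2,1)] sum_subtractf[symmetric]
      using b by (intro sum.cong refl) simp
  qed
  then have "(\<Sum>J\<in>Pow (insert b A). \<Sum>K\<in>Pow J. (-1) ^ card (J - K) * g K)
     = (\<Sum>J\<in>Pow A. \<Sum>K\<in>Pow J. (-1) ^ card (J - K) * g (insert b K))"
    unfolding sum_Pow_insert[OF insert.hyps(1,2)] by (intro sum.cong refl) simp
  with insert.IH[of "\<lambda>K. g (insert b K)"] show ?case by simp
qed simp

section \<open>Hessenberg permutations\<close>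

definition hess :: "nat \<Rightarrow> (nat \<Rightarrow> nat) \<Rightarrow> bool" where
  "hess n s \<longleftrightarrow> s permutes {1..n} \<and> (\<forall>i\<in>{1..n}. i \<le> s i + 1)"

definition drops :: "nat \<Rightarrow> (nat \<Rightarrow> nat) \<Rightarrow> nat set" where
  "drops n s = {j\<in>{1..<n}. s (j + 1) = j}"

lemma wperm_insert:
  assumes "finite A" "\<forall>a\<in>A. b < a" shows "wperm (insert b A) = wperm A \<circ> sadj b"
  using assms by (simp add: wperm_def sorted_list_insert_min del: sorted_list_of_set_insert_remove)

text \<open>The first conjunct carries the induction: below the new minimum nothing has moved, so
  s_b exchanges the fixed value b with the value at b + 1.\<close>

lemma wperm_values:
  assumes "finite J" "0 \<notin> J"
  shows "(\<forall>i. (\<forall>z\<in>J. i < z) \<longrightarrow> wperm J i = i)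
     \<and> (\<forall>j. if j \<in> J then wperm J (j + 1) = j else j + 1 \<le> wperm J (j + 1))"
  using assms
proof (induction J rule: finite_linorder_min_induct)
  case empty
  then show ?case by (simp add: wperm_def)
next
  case (insert b A)
  then have fix': "\<And>i. \<forall>z\<in>A. i < z \<Longrightarrow> wperm A i = i"
    and val: "\<And>j. if j \<in> A then wperm A (j + 1) = j else j + 1 \<le> wperm A (j + 1)"
    by blast+
  have b: "b \<notin> A" "0 < b" "\<And>z. z \<in> A \<Longrightarrow> b < z" using insert by auto
  have w: "wperm (insert b A) i = (if i = b then wperm A (b + 1) else if i = b + 1 then b else wperm A i)" for i
    using insert.hyps fix'[of b] by (simp add: wperm_insert sadj_def transpose_def)
  have "wperm (insert b A) i = i" if "\<forall>z\<in>insert b A. i < z" for i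
    using that fix'[of i] unfolding w by auto
  moreover have "if j \<in> insert b A then wperm (insert b A) (j + 1) = j else j + 1 \<le> wperm (insert b A) (j + 1)" for j
    using val[of j] val[of b] b(1,2) b(3)[of j] unfolding w by (auto split: if_splits)
  ultimately show ?case by blast
qed

lemma wperm_hess:
  assumes "J \<subseteq> {1..<n}" shows "hess n (wperm J)" "drops n (wperm J) = J"
proof -
  have fin: "finite J" "0 \<notin> J" using assms finite_subset by auto
  have v: "if j \<in> J then wperm J (j + 1) = j else j + 1 \<le> wperm J (j + 1)" for j
    using wperm_values[OF fin] by blast
  have "i \<le> wperm J i + 1" if "i \<in> {1..n}" for i
    using v[of "i - 1"] that by (auto split: if_splits)
  then show "hess n (wperm J)"
    unfolding hess_def wperm_def using word_perm_permutes fin assms by simp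
  have "j \<in> J" if "wperm J (j + 1) = j" for j
    using v[of j] that by (auto split: if_splits)
  moreover have "wperm J (j + 1) = j" if "j \<in> J" for j
    using v[of j] that by simp
  ultimately show "drops n (wperm J) = J"
    unfolding drops_def using assms by blast
qed

text \<open>Let b be the smallest drop. Then s(b) is not b, and s(b) = b - 1 would make b - 1 a
  smaller drop, so s(b) >= b + 1; composing with s_b thus keeps the Hessenberg condition and removes
  just this drop. Without drops s(i) >= i everywhere, which forces the identity.\<close>

lemma hess_eq_wperm: "hess n s \<Longrightarrow> s = wperm (drops n s)"
proof (induction "card (drops n s)" arbitrary: s)
  case 0
  have fin: "finite (drops n s)" by (simp add: drops_def)
  have ge: "s i \<ge> i" if "i \<in> {1..n}" for i
  proof (rule ccontr)
    assume "\<not> i \<le> s i"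
    with 0(2) that have i: "s i + 1 = i" unfolding hess_def by fastforce
    have "s i \<in> {1..n}" using 0(2) that permutes_in_image unfolding hess_def by metis
    with i that have "s i \<in> drops n s" by (auto simp: drops_def)
    with 0(1) fin show False by simp
  qed
  have "s = id" using 0(2) ge unfolding hess_def by (intro permutes_natset_ge[of s "{1..n}"]) auto
  moreover have "drops n s = {}" using 0(1) fin by simp
  ultimately have "wperm (drops n s) = s" by (metis (no_types) sorted_list_of_set_empty word_perm_simps(1) wperm_def)
  then show ?case by simp
next
  case (Suc k)
  have fin: "finite (drops n s)" by (simp add: drops_def)
  have ne: "drops n s \<noteq> {}" using Suc(2) by auto
  define b where "b = Min (drops n s)"
  have b: "b \<in> drops n s" "\<And>j. j \<in> drops n s \<Longrightarrow> b \<le> j"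
    using fin ne by (simp_all add: b_def)
  then have bn: "1 \<le> b" "b < n" "s (b + 1) = b" by (auto simp: drops_def)
  define t where "t = s \<circ> sadj b"
  have t: "t i = (if i = b then b else if i = b + 1 then s b else s i)" for i
    using bn by (simp add: t_def sadj_def transpose_def)
  have perm: "s permutes {1..n}" and hs: "\<And>i. i \<in> {1..n} \<Longrightarrow> i \<le> s i + 1"
    using Suc(3) by (auto simp: hess_def)
  have sb: "b + 1 \<le> s b"
  proof (rule ccontr)
    assume "\<not> b + 1 \<le> s b"
    moreover have "s b \<noteq> b" using bn(3) permutes_inj[OF perm] by (metis inj_eq n_not_Suc_n Suc_eq_plus1)
    moreover have "b \<le> s b + 1" using hs[of b] bn by simp
    ultimately have sb: "s b + 1 = b" by linarith
    have "s b \<in> {1..n}" using perm permutes_in_image[of s "{1..n}" b] bn by simp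
    then have "s b \<in> drops n s" using sb bn by (auto simp: drops_def)
    with b(2) sb show False by fastforce
  qed
  have "t permutes {1..n}"
    unfolding t_def sadj_def using bn perm by (intro permutes_compose permutes_swap_id) auto
  then have ht: "hess n t"
    unfolding hess_def using hs sb by (auto simp: t)
  have dt: "drops n t = drops n s - {b}"
  proof (rule set_eqI)
    fix j
    show "j \<in> drops n t \<longleftrightarrow> j \<in> drops n s - {b}"
    proof (cases "j + 1 = b \<or> j = b")
      case True
      then show ?thesis using sb b(2)[of j] by (auto simp: drops_def t)
    next
      case False
      then show ?thesis by (auto simp: drops_def t)
    qed
  qed
  have "card (drops n t) = k" using Suc(2) dt b(1) fin by simp
  then have "t = wperm (drops n s - {b})" using Suc(1)[of t] ht dt by simp
  then have "wperm (insert b (drops n s - {b})) = t \<circ> sadj b"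
    using fin b(2) by (subst wperm_insert) (auto simp: le_neq_implies_less)
  moreover have "insert b (drops n s - {b}) = drops n s" using b(1) by auto
  moreover have "t \<circ> sadj b = s" by (simp add: t_def fun_eq_iff)
  ultimately show ?case by simp
qed

lemma hess_iff_wperm: "hess n s \<and> drops n s \<subseteq> I \<longleftrightarrow> (\<exists>J. J \<subseteq> I \<and> J \<subseteq> {1..<n} \<and> s = wperm J)"
proof
  assume "hess n s \<and> drops n s \<subseteq> I"
  then show "\<exists>J. J \<subseteq> I \<and> J \<subseteq> {1..<n} \<and> s = wperm J"
    using hess_eq_wperm by (intro exI[of _ "drops n s"]) (auto simp: drops_def)
qed (use wperm_hess in blast)

section \<open>The group algebra element B(I) as an indicator function\<close>

lemma galg_mult_one_plus:
  assumes "i \<in> {1..<n}" "s \<in> perms n"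
  shows "galg_mult n (\<lambda>s. galg_basis id s + galg_basis (sadj i) s) a s = a s + a (s \<circ> sadj i)"
proof -
  have p: "id \<in> perms n" "sadj i \<in> perms n" "finite (perms n)"
    using assms(1) by (auto simp: perms_def sadj_def permutes_id finite_permutations intro: permutes_swap_id)
  have "sadj i i \<noteq> id i" by (simp add: sadj_def)
  then have ne: "sadj i \<noteq> id" by metis
  have "galg_mult n (\<lambda>s. galg_basis id s + galg_basis (sadj i) s) a s =
     (\<Sum>p\<in>perms n. (if p = id then a (s \<circ> inv p) else 0) + (if p = sadj i then a (s \<circ> inv p) else 0))"
    unfolding galg_mult_def galg_basis_def using assms(2) ne by (auto intro!: sum.cong)
  also have "\<dots> = a (s \<circ> inv id) + a (s \<circ> inv (sadj i))"
    using p by (simp add: sum.distrib)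
  finally show ?thesis by (simp add: sadj_def)
qed

lemma hess_drops_inj: "hess n s \<Longrightarrow> hess n t \<Longrightarrow> drops n s = drops n t \<Longrightarrow> s = t"
  using hess_eq_wperm by metis

lemma BB_eq:
  assumes "I \<subseteq> {1..<n}"
  shows "BB n I s = (if hess n s \<and> drops n s \<subseteq> I then 1 else 0)"
proof -
  have "finite I" using assms finite_subset by blast
  then show ?thesis using assms
  proof (induction I arbitrary: s rule: finite_linorder_min_induct)
    case empty
    have "hess n s \<and> drops n s \<subseteq> {} \<longleftrightarrow> s = id"
      unfolding hess_iff_wperm by (auto simp: wperm_def)
    then show ?case by (simp add: BB_def galg_basis_def)
  next
    case (insert b A)
    have b: "b \<in> {1..<n}" "b \<notin> A" and A: "A \<subseteq> {1..<n}" using insert by auto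
    have BB: "BB n (insert b A) = galg_mult n (\<lambda>s. galg_basis id s + galg_basis (sadj b) s) (BB n A)"
      using insert by (simp add: BB_def sorted_list_insert_min del: sorted_list_of_set_insert_remove)
    show ?case
    proof (cases "s \<in> perms n")
      case False
      then show ?thesis unfolding BB galg_mult_def by (auto simp: hess_def perms_def)
    next
      case True
      have ins: "wperm (insert b K) = wperm K \<circ> sadj b" if "K \<subseteq> A" for K
        using that insert.hyps finite_subset by (intro wperm_insert) auto
      have inv: "(t \<circ> sadj b) \<circ> sadj b = t" for t by (simp add: fun_eq_iff)
      \<comment> \<open>The summand from s_b covers the permutations with drop \<open>b\<close>, the
        summand from 1 those without it, so the two never overlap.\<close>
      have 1: "hess n (s \<circ> sadj b) \<and> drops n (s \<circ> sadj b) \<subseteq> A \<longleftrightarrow> hess n s \<and> drops n s \<subseteq> insert b A \<and> b \<in> drops n s"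
      proof
        assume "hess n (s \<circ> sadj b) \<and> drops n (s \<circ> sadj b) \<subseteq> A"
        then obtain K where K: "K \<subseteq> A" "s \<circ> sadj b = wperm K" unfolding hess_iff_wperm by blast
        then have "s = wperm (insert b K)" using ins inv by metis
        with K A b wperm_hess[of "insert b K" n] show "hess n s \<and> drops n s \<subseteq> insert b A \<and> b \<in> drops n s" by auto
      next
        assume s: "hess n s \<and> drops n s \<subseteq> insert b A \<and> b \<in> drops n s"
        define K where "K = drops n s - {b}"
        have K: "K \<subseteq> A" "drops n s = insert b K" using s by (auto simp: K_def)
        have "s = wperm (insert b K)" using s hess_eq_wperm K by metis
        then have "s \<circ> sadj b = wperm K" using ins[OF K(1)] inv by metis
        with K A show "hess n (s \<circ> sadj b) \<and> drops n (s \<circ> sadj b) \<subseteq> A"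
          unfolding hess_iff_wperm by blast
      qed
      have "BB n (insert b A) s = BB n A s + BB n A (s \<circ> sadj b)"
        unfolding BB by (rule galg_mult_one_plus[OF b(1) True])
      also have "\<dots> = (if hess n s \<and> drops n s \<subseteq> insert b A then 1 else 0)"
        unfolding insert.IH[OF A] 1 using b by auto
      finally show ?thesis .
    qed
  qed
qed

lemma theta_lin_BB:
  assumes "I \<subseteq> {1..<n}" "\<And>s. a s = c * BB n I s"
  shows "theta_lin n a = (\<lambda>D. c * tl_basis (tau_diag n I) D)"
proof
  fix D
  have fin: "finite I" using assms finite_subset by blast
  have inj: "inj_on wperm (Pow I)"
    using wperm_hess(2) assms(1) by (intro inj_onI) (metis PowD subset_trans)
  have im: "wperm ` Pow I = {s\<in>perms n. hess n s \<and> drops n s \<subseteq> I}"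
  proof -
    have "s \<in> wperm ` Pow I \<longleftrightarrow> hess n s \<and> drops n s \<subseteq> I" for s
      unfolding hess_iff_wperm using assms(1) by auto
    then show ?thesis by (auto simp: hess_def perms_def)
  qed
  have finp: "finite (perms n)" by (simp add: perms_def finite_permutations)
  have "theta_lin n a D = (\<Sum>s\<in>perms n. if hess n s \<and> drops n s \<subseteq> I then c * theta_perm n s D else 0)"
    unfolding theta_lin_def assms(2) BB_eq[OF assms(1)] by (intro sum.cong refl) simp
  also have "\<dots> = (\<Sum>s\<in>wperm ` Pow I. c * theta_perm n s D)"
    unfolding im by (rule sum.inter_filter[OF finp, symmetric])
  also have "\<dots> = c * (\<Sum>J\<in>Pow I. theta_perm n (wperm J) D)"
    by (simp add: sum.reindex[OF inj] sum_distrib_left)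
  also have "(\<Sum>J\<in>Pow I. theta_perm n (wperm J) D)
      = (\<Sum>J\<in>Pow I. \<Sum>K\<in>Pow J. (-1) ^ card (J - K) * tl_basis (tau_diag n K) D)"
    using assms(1) by (intro sum.cong refl) (subst theta_wperm, auto)
  also have "\<dots> = tl_basis (tau_diag n I) D"
    by (rule sum_Pow_signs[OF fin])
  finally show "theta_lin n a D = c * tl_basis (tau_diag n I) D" .
qed

section \<open>Path families for shapes without a 3 by 2 block\<close>

lemma path_step: "is_path a c X \<Longrightarrow> X y = X (Suc y) \<or> X y = X (Suc y) - 1"
  unfolding is_path_def by (metis One_nat_def Suc_le_mono diff_Suc_1 le0)

lemma path_mono: assumes "is_path a c X" "y \<le> z" shows "X y \<le> X z"
proof (rule lift_Suc_mono_le[OF _ assms(2)])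
  show "X k \<le> X (Suc k)" for k using path_step[OF assms(1), of k] by linarith
qed

lemma path_bounds: assumes "is_path a c X" shows "c \<le> X y" "X y \<le> a"
proof -
  have "X 0 = c" using assms by (simp add: is_path_def)
  then show "c \<le> X y" using path_mono[OF assms, of 0 y] by simp
  obtain Y where "\<And>y. y \<ge> Y \<Longrightarrow> X y = a" using assms by (auto simp: is_path_def)
  then show "X y \<le> a" using path_mono[OF assms, of y "max y Y"] by simp
qed

text \<open>At the lowest height where \<open>X\<close> is not strictly left of \<open>Z\<close> the
  unit steps force a meeting, from which \<open>Z\<close> goes south and \<open>X\<close> southwest.
  The strict order below it is what later identifies lowest splits.\<close>

lemma path_crossing:
  assumes X: "is_path a c X" and Z: "is_path a' c' Z" and "X 0 < Z 0" "Z T \<le> X T"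
  shows "\<exists>y<T. X (Suc y) = Z (Suc y) \<and> Z y = Z (Suc y) \<and> X y = Z (Suc y) - 1 \<and> (\<forall>t\<le>y. X t < Z t)"
proof -
  define L where "L = (LEAST t. Z t \<le> X t)"
  have L: "Z L \<le> X L" "L \<le> T" "\<And>t. t < L \<Longrightarrow> X t < Z t"
    unfolding L_def using assms(4) by (auto intro: LeastI Least_le dest: not_less_Least)
  then obtain y where y: "L = Suc y" using assms(3) by (cases L) auto
  have "X y < Z y" using L y by simp
  with path_step[OF X, of y] path_step[OF Z, of y] L(1) y
  have "X (Suc y) = Z (Suc y) \<and> Z y = Z (Suc y) \<and> X y = Z (Suc y) - 1" by auto
  with L y show ?thesis by (intro exI[of _ y]) auto
qed

definition lev_edge :: "int \<Rightarrow> int \<Rightarrow> nat \<Rightarrow> edge" where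
  "lev_edge x x' y = ((x, int (Suc y)), (x', int y))"

lemma path_edges_eq: "path_edges X = {lev_edge (X (Suc y)) (X y) y | y. True}"
proof -
  have "(\<exists>y\<ge>1. e = ((X y, int y), (X (y - 1), int y - 1))) \<longleftrightarrow> (\<exists>y. e = lev_edge (X (Suc y)) (X y) y)" for e
    unfolding lev_edge_def
  proof
    assume "\<exists>y\<ge>1. e = ((X y, int y), (X (y - 1), int y - 1))"
    then obtain y where y: "y \<ge> 1" "e = ((X y, int y), (X (y - 1), int y - 1))" by blast
    then show "\<exists>y. e = ((X (Suc y), int (Suc y)), (X y, int y))"
      by (intro exI[of _ "y - 1"]) (auto simp: of_nat_diff)
  next
    assume "\<exists>y. e = ((X (Suc y), int (Suc y)), (X y, int y))"
    then obtain y where "e = ((X (Suc y), int (Suc y)), (X y, int y))" by blast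
    then show "\<exists>y\<ge>1. e = ((X y, int y), (X (y - 1), int y - 1))"
      by (intro exI[of _ "Suc y"]) auto
  qed
  then show ?thesis unfolding path_edges_def by blast
qed

lemma lev_edge_in: "lev_edge x x' y \<in> path_edges X \<longleftrightarrow> X (Suc y) = x \<and> X y = x'"
  unfolding path_edges_eq by (auto simp: lev_edge_def)

lemma fam_edges_pos:
  "0 < fam_edges n P (lev_edge x x' y) \<longleftrightarrow> (\<exists>i\<in>{1..n}. P i (Suc y) = x \<and> P i y = x')"
  unfolding fam_edges_def lev_edge_in by (auto simp: card_gt_0_iff)

text \<open>The j - 1 values below j are all taken at positions up to j, because m <= s(m) + 1. This
  leaves a single position among the first j for the values from j on.\<close>

lemma hess_pigeon:
  fixes n i j k :: nat
  assumes s: "s permutes {1..n}" "\<forall>i\<in>{1..n}. i \<le> s i + 1"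
    and ik: "i \<noteq> k" "i \<in> {1..j}" "k \<in> {1..j}" "j \<le> n" "j \<le> s i" "j \<le> s k"
  shows False
proof -
  let ?A = "{m\<in>{1..n}. s m < j}"
  have inj: "inj_on s ?A" using permutes_inj[OF s(1)] by (auto intro: inj_on_subset)
  have "s ` ?A = {1..<j}"
  proof
    have "s m \<in> {1..n}" if "m \<in> {1..n}" for m using that permutes_in_image[OF s(1)] by blast
    then show "s ` ?A \<subseteq> {1..<j}" by fastforce
    show "{1..<j} \<subseteq> s ` ?A"
    proof
      fix v assume v: "v \<in> {1..<j}"
      then have "v \<in> {1..n}" using ik(4) by auto
      then have "v \<in> s ` {1..n}" using permutes_image[OF s(1)] by simp
      then obtain m where m: "s m = v" "m \<in> {1..n}" by blast
      with v show "v \<in> s ` ?A" by auto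
    qed
  qed
  then have "card ?A = j - 1" using card_image[OF inj] by simp
  moreover have "?A \<subseteq> {1..j} - {i, k}" using s(2) ik by fastforce
  then have "card ?A \<le> card ({1..j} - {i, k})" by (intro card_mono) auto
  moreover have "card ({1..j} - {i, k}) = j - 2" using ik by (simp add: card_Diff_subset)
  moreover have "2 \<le> j" using ik(1-3) by (cases "i < k") auto
  ultimately show False by linarith
qed

text \<open>Otherwise the j - 1 positions below j would be mapped injectively into the j - 2 values
  below j - 1, since j - 1 itself is the value at j.\<close>

lemma drop_partner:
  fixes n j :: nat
  assumes s: "s permutes {1..n}" and j: "2 \<le> j" "j \<le> n" "s j = j - 1"
  shows "\<exists>i\<in>{1..<j}. j \<le> s i"
proof (rule ccontr)
  assume neg: "\<not> ?thesis"
  have inj: "inj_on s {1..<j}" using permutes_inj[OF s] by (auto intro: inj_on_subset)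
  have "s i \<in> {1..<j} - {j - 1}" if "i \<in> {1..<j}" for i
  proof -
    have "s i \<noteq> s j" using permutes_inj[OF s] that by (metis inj_eq less_irrefl atLeastLessThan_iff)
    moreover have "s i \<in> {1..n}" using permutes_in_image[OF s, of i] that j by simp
    moreover have "s i < j" using neg that by (meson not_le)
    ultimately show ?thesis using j by simp
  qed
  then have "card {1..<j} \<le> card ({1..<j} - {j - 1})"
    by (intro card_inj_on_le[OF inj]) auto
  with j show False by simp
qed

text \<open>\<open>gap\<close> is the absence of a \<open>3 \<times> 2\<close> block: no path starting at the \<open>(i + 2)\<close>-nd source can meet
  a path ending at the \<open>i\<close>-th sink.\<close>

locale hess_shape =
  fixes n :: nat and lam mu :: "nat list"
  assumes a_dec: "\<And>i j. 1 \<le> i \<Longrightarrow> i < j \<Longrightarrow> j \<le> n \<Longrightarrow> Acoord n lam j < Acoord n lam i"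
    and b_dec: "\<And>i j. 1 \<le> i \<Longrightarrow> i < j \<Longrightarrow> j \<le> n \<Longrightarrow> Bcoord n mu j < Bcoord n mu i"
    and gap: "\<And>i. 1 \<le> i \<Longrightarrow> i + 2 \<le> n \<Longrightarrow> Acoord n lam (i + 2) < Bcoord n mu i"
begin

abbreviation "a \<equiv> Acoord n lam"
abbreviation "b \<equiv> Bcoord n mu"

lemma a_dec_le: "1 \<le> i \<Longrightarrow> i \<le> j \<Longrightarrow> j \<le> n \<Longrightarrow> a j \<le> a i"
  using a_dec[of i j] by (cases "i = j") auto

lemma b_dec_le: "1 \<le> i \<Longrightarrow> i \<le> j \<Longrightarrow> j \<le> n \<Longrightarrow> b j \<le> b i"
  using b_dec[of i j] by (cases "i = j") auto

lemma path_hess: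
  assumes "is_path (a i) (b j) X" "i \<in> {1..n}" "j \<in> {1..n}" shows "i \<le> j + 1"
proof (rule ccontr)
  assume "\<not> i \<le> j + 1"
  then have "a i \<le> a (j + 2)" "a (j + 2) < b j" using assms a_dec_le[of "j + 2" i] gap[of j] by auto
  with path_bounds[OF assms(1), of 0] show False by simp
qed

text \<open>The strip between sink j - 1 and source j, indexed by the source: the m-th strip of the
  overview is zone m + 1. Consecutive strips are kept apart by \<open>gap\<close>.\<close>

definition zone :: "int \<Rightarrow> nat \<Rightarrow> bool" where
  "zone x j \<longleftrightarrow> 2 \<le> j \<and> j \<le> n \<and> b (j - 1) \<le> x \<and> x \<le> a j"

lemma zone_unique: assumes "zone x i" "zone x j" shows "i = j"
proof -
  have False if "zone x i" "zone x j" "i < j" for i j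
  proof -
    have "a j \<le> a (i + 1)" using that by (intro a_dec_le) (auto simp: zone_def)
    moreover have "a (i + 1) < b (i - 1)" using that gap[of "i - 1"] by (auto simp: zone_def)
    ultimately show False using that by (auto simp: zone_def)
  qed
  with assms show ?thesis by (metis linorder_neqE_nat)
qed

definition fam :: "(nat \<Rightarrow> nat) \<Rightarrow> (nat \<Rightarrow> nat \<Rightarrow> int) \<Rightarrow> (edge \<Rightarrow> nat) \<Rightarrow> bool" where
  "fam s P H \<longleftrightarrow> is_family n lam mu s P \<and> fam_edges n P = H"

lemma famD:
  assumes "fam s P H"
  shows "s permutes {1..n}" "i \<in> {1..n} \<Longrightarrow> is_path (a i) (b (s i)) (P i)" "i \<notin> {1..n} \<Longrightarrow> P i = (\<lambda>_. 0)"
    "i \<in> {1..n} \<Longrightarrow> s i \<in> {1..n}" "\<forall>i\<in>{1..n}. i \<le> s i + 1" "hess n s"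
    "0 < H (lev_edge x x' y) \<longleftrightarrow> (\<exists>i\<in>{1..n}. P i (Suc y) = x \<and> P i y = x')"
proof -
  show s: "s permutes {1..n}" and p: "i \<in> {1..n} \<Longrightarrow> is_path (a i) (b (s i)) (P i)"
    and "i \<notin> {1..n} \<Longrightarrow> P i = (\<lambda>_. 0)" for i
    using assms by (auto simp: fam_def is_family_def)
  show si: "i \<in> {1..n} \<Longrightarrow> s i \<in> {1..n}" for i using permutes_in_image[OF s] by blast
  show h: "\<forall>i\<in>{1..n}. i \<le> s i + 1" using path_hess p si by blast
  with s show "hess n s" by (simp add: hess_def)
  show "0 < H (lev_edge x x' y) \<longleftrightarrow> (\<exists>i\<in>{1..n}. P i (Suc y) = x \<and> P i y = x')"
    using assms fam_edges_pos[of n P] by (auto simp: fam_def)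
qed

text \<open>A meeting point is never right of source j. If it were left of sink j - 1, both paths,
  which only move left, would end at sinks with index at least j, against
  \<open>hess_pigeon\<close>.\<close>

lemma meet_zone:
  assumes f: "fam s P H" and ij: "1 \<le> i" "i < j" "j \<le> n" "P i y = x" "P j y = x"
  shows "zone x j"
proof -
  have in': "i \<in> {1..n}" "j \<in> {1..n}" using ij by auto
  note pi = path_bounds[OF famD(2)[OF f in'(1)], of y] and pj = path_bounds[OF famD(2)[OF f in'(2)], of y]
  have "b (j - 1) \<le> x"
  proof (rule ccontr)
    assume x: "\<not> b (j - 1) \<le> x"
    have "j \<le> s k" if "b (s k) \<le> x" "k \<in> {1..n}" for k
    proof (rule ccontr)
      assume "\<not> j \<le> s k"
      then have "b (j - 1) \<le> b (s k)" using famD(4)[OF f that(2)] ij by (intro b_dec_le) auto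
      with x that show False by simp
    qed
    then show False using hess_pigeon[OF famD(1,5)[OF f], of i j j] pi pj ij in' by auto
  qed
  with pj ij show ?thesis by (simp add: zone_def)
qed

text \<open>The pair \<open>(x, y)\<close> stands for the vertex \<open>(x, y + 1)\<close>.\<close>

definition splits :: "(edge \<Rightarrow> nat) \<Rightarrow> (int \<times> nat) set" where
  "splits H = {(x, y). 0 < H (lev_edge x x y) \<and> 0 < H (lev_edge x (x - 1) y)}"

lemma fam_step: "fam s P H \<Longrightarrow> i \<in> {1..n} \<Longrightarrow> P i y = P i (Suc y) \<or> P i y = P i (Suc y) - 1"
  using path_step famD(2) by blast

lemma split_pair:
  assumes f: "fam s P H" and x: "(x, y) \<in> splits H"
  shows "\<exists>i j. 1 \<le> i \<and> i < j \<and> j \<le> n \<and> zone x j \<and> P i (Suc y) = x \<and> P j (Suc y) = x \<and> P i y \<noteq> P j y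
     \<and> (\<forall>k\<in>{1..n}. P k (Suc y) = x \<longrightarrow> k = i \<or> k = j)"
proof -
  obtain k l where kl: "k \<in> {1..n}" "P k (Suc y) = x" "P k y = x" "l \<in> {1..n}" "P l (Suc y) = x" "P l y = x - 1"
    using x unfolding splits_def by (auto simp: famD(7)[OF f])
  define i j where "i = min k l" and "j = max k l"
  have "k \<noteq> l" using kl by auto
  then have ij: "1 \<le> i" "i < j" "j \<le> n" "P i (Suc y) = x" "P j (Suc y) = x" "P i y \<noteq> P j y"
    using kl by (auto simp: i_def j_def min_def max_def)
  have z: "zone x j" using meet_zone[OF f ij(1-3)] ij by blast
  \<comment> \<open>A third path through the vertex would put \<open>x\<close> into a second zone as
    well: the zone of the larger index in some pair of the three paths.\<close>
  have "m = i \<or> m = j" if m: "m \<in> {1..n}" "P m (Suc y) = x" for m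
  proof (rule ccontr)
    assume ne: "\<not> (m = i \<or> m = j)"
    have mz: "zone x v" if "u \<in> {m, i, j}" "v \<in> {m, i, j}" "u < v" for u v
      using meet_zone[OF f, of u v "Suc y" x] that m ij by auto
    show False
    proof (cases "m < j")
      case True
      then have "zone x (max m i)" using mz[of "min m i" "max m i"] ne by (auto simp: min_def max_def)
      with z zone_unique have "max m i = j" by blast
      with True ij show False by simp
    next
      case False
      then have "zone x m" using mz[of j m] ne by auto
      with z zone_unique ne show False by blast
    qed
  qed
  with ij z show ?thesis by blast
qed

lemma split_visit:
  assumes "fam s P H" "(x, y) \<in> splits H" "zone x j" shows "P j (Suc y) = x"
  using split_pair[OF assms(1,2)] zone_unique assms(3) by metis

text \<open>A split is recorded when the path named by its zone goes south there. That path depends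
  only on \<open>x\<close>, so the records of different families covering \<open>H\<close> are
  comparable.\<close>

definition bits :: "(nat \<Rightarrow> nat \<Rightarrow> int) \<Rightarrow> (edge \<Rightarrow> nat) \<Rightarrow> (int \<times> nat) set" where
  "bits P H = {(x, y). (x, y) \<in> splits H \<and> (\<exists>j. zone x j \<and> P j y = x)}"

lemma bits_iff: "(x, y) \<in> splits H \<Longrightarrow> zone x j \<Longrightarrow> (x, y) \<in> bits P H \<longleftrightarrow> P j y = x"
  unfolding bits_def using zone_unique by blast

text \<open>Away from splits only one edge of \<open>H\<close> leaves the vertex. At a split both
  families have the same two paths, since they agree one level higher, and the bit tells which of
  them goes south.\<close>

lemma bits_determine_step:
  assumes f: "fam s P H" "fam s' P' H" and b: "bits P H = bits P' H"
    and eq: "\<forall>k\<in>{1..n}. P k (Suc y) = P' k (Suc y)" and k: "k \<in> {1..n}"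
  shows "P k y = P' k y"
proof -
  define x where "x = P k (Suc y)"
  have x': "P' k (Suc y) = x" using eq k by (simp add: x_def)
  have st: "P k y = x \<or> P k y = x - 1" "P' k y = x \<or> P' k y = x - 1"
    using fam_step[OF f(1) k, of y] fam_step[OF f(2) k, of y] x' x_def by auto
  have pos: "0 < H (lev_edge x (P k y) y)"
    unfolding famD(7)[OF f(1)] using k x_def by auto
  have pos': "0 < H (lev_edge x (P' k y) y)"
    unfolding famD(7)[OF f(2)] using k x' by auto
  show ?thesis
  proof (cases "(x, y) \<in> splits H")
    case False
    with st pos pos' show ?thesis unfolding splits_def by auto
  next
    case True
    obtain i j where ij: "1 \<le> i" "i < j" "j \<le> n" "zone x j" "P i (Suc y) = x" "P j (Suc y) = x" "P i y \<noteq> P j y"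
      "\<forall>k\<in>{1..n}. P k (Suc y) = x \<longrightarrow> k = i \<or> k = j" using split_pair[OF f(1) True] by blast
    obtain i' j' where ij': "1 \<le> i'" "i' < j'" "j' \<le> n" "zone x j'" "P' i' (Suc y) = x" "P' j' (Suc y) = x" "P' i' y \<noteq> P' j' y"
      using split_pair[OF f(2) True] by blast
    have j: "j' = j" using zone_unique ij' ij by blast
    have "i' \<in> {1..n}" using ij' by auto
    with ij(8) eq ij' j have i: "i' = i" by (metis less_irrefl)
    have iff: "P j y = x \<longleftrightarrow> P' j y = x" using bits_iff[OF True ij(4)] b by blast
    have "i \<in> {1..n}" "j \<in> {1..n}" using ij by auto
    then have steps: "P j y = x \<or> P j y = x - 1" "P' j y = x \<or> P' j y = x - 1"
        "P i y = x \<or> P i y = x - 1" "P' i y = x \<or> P' i y = x - 1"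
      using fam_step[OF f(1)] fam_step[OF f(2)] ij(5,6) ij'(5,6) i j by metis+
    have Pj: "P j y = P' j y" using iff steps(1,2) by auto
    have "P i y = P' i y" using Pj ij(7) ij'(7) steps(3,4) steps(1,2) unfolding i j by linarith
    moreover have "k = i \<or> k = j" using ij(8) k x_def by blast
    ultimately show ?thesis using Pj by blast
  qed
qed

lemma fam_top: assumes "fam s P H" shows "\<exists>Y. \<forall>y\<ge>Y. \<forall>i\<in>{1..n}. P i y = a i"
proof -
  have "\<exists>Y. \<forall>y\<ge>Y. P i y = a i" if "i \<in> {1..n}" for i
    using famD(2)[OF assms that] by (auto simp: is_path_def)
  then obtain Y where Y: "\<And>i y. i \<in> {1..n} \<Longrightarrow> y \<ge> Y i \<Longrightarrow> P i y = a i" by metis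
  have "Y i \<le> Max (Y ` {1..n})" if "i \<in> {1..n}" for i using that by simp
  then have "\<forall>y\<ge>Max (Y ` {1..n}). \<forall>i\<in>{1..n}. P i y = a i" using Y by (meson le_trans)
  then show ?thesis ..
qed

lemma bits_inj:
  assumes f: "fam s P H" "fam s' P' H" and b: "bits P H = bits P' H" shows "P = P'"
proof -
  obtain Y Y' where Y: "\<forall>y\<ge>Y. \<forall>i\<in>{1..n}. P i y = a i" "\<forall>y\<ge>Y'. \<forall>i\<in>{1..n}. P' i y = a i"
    using fam_top[OF f(1)] fam_top[OF f(2)] by blast
  have "\<forall>k\<in>{1..n}. P k y = P' k y" for y
  proof (cases "y \<le> max Y Y'")
    case True
    then show ?thesis
    proof (induction rule: inc_induct)
      case base then show ?case using Y by simp
    next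
      case (step m) then show ?case using bits_determine_step[OF f b] by blast
    qed
  next
    case False then show ?thesis using Y by simp
  qed
  then show ?thesis using famD(3)[OF f(1)] famD(3)[OF f(2)] by (metis ext)
qed

lemma finite_splits: assumes f: "fam s P H" shows "finite (splits H)"
proof -
  obtain Y where Y: "\<forall>y\<ge>Y. \<forall>i\<in>{1..n}. P i y = a i" using fam_top[OF f] by blast
  have "splits H \<subseteq> (\<Union>i\<in>{1..n}. (\<lambda>y. (P i (Suc y), y)) ` {..Y})"
  proof
    fix v assume v: "v \<in> splits H"
    obtain x y where xy: "v = (x, y)" by (cases v)
    then obtain i where i: "i \<in> {1..n}" "P i (Suc y) = x" "P i y = x - 1"
      using v famD(7)[OF f] by (auto simp: splits_def)
    then have "\<not> Y \<le> y" using Y by auto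
    with i xy show "v \<in> (\<Union>i\<in>{1..n}. (\<lambda>y. (P i (Suc y), y)) ` {..Y})" by (auto intro!: bexI[of _ i])
  qed
  then show ?thesis by (rule finite_subset) auto
qed

end

section \<open>Exchanging the tails of two paths\<close>

context hess_shape
begin

text \<open>The paths meet at height y + 1, so the step from y + 1 to y is already exchanged and the
  bit at the split \<open>(x, y)\<close> itself changes.\<close>

definition swap_tails :: "nat \<Rightarrow> nat \<Rightarrow> nat \<Rightarrow> (nat \<Rightarrow> nat \<Rightarrow> int) \<Rightarrow> nat \<Rightarrow> nat \<Rightarrow> int" where
  "swap_tails i j y P k t = (if t \<le> y then P (transpose i j k) t else P k t)"

lemma swap_tails_fam:
  assumes f: "fam s P H" and ij: "i \<in> {1..n}" "j \<in> {1..n}" "P i (Suc y) = P j (Suc y)"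
  shows "fam (s \<circ> transpose i j) (swap_tails i j y P) H"
proof -
  let ?t = "transpose i j" and ?Q = "swap_tails i j y P"
  have tn: "?t k \<in> {1..n} \<longleftrightarrow> k \<in> {1..n}" for k using ij by (auto simp: transpose_def)
  have meet: "P (?t k) (Suc y) = P k (Suc y)" for k using ij(3) by (auto simp: transpose_def)
  have up: "?Q k (Suc t) = (if t \<le> y then P (?t k) (Suc t) else P k (Suc t))" for k t
    by (cases "t = y") (auto simp: swap_tails_def meet)
  have step: "?Q k (Suc t) = u \<and> ?Q k t = v \<longleftrightarrow> (if t \<le> y then P (?t k) (Suc t) = u \<and> P (?t k) t = v
      else P k (Suc t) = u \<and> P k t = v)" for k t u v
    unfolding up by (simp add: swap_tails_def)
  have "is_path (a k) (b ((s \<circ> ?t) k)) (?Q k)" if k: "k \<in> {1..n}" for k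
    unfolding is_path_def
  proof (intro conjI allI impI)
    fix t :: nat assume "1 \<le> t"
    then obtain t' where t: "t = Suc t'" by (cases t) auto
    show "?Q k (t - 1) = ?Q k t \<or> ?Q k (t - 1) = ?Q k t - 1"
    proof (cases "t' \<le> y")
      case True
      then show ?thesis using fam_step[OF f, of "?t k" t'] k tn[of k] unfolding t up by (simp add: swap_tails_def)
    next
      case False
      then show ?thesis using fam_step[OF f, of k t'] k unfolding t up by (simp add: swap_tails_def)
    qed
  next
    obtain Y where "\<forall>z\<ge>Y. P k z = a k" using famD(2)[OF f k] by (auto simp: is_path_def)
    then show "\<exists>Y. \<forall>z\<ge>Y. ?Q k z = a k"
      by (intro exI[of _ "max Y (Suc y)"]) (auto simp: swap_tails_def)
  next
    show "?Q k 0 = b ((s \<circ> ?t) k)"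
      using famD(2)[OF f, of "?t k"] k tn[of k] by (simp add: swap_tails_def is_path_def)
  qed
  moreover have "?Q k = (\<lambda>_. 0)" if "k \<notin> {1..n}" for k
    using famD(3)[OF f, of k] famD(3)[OF f, of "?t k"] that tn[of k] by (auto simp: swap_tails_def fun_eq_iff)
  moreover have "s \<circ> ?t permutes {1..n}"
    using famD(1)[OF f] ij by (intro permutes_compose permutes_swap_id) auto
  moreover have "fam_edges n ?Q = fam_edges n P"
  proof
    fix e
    show "fam_edges n ?Q e = fam_edges n P e"
    proof (cases "\<exists>u v t. e = lev_edge u v t")
      case False
      then have "e \<notin> path_edges X" for X by (auto simp: path_edges_eq)
      then show ?thesis by (simp add: fam_edges_def)
    next
      case True
      then obtain u v t where e: "e = lev_edge u v t" by blast
      show ?thesis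
      proof (cases "t \<le> y")
        case False
        then show ?thesis unfolding fam_edges_def e lev_edge_in step by simp
      next
        case le: True
        have "bij_betw ?t {k\<in>{1..n}. P (?t k) (Suc t) = u \<and> P (?t k) t = v} {k\<in>{1..n}. P k (Suc t) = u \<and> P k t = v}"
          by (rule bij_betw_byWitness[where f' = ?t])
            (use tn in \<open>simp_all add: image_subset_iff del: atLeastAtMost_iff\<close>)
        with le show ?thesis unfolding fam_edges_def e lev_edge_in step
          by (simp add: bij_betw_same_card)
      qed
    qed
  qed
  ultimately show ?thesis using f by (auto simp: fam_def is_family_def)
qed

definition sd :: "'b set \<Rightarrow> 'b set \<Rightarrow> 'b set" where "sd A B = (A - B) \<union> (B - A)"

lemma swap_tails_bits:
  assumes f: "fam s P H" and xy: "(x, y) \<in> splits H" "zone x j"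
  shows "\<exists>s' P'. fam s' P' H \<and> bits P' H = sd (bits P H) {(x', y'). (x', y') \<in> splits H \<and> zone x' j \<and> y' \<le> y}"
proof -
  obtain i where ij: "1 \<le> i" "i < j" "j \<le> n" "P i (Suc y) = x" "P j (Suc y) = x" "P i y \<noteq> P j y"
    using split_pair[OF f xy(1)] zone_unique[OF _ xy(2)] by blast
  let ?Q = "swap_tails i j y P"
  have in': "i \<in> {1..n}" "j \<in> {1..n}" using ij by auto
  have Q: "fam (s \<circ> transpose i j) ?Q H"
    using swap_tails_fam[OF f in'] ij by simp
  have "(x', y') \<in> bits ?Q H \<longleftrightarrow> (x', y') \<in> sd (bits P H) {(x', y'). (x', y') \<in> splits H \<and> zone x' j \<and> y' \<le> y}" for x' y'
  proof (cases "(x', y') \<in> splits H")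
    case False then show ?thesis by (auto simp: bits_def sd_def)
  next
    case S: True
    obtain z where z: "zone x' z" using split_pair[OF f S] by blast
    note bq = bits_iff[OF S z, of ?Q] and bp = bits_iff[OF S z, of P]
    have zz: "zone x' j \<longleftrightarrow> z = j" using zone_unique z by blast
    have Pz: "P z (Suc y') = x'" and Qz: "?Q z (Suc y') = x'"
      using split_visit[OF f S z] split_visit[OF Q S z] .
    consider "z \<noteq> i" "z \<noteq> j" | "y < y'" | "z = i" "y' \<le> y" | "z = j" "y' \<le> y" by linarith
    then show ?thesis
    proof cases
      case 1
      then have "?Q z y' = P z y'" by (simp add: swap_tails_def)
      with bq bp zz 1 S show ?thesis by (simp add: sd_def)
    next
      case 2
      then have "?Q z y' = P z y'" by (simp add: swap_tails_def)
      with bq bp 2 S show ?thesis by (simp add: sd_def)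
    next
      case 3
      \<comment> \<open>This case is impossible: having met path \<open>j\<close> inside zone
        \<open>j\<close>, path \<open>i\<close> is from there on strictly left of sink i - 1 by
        \<open>gap\<close>, hence outside its own zone.\<close>
      have "2 \<le> i" "b (i - 1) \<le> x'" using z 3 by (auto simp: zone_def)
      moreover have "P i (Suc y') \<le> P i (Suc y)" using path_mono[OF famD(2)[OF f in'(1)]] 3 by simp
      moreover have "a (i + 1) < b (i - 1)" using gap[of "i - 1"] \<open>2 \<le> i\<close> ij by simp
      moreover have "a j \<le> a (i + 1)" using ij by (intro a_dec_le) auto
      moreover have "x \<le> a j" using xy(2) by (simp add: zone_def)
      ultimately show ?thesis using Pz 3 ij by simp
    next
      case 4
      have Qj: "?Q j y' = P i y'" using 4 ij by (simp add: swap_tails_def)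
      \<comment> \<open>Because the exchanged family covers the same \<open>H\<close>,
        \<open>split_visit\<close> applies to it and shows that the original path \<open>i\<close>
        also visits this split. So \<open>i\<close> and \<open>j\<close> part there, and the
        exchange flips the bit.\<close>
      have Pi: "P i (Suc y') = x'"
      proof (cases "y' = y")
        case True then show ?thesis using Pz 4 ij by simp
      next
        case False
        then have "?Q j (Suc y') = P i (Suc y')" using 4 by (simp add: swap_tails_def)
        with Qz 4 show ?thesis by simp
      qed
      obtain i2 j2 where p2: "zone x' j2" "P i2 y' \<noteq> P j2 y'" "\<forall>k\<in>{1..n}. P k (Suc y') = x' \<longrightarrow> k = i2 \<or> k = j2"
        using split_pair[OF f S] by blast
      have "j2 = j" using zone_unique[OF p2(1)] z 4 by blast
      moreover have "i = i2 \<or> i = j2" using p2(3) Pi in' by blast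
      ultimately have ne: "P i y' \<noteq> P j y'" using p2(2) ij by auto
      have "P i y' = x' \<or> P i y' = x' - 1" "P j y' = x' \<or> P j y' = x' - 1"
        using fam_step[OF f in'(1), of y'] fam_step[OF f in'(2), of y'] Pi Pz 4 by auto
      with ne have "?Q j y' = x' \<longleftrightarrow> P j y' \<noteq> x'" unfolding Qj by auto
      with bq bp 4 S zz show ?thesis by (auto simp: sd_def)
    qed
  qed
  then have "bits ?Q H = sd (bits P H) {(x', y'). (x', y') \<in> splits H \<and> zone x' j \<and> y' \<le> y}"
    by (auto simp: set_eq_iff)
  with Q show ?thesis by blast
qed

definition bit_sets :: "(edge \<Rightarrow> nat) \<Rightarrow> (int \<times> nat) set set" where
  "bit_sets H = {bits P H | s P. fam s P H}"

lemma bit_sets_toggle_all: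
  assumes "finite L" "\<And>v B. v \<in> L \<Longrightarrow> B \<in> bit_sets H \<Longrightarrow> sd B {v} \<in> bit_sets H" "B \<in> bit_sets H"
  shows "sd B L \<in> bit_sets H"
  using assms
proof (induction L arbitrary: B rule: finite_induct)
  case empty then show ?case by (simp add: sd_def)
next
  case (insert v L)
  have "sd (sd B {v}) L = sd B (insert v L)" using insert.hyps by (auto simp: sd_def)
  moreover have "sd (sd B {v}) L \<in> bit_sets H" using insert by auto
  ultimately show ?case by simp
qed

text \<open>An exchange flips the chosen split together with all lower splits of its zone. The lower
  ones are flipped back one at a time by the induction hypothesis; no other split of the zone has
  the same height, since path \<open>j\<close> visits them all.\<close>

lemma bit_sets_toggle:
  assumes f: "fam s P H" shows "(x, y) \<in> splits H \<Longrightarrow> B \<in> bit_sets H \<Longrightarrow> sd B {(x, y)} \<in> bit_sets H"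
proof (induction y arbitrary: x B rule: less_induct)
  case (less y)
  obtain j where j: "zone x j" using split_pair[OF f less.prems(1)] by blast
  define D where "D = {(x', y'). (x', y') \<in> splits H \<and> zone x' j \<and> y' \<le> y}"
  have D: "(x, y) \<in> D" "D \<subseteq> splits H" using less.prems j by (auto simp: D_def)
  have low: "y' < y" if "(x', y') \<in> D - {(x, y)}" for x' y'
  proof (rule ccontr)
    assume "\<not> y' < y"
    then have y': "y' = y" "(x', y) \<in> splits H" "zone x' j" using that by (auto simp: D_def)
    then have "x' = x" using split_visit[OF f _ j] less.prems(1) split_visit[OF f y'(2,3)] by metis
    with y' that show False by simp
  qed
  have BD: "sd B D \<in> bit_sets H"
    using swap_tails_bits[OF _ less.prems(1) j] less.prems(2) unfolding bit_sets_def D_def by fastforce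
  have fin: "finite (D - {(x, y)})" using D finite_splits[OF f] finite_subset by blast
  have tog: "sd C {v} \<in> bit_sets H" if "v \<in> D - {(x, y)}" "C \<in> bit_sets H" for v C
    using less.IH[of "snd v" "fst v"] low[of "fst v" "snd v"] that D(2) by auto
  have "sd (sd B D) (D - {(x, y)}) \<in> bit_sets H"
    by (rule bit_sets_toggle_all[OF fin tog BD])
  moreover have "sd (sd B D) (D - {(x, y)}) = sd B {(x, y)}" using D(1) by (auto simp: sd_def)
  ultimately show ?case by simp
qed

lemma bit_sets_eq: assumes f: "fam s P H" shows "bit_sets H = Pow (splits H)"
proof
  show "bit_sets H \<subseteq> Pow (splits H)" by (auto simp: bit_sets_def bits_def)
  show "Pow (splits H) \<subseteq> bit_sets H"
  proof
    fix B assume B: "B \<in> Pow (splits H)"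
    have B0: "bits P H \<in> bit_sets H" using f by (auto simp: bit_sets_def)
    have sub: "sd (bits P H) B \<subseteq> splits H" using B by (auto simp: sd_def bits_def)
    then have fin: "finite (sd (bits P H) B)" using finite_splits[OF f] finite_subset by blast
    have "sd C {v} \<in> bit_sets H" if "v \<in> sd (bits P H) B" "C \<in> bit_sets H" for v C
      using bit_sets_toggle[OF f, of "fst v" "snd v"] sub that by auto
    from bit_sets_toggle_all[OF fin this B0]
    have "sd (bits P H) (sd (bits P H) B) \<in> bit_sets H" .
    moreover have "sd (bits P H) (sd (bits P H) B) = B" by (auto simp: sd_def)
    ultimately show "B \<in> bit_sets H" by simp
  qed
qed

section \<open>Lowest splits and the type of a family\<close>

definition last_splits :: "(edge \<Rightarrow> nat) \<Rightarrow> (int \<times> nat) set" where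
  "last_splits H = {(x, y). (x, y) \<in> splits H \<and> (\<exists>j. zone x j \<and> (\<forall>x' y'. (x', y') \<in> splits H \<longrightarrow> zone x' j \<longrightarrow> y \<le> y'))}"

text \<open>The shift by one turns the source index j of a zone into the potential drop j - 1, as in
  s(j) = j - 1.\<close>

definition split_index :: "int \<times> nat \<Rightarrow> nat" where
  "split_index v = (THE j. zone (fst v) j) - 1"

lemma split_index_eq: assumes "zone x j" shows "split_index (x, y) = j - 1"
proof -
  have "(THE i. zone x i) = j" using assms zone_unique by (intro the_equality) blast+
  then show ?thesis by (simp add: split_index_def)
qed

lemma last_splits_iff:
  assumes "zone x j"
  shows "(x, y) \<in> last_splits H \<longleftrightarrow> (x, y) \<in> splits H \<and> (\<forall>x' y'. (x', y') \<in> splits H \<longrightarrow> zone x' j \<longrightarrow> y \<le> y')"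
  unfolding last_splits_def using zone_unique assms by blast

lemma inj_split_index: assumes f: "fam s P H" shows "inj_on split_index (last_splits H)"
proof (rule inj_onI)
  fix v w assume vw: "v \<in> last_splits H" "w \<in> last_splits H" "split_index v = split_index w"
  obtain x y x' y' where v: "v = (x, y)" and w: "w = (x', y')" by (cases v; cases w)
  obtain j j' where j: "zone x j" "zone x' j'" using vw v w by (auto simp: last_splits_def)
  then have "j - 1 = j' - 1" using vw(3) v w by (simp add: split_index_eq)
  then have jj: "j' = j" using j by (auto simp: zone_def)
  have l: "(x, y) \<in> splits H" "(x', y') \<in> splits H" "y \<le> y'" "y' \<le> y"
    using vw v w j jj by (auto simp: last_splits_iff)
  then have y: "y' = y" by simp
  have "x' = x" using split_visit[OF f l(1) j(1)] split_visit[OF f l(2)] j jj y by metis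
  with v w y show "v = w" by simp
qed

text \<open>The path supplied by \<open>drop_partner\<close> starts right of path \<open>j\<close>
  and ends left of it, so the two cross, and at their lowest meeting vertex path \<open>j\<close>
  goes south.\<close>

lemma drop_last_split:
  assumes f: "fam s P H" and j: "2 \<le> j" "j \<le> n" "s j = j - 1"
  shows "\<exists>x y. (x, y) \<in> last_splits H \<and> zone x j \<and> P j y = x"
proof -
  obtain i where i: "1 \<le> i" "i < j" "j \<le> s i"
    using drop_partner[OF famD(1)[OF f] j] by auto
  have in': "i \<in> {1..n}" "j \<in> {1..n}" using i j by auto
  note pi = famD(2)[OF f in'(1)] and pj = famD(2)[OF f in'(2)]
  have "s i \<le> n" using famD(4)[OF f in'(1)] by simp
  then have "b (s i) < b (j - 1)" using i j by (intro b_dec) auto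
  then have "P i 0 < P j 0" using pi pj j by (simp add: is_path_def)
  moreover obtain Y where "\<forall>y\<ge>Y. \<forall>i\<in>{1..n}. P i y = a i" using fam_top[OF f] by blast
  then have "P j Y \<le> P i Y" using in' a_dec[of i j] i j by auto
  ultimately obtain y where y: "P i (Suc y) = P j (Suc y)" "P j y = P j (Suc y)" "P i y = P j (Suc y) - 1" "\<forall>t\<le>y. P i t < P j t"
    using path_crossing[OF pi pj] by blast
  define x where "x = P j (Suc y)"
  have S: "(x, y) \<in> splits H"
    using y in' x_def by (auto simp: splits_def famD(7)[OF f])
  have z: "zone x j" using meet_zone[OF f i(1,2) j(2) y(1) refl] unfolding x_def .
  have "y \<le> y'" if S': "(x', y') \<in> splits H" "zone x' j" for x' y'
  proof (rule ccontr)
    assume lt: "\<not> y \<le> y'"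
    obtain i' j' where p: "1 \<le> i'" "i' < j'" "zone x' j'" "P i' (Suc y') = x'" "P j' (Suc y') = x'"
      using split_pair[OF f S'(1)] by blast
    have jj: "j' = j" using zone_unique p S' by blast
    \<comment> \<open>The second path at a lower split has no possible end: it is not
      \<open>i\<close>, so sinks from j on are excluded by \<open>hess_pigeon\<close>; sink j - 1
      belongs to path \<open>j\<close>; sinks up to j - 2 lie right of source j by
      \<open>gap\<close>, hence right of the zone.\<close>
    have "i' \<noteq> i" using y(4)[rule_format, of "Suc y'"] lt p jj by auto
    then have "\<not> j \<le> s i'"
      using hess_pigeon[OF famD(1,5)[OF f], of i i' j] i j p jj by auto
    moreover have "s i' \<noteq> j - 1" using permutes_inj[OF famD(1)[OF f]] p(2) jj j(3) by (metis inj_eq less_irrefl)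
    moreover have i': "i' \<in> {1..n}" using p jj j by auto
    moreover have "s i' \<in> {1..n}" using famD(4)[OF f i'] .
    ultimately have si: "1 \<le> s i'" "s i' \<le> j - 2" "3 \<le> j" by auto
    have "b (j - 2) \<le> b (s i')" using si j by (intro b_dec_le) auto
    moreover have "j - 2 + 2 = j" using si by simp
    then have "a j < b (j - 2)" using gap[of "j - 2"] si j by simp
    moreover have "b (s i') \<le> x'" using path_bounds(1)[OF famD(2)[OF f i'], of "Suc y'"] p by simp
    ultimately show False using S'(2) by (simp add: zone_def)
  qed
  with S z have "(x, y) \<in> last_splits H" by (simp add: last_splits_iff)
  with z y x_def show ?thesis by blast
qed

text \<open>If path \<open>j\<close> goes south at the split but s(j) >= j, then its partner there
  ends at a sink with index below j, hence right of the end of path \<open>j\<close>. The two must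
  cross again, which yields a lower split of the same zone.\<close>

lemma last_split_drop:
  assumes f: "fam s P H" and l: "(x, y) \<in> last_splits H" and z: "zone x j"
  shows "(x, y) \<in> bits P H \<longleftrightarrow> s j = j - 1"
proof
  have S: "(x, y) \<in> splits H" using l by (auto simp: last_splits_def)
  have j: "2 \<le> j" "j \<le> n" using z by (auto simp: zone_def)
  {
    assume "s j = j - 1"
    then obtain x' y' where l': "(x', y') \<in> last_splits H" "zone x' j" "P j y' = x'"
      using drop_last_split[OF f j] by blast
    have "split_index (x', y') = split_index (x, y)" using l' z by (simp add: split_index_eq)
    then have "(x', y') = (x, y)" using inj_split_index[OF f] l l'(1) by (auto dest: inj_onD)
    with l'(3) show "(x, y) \<in> bits P H" using bits_iff[OF S z] by simp
  next
    assume "(x, y) \<in> bits P H"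
    then have Pj: "P j y = x" using bits_iff[OF S z] by simp
    show "s j = j - 1"
    proof (rule ccontr)
      assume ne: "s j \<noteq> j - 1"
      have in2: "j \<in> {1..n}" using j by auto
      have sj: "j \<le> s j" using famD(5)[OF f] in2 ne by fastforce
      obtain i j' where p: "1 \<le> i" "i < j'" "zone x j'" "P i (Suc y) = x" "P i y \<noteq> P j' y"
        using split_pair[OF f S] by blast
      have jj: "j' = j" using zone_unique p z by blast
      have in1: "i \<in> {1..n}" using p jj j by auto
      have si: "s i < j" using hess_pigeon[OF famD(1,5)[OF f], of i j j] sj p jj j by fastforce
      note pi = famD(2)[OF f in1] and pj = famD(2)[OF f in2]
      have "b (s j) < b (s i)" using si sj famD(4)[OF f in1] famD(4)[OF f in2] by (intro b_dec) auto
      then have "P j 0 < P i 0" using pi pj by (simp add: is_path_def)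
      moreover have "P i y \<le> P j y" using fam_step[OF f in1, of y] p Pj by auto
      ultimately obtain t where t: "t < y" "P j (Suc t) = P i (Suc t)" "P i t = P i (Suc t)" "P j t = P i (Suc t) - 1"
        using path_crossing[OF pj pi] by blast
      have "(P i (Suc t), t) \<in> splits H" using t in1 in2 by (auto simp: splits_def famD(7)[OF f])
      moreover have "zone (P i (Suc t)) j" using meet_zone[OF f p(1) _ j(2) refl t(2)] p(2) jj by blast
      ultimately show False using l t(1) unfolding last_splits_iff[OF z] by (meson not_le)
    qed
  }
qed

lemma drops_eq_bits:
  assumes f: "fam s P H" shows "drops n s = split_index ` (bits P H \<inter> last_splits H)"
proof
  show "drops n s \<subseteq> split_index ` (bits P H \<inter> last_splits H)"
  proof
    fix m assume "m \<in> drops n s"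
    then have m: "2 \<le> m + 1" "m + 1 \<le> n" "s (m + 1) = m + 1 - 1" by (auto simp: drops_def)
    then obtain x y where l: "(x, y) \<in> last_splits H" "zone x (m + 1)" using drop_last_split[OF f] by blast
    then have "(x, y) \<in> bits P H" using last_split_drop[OF f] m by blast
    moreover have "split_index (x, y) = m" using split_index_eq[OF l(2)] by simp
    ultimately show "m \<in> split_index ` (bits P H \<inter> last_splits H)" using l by force
  qed
  show "split_index ` (bits P H \<inter> last_splits H) \<subseteq> drops n s"
  proof
    fix m assume "m \<in> split_index ` (bits P H \<inter> last_splits H)"
    then obtain x y where v: "(x, y) \<in> bits P H" "(x, y) \<in> last_splits H" "m = split_index (x, y)" by force
    then obtain j where j: "zone x j" by (auto simp: last_splits_def)
    then have "s j = j - 1" "m = j - 1" using last_split_drop[OF f v(2) j] v split_index_eq[OF j] by auto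
    with j show "m \<in> drops n s" by (auto simp: drops_def zone_def)
  qed
qed

text \<open>For a given type the bits at the lowest splits are prescribed and all others are free,
  so each permutation occurring in B(I) is the type of 2 to the number of other splits
  families.\<close>

lemma type_sum_eq:
  assumes "subnetwork n lam mu H"
  shows "\<exists>e I. I \<subseteq> {1..<n} \<and> type_sum n lam mu H = (\<lambda>s. 2 ^ e * BB n I s)"
proof -
  obtain s0 P0 where f0: "fam s0 P0 H" using assms by (auto simp: subnetwork_def fam_def)
  let ?S = "splits H" and ?L = "last_splits H"
  define I where "I = split_index ` ?L"
  have finS: "finite ?S" by (rule finite_splits[OF f0])
  have LS: "?L \<subseteq> ?S" by (auto simp: last_splits_def)
  note inj = inj_split_index[OF f0]
  have I: "I \<subseteq> {1..<n}"
  proof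
    fix m assume "m \<in> I"
    then obtain x y where v: "(x, y) \<in> ?L" "m = split_index (x, y)" by (auto simp: I_def)
    then obtain j where "zone x j" by (auto simp: last_splits_def)
    with v show "m \<in> {1..<n}" by (auto simp: split_index_eq zone_def)
  qed
  have "type_sum n lam mu H s = 2 ^ card (?S - ?L) * BB n I s" for s
  proof (cases "hess n s \<and> drops n s \<subseteq> I")
    case False
    have "\<not> fam s P H" for P
      using False famD(6) drops_eq_bits[of s P H] unfolding I_def by blast
    then have X: "{P. is_family n lam mu s P \<and> fam_edges n P = H} = {}" unfolding fam_def by blast
    have "BB n I s = 0" unfolding BB_eq[OF I] by (simp only: False if_False)
    then show ?thesis unfolding type_sum_def X by simp
  next
    case True
    define T where "T = {v\<in>?L. split_index v \<in> drops n s}"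
    have T: "split_index ` T = drops n s" "T \<subseteq> ?L" using True by (auto simp: T_def I_def)
    \<comment> \<open>The bits at the lowest splits give the drops, and the drops determine a
      Hessenberg permutation.\<close>
    have iff: "fam s P H \<longleftrightarrow> (\<exists>s'. fam s' P H) \<and> bits P H \<inter> ?L = T" for P
    proof
      assume f: "fam s P H"
      have "split_index ` (bits P H \<inter> ?L) = split_index ` T" using drops_eq_bits[OF f] T by simp
      then have "bits P H \<inter> ?L = T" using inj_on_image_eq_iff[OF inj Int_lower2 T(2)] by simp
      with f show "(\<exists>s'. fam s' P H) \<and> bits P H \<inter> ?L = T" by blast
    next
      assume "(\<exists>s'. fam s' P H) \<and> bits P H \<inter> ?L = T"
      then obtain s' where s': "fam s' P H" "bits P H \<inter> ?L = T" by blast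
      then have "drops n s' = drops n s" using drops_eq_bits[OF s'(1)] T by simp
      then have "s' = s" using hess_drops_inj famD(6)[OF s'(1)] True by blast
      with s' show "fam s P H" by simp
    qed
    have bij1: "bij_betw (\<lambda>P. bits P H) {P. fam s P H} {B\<in>Pow ?S. B \<inter> ?L = T}"
      unfolding bij_betw_def
    proof
      show "inj_on (\<lambda>P. bits P H) {P. fam s P H}" using bits_inj by (auto intro: inj_onI)
      show "(\<lambda>P. bits P H) ` {P. fam s P H} = {B\<in>Pow ?S. B \<inter> ?L = T}"
        unfolding iff bit_sets_eq[OF f0, symmetric] bit_sets_def by auto
    qed
    have bij2: "bij_betw (\<lambda>B. B - ?L) {B\<in>Pow ?S. B \<inter> ?L = T} (Pow (?S - ?L))"
      by (rule bij_betw_byWitness[where f' = "\<lambda>B. B \<union> T"]) (use T LS in auto)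
    have "card {P. fam s P H} = card (Pow (?S - ?L))"
      by (rule trans[OF bij_betw_same_card[OF bij1] bij_betw_same_card[OF bij2]])
    then have "card {P. fam s P H} = 2 ^ card (?S - ?L)" using finS by (simp add: card_Pow)
    moreover have "BB n I s = 1" unfolding BB_eq[OF I] by (simp only: True if_True simp_thms)
    ultimately show ?thesis unfolding type_sum_def fam_def by simp
  qed
  with I show ?thesis by blast
qed

end

section \<open>Generating functions of path families\<close>

definition gf :: "'b set \<Rightarrow> ('b \<Rightarrow> monom) \<Rightarrow> fps" where
  "gf T w m = int (card {t\<in>T. w t = m})"

text \<open>Keeps \<open>gf\<close> meaningful, since \<open>card\<close> gives 0 for infinite sets;
  it has to be carried through every product.\<close>

definition finite_fibres :: "'b set \<Rightarrow> ('b \<Rightarrow> monom) \<Rightarrow> bool" where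
  "finite_fibres T w \<longleftrightarrow> (\<forall>m. finite {t\<in>T. w t = m})"

lemma finite_splittings: "finite {(x, y). x + y = (m :: 'b \<Rightarrow>\<^sub>0 nat)}"
proof -
  let ?K = "Poly_Mapping.keys m" and ?l = Poly_Mapping.lookup
  let ?F = "{f. \<forall>v. (v \<in> ?K \<longrightarrow> f v \<in> {..sum (?l m) ?K}) \<and> (v \<notin> ?K \<longrightarrow> f v = (0 :: nat))}"
  have fin: "finite ?F" by (intro finite_set_of_finite_funs) auto
  have "inj_on (\<lambda>(x, y). ?l x) {(x, y). x + y = m}"
    by (auto simp: inj_on_def lookup_inject)
  moreover have "(\<lambda>(x, y). ?l x) ` {(x, y). x + y = m} \<subseteq> ?F"
  proof (rule image_subsetI)
    fix p assume "p \<in> {(x, y). x + y = m}"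
    then obtain x y where p: "p = (x, y)" and m: "m = x + y" by blast
    have le: "?l x v \<le> ?l m v" for v by (simp add: m lookup_add)
    have "?l x v \<le> sum (?l m) ?K" if "v \<in> ?K" for v
      using le[of v] member_le_sum[OF that, of "?l m"] by simp
    moreover have "?l x v = 0" if "v \<notin> ?K" for v
      using le[of v] that by (simp add: in_keys_iff)
    ultimately show "(\<lambda>(x, y). ?l x) p \<in> ?F" by (simp add: p)
  qed
  ultimately show ?thesis using fin by (meson finite_imageD finite_subset)
qed

lemma gf_mult:
  assumes "finite_fibres T w" "finite_fibres T' w'"
  shows "fps_mult (gf T w) (gf T' w') = gf (T \<times> T') (\<lambda>(t, t'). w t + w' t')"
    and "finite_fibres (T \<times> T') (\<lambda>(t, t'). w t + w' t')"
proof -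
  let ?S = "\<lambda>m. {(x, y). x + y = m}"
  let ?B = "\<lambda>v. {t\<in>T. w t = fst v} \<times> {t\<in>T'. w' t = snd v}"
  have un: "{p\<in>T \<times> T'. (case p of (t, t') \<Rightarrow> w t + w' t') = m} = (\<Union>v\<in>?S m. ?B v)" for m
    by auto
  have fin: "finite (?B v)" for v using assms by (simp add: finite_fibres_def)
  show "finite_fibres (T \<times> T') (\<lambda>(t, t'). w t + w' t')"
    unfolding finite_fibres_def un using finite_splittings fin by blast
  show "fps_mult (gf T w) (gf T' w') = gf (T \<times> T') (\<lambda>(t, t'). w t + w' t')"
  proof
    fix m
    have "card (\<Union>v\<in>?S m. ?B v) = (\<Sum>v\<in>?S m. card (?B v))"
      using finite_splittings fin by (intro card_UN_disjoint) auto
    then show "fps_mult (gf T w) (gf T' w') m = gf (T \<times> T') (\<lambda>(t, t'). w t + w' t') m"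
      unfolding gf_def un fps_mult_def by (simp add: card_cartesian_product case_prod_beta)
  qed
qed

lemma gf_reindex:
  assumes "bij_betw h T T'" "\<And>t. t \<in> T \<Longrightarrow> w' (h t) = w t"
  shows "gf T w = gf T' w'" "finite_fibres T w \<longleftrightarrow> finite_fibres T' w'"
proof -
  have "bij_betw h {t\<in>T. w t = m} {t\<in>T'. w' t = m}" for m
    using assms by (auto simp: bij_betw_def inj_on_def)
  from bij_betw_same_card[OF this] bij_betw_finite[OF this]
  show "gf T w = gf T' w'" "finite_fibres T w \<longleftrightarrow> finite_fibres T' w'"
    unfolding gf_def finite_fibres_def by simp_all
qed

text \<open>Fixing the value \<open>d\<close> outside \<open>A\<close> follows the convention of
  \<open>is_family\<close> and \<open>is_multinetwork\<close>, so that each tuple is counted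
  once.\<close>

definition ext_funs :: "'i set \<Rightarrow> ('i \<Rightarrow> 'b set) \<Rightarrow> 'b \<Rightarrow> ('i \<Rightarrow> 'b) set" where
  "ext_funs A T d = {f. (\<forall>x\<in>A. f x \<in> T x) \<and> (\<forall>x. x \<notin> A \<longrightarrow> f x = d)}"

lemma ext_funs_insert:
  assumes "x \<notin> A"
  shows "bij_betw (\<lambda>(t, f). f(x := t)) (T x \<times> ext_funs A T d) (ext_funs (insert x A) T d)"
  by (rule bij_betw_byWitness[where f' = "\<lambda>f. (f x, f(x := d))"])
    (use assms in \<open>auto simp: ext_funs_def fun_eq_iff\<close>)

lemma ext_funs_empty: "ext_funs {} T d = {\<lambda>_. d}"
  by (auto simp: ext_funs_def)

lemma ext_funs_nested:
  "f \<in> ext_funs A (\<lambda>i. ext_funs B (T i) d) (\<lambda>_. d)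
     \<longleftrightarrow> (\<forall>i r. if i \<in> A \<and> r \<in> B then f i r \<in> T i r else f i r = d)"
  unfolding ext_funs_def mem_Collect_eq fun_eq_iff if_bool_eq_conj by blast

text \<open>Expanding the product of Hadamard entries gives tuples indexed by row first and by shape
  second; path families need the opposite order.\<close>

lemma ext_funs_transpose:
  "bij_betw (\<lambda>f r i. f i r) (ext_funs A (\<lambda>i. ext_funs B (T i) d) (\<lambda>_. d))
     (ext_funs B (\<lambda>r. ext_funs A (\<lambda>i. T i r) d) (\<lambda>_. d))"
  by (rule bij_betw_byWitness[where f' = "\<lambda>f r i. f i r"])
    (simp_all add: image_subset_iff ext_funs_nested conj_commute)

lemma card_ext_funs: "finite A \<Longrightarrow> card (ext_funs A T d) = (\<Prod>x\<in>A. card (T x))"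
proof (induction A rule: finite_induct)
  case (insert x A)
  then show ?case
    using bij_betw_same_card[OF ext_funs_insert[OF insert.hyps(2), of T d]]
    by (simp add: card_cartesian_product)
qed (simp add: ext_funs_empty)

lemma gf_prod_list:
  assumes "distinct xs" "\<And>x. x \<in> set xs \<Longrightarrow> finite_fibres (T x) (w x)"
  shows "fps_prod_list (map (\<lambda>x. gf (T x) (w x)) xs) = gf (ext_funs (set xs) T d) (\<lambda>f. \<Sum>x\<in>set xs. w x (f x))
     \<and> finite_fibres (ext_funs (set xs) T d) (\<lambda>f. \<Sum>x\<in>set xs. w x (f x))"
  using assms
proof (induction xs)
  case Nil
  have "{t\<in>{\<lambda>_. d}. (\<Sum>x\<in>set []. w x (t x)) = m} = (if m = 0 then {\<lambda>_. d} else {})" for m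
    by auto
  then show ?case
    unfolding list.set(1) ext_funs_empty
    by (simp add: fps_prod_list_def fps_one_def gf_def finite_fibres_def fun_eq_iff)
next
  case (Cons x xs)
  let ?W = "\<lambda>xs f. \<Sum>x\<in>set xs. w x (f x)"
  have x: "x \<notin> set xs" "finite_fibres (T x) (w x)" using Cons.prems by auto
  have IH: "fps_prod_list (map (\<lambda>x. gf (T x) (w x)) xs) = gf (ext_funs (set xs) T d) (?W xs)"
    "finite_fibres (ext_funs (set xs) T d) (?W xs)" using Cons by auto
  have weight: "?W (x # xs) ((\<lambda>(t, f). f(x := t)) p) = (case p of (t, f) \<Rightarrow> w x t + ?W xs f)" for p
  proof -
    obtain t f where p: "p = (t, f)" by (cases p)
    have "(\<Sum>y\<in>set xs. w y ((f(x := t)) y)) = ?W xs f" using x by (intro sum.cong) auto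
    with x show ?thesis by (simp add: p)
  qed
  note re = gf_reindex[where w' = "?W (x # xs)", OF ext_funs_insert[OF x(1), of T d] weight]
  have "fps_prod_list (map (\<lambda>x. gf (T x) (w x)) (x # xs)) = fps_mult (gf (T x) (w x)) (gf (ext_funs (set xs) T d) (?W xs))"
    by (simp add: IH(1)[symmetric] fps_prod_list_def)
  then show ?case using gf_mult[OF x(2) IH(2)] re by simp
qed

section \<open>Elementary symmetric functions as sums over paths\<close>

definition sw_steps :: "(nat \<Rightarrow> int) \<Rightarrow> nat set" where
  "sw_steps X = {y. y \<ge> 1 \<and> X (y - 1) = X y - 1}"

lemma path_from_steps:
  assumes "is_path a c X"
  shows "finite (sw_steps X)" "X y = c + int (card (sw_steps X \<inter> {..y}))" "a = c + int (card (sw_steps X))"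
proof -
  obtain Y where Y: "\<And>y. y \<ge> Y \<Longrightarrow> X y = a" using assms by (auto simp: is_path_def)
  have "sw_steps X \<subseteq> {..Y}"
  proof
    fix y assume y: "y \<in> sw_steps X"
    show "y \<in> {..Y}"
    proof (rule ccontr)
      assume "y \<notin> {..Y}"
      then have "X y = a" "X (y - 1) = a" using Y[of y] Y[of "y - 1"] by auto
      with y show False by (simp add: sw_steps_def)
    qed
  qed
  then show fin: "finite (sw_steps X)" by (rule finite_subset) simp
  show val: "X y = c + int (card (sw_steps X \<inter> {..y}))" for y
  proof (induction y)
    case 0
    have "sw_steps X \<inter> {..0} = {}" by (auto simp: sw_steps_def)
    then show ?case using assms by (simp add: is_path_def)
  next
    case (Suc y)
    have "sw_steps X \<inter> {..Suc y} = (if Suc y \<in> sw_steps X then insert (Suc y) (sw_steps X \<inter> {..y}) else sw_steps X \<inter> {..y})"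
      by (auto simp: le_Suc_eq)
    then have "card (sw_steps X \<inter> {..Suc y}) = card (sw_steps X \<inter> {..y}) + (if Suc y \<in> sw_steps X then 1 else 0)"
      using fin by simp
    moreover have "Suc y \<in> sw_steps X \<longleftrightarrow> X y = X (Suc y) - 1" by (simp add: sw_steps_def)
    ultimately show ?case using Suc.IH path_step[OF assms, of y] by (cases "Suc y \<in> sw_steps X") simp_all
  qed
  have "sw_steps X \<inter> {..Y} = sw_steps X" using \<open>sw_steps X \<subseteq> {..Y}\<close> by auto
  with val[of Y] Y[of Y] show "a = c + int (card (sw_steps X))" by simp
qed

lemma lookup_path_monom:
  assumes "finite (sw_steps X)"
  shows "Poly_Mapping.lookup (path_monom r X) (q, y) = (if q = r \<and> y \<in> sw_steps X then 1 else 0)"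
proof -
  have "Poly_Mapping.lookup (path_monom r X) (q, y) = (\<Sum>z\<in>sw_steps X. if z = y then (if q = r then 1 else 0) else 0)"
    unfolding path_monom_def sw_steps_def[symmetric] lookup_sum
    by (intro sum.cong refl) (auto simp: lookup_single when_def)
  with assms show ?thesis by simp
qed

lemma path_monom_elem_sym:
  assumes "is_path a c X" shows "elem_sym r (a - c) (path_monom r X) = 1"
proof -
  note P = path_from_steps[OF assms]
  note lk = lookup_path_monom[OF P(1), of r]
  have "Poly_Mapping.keys (path_monom r X) = Pair r ` sw_steps X"
    by (auto simp: in_keys_iff lk split: if_splits)
  then have "(\<Sum>v\<in>Poly_Mapping.keys (path_monom r X). Poly_Mapping.lookup (path_monom r X) v) = card (sw_steps X)"
    by (simp add: sum.reindex inj_on_def lk)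
  then show ?thesis
    using P(3) by (auto simp: elem_sym_def lk sw_steps_def split: if_splits)
qed

lemma elem_sym_path:
  assumes "elem_sym r d m \<noteq> 0" shows "\<exists>X. is_path (c + d) c X \<and> path_monom r X = m"
proof -
  let ?l = "Poly_Mapping.lookup m"
  have m: "\<And>v. ?l v \<le> 1" "\<And>v. ?l v \<noteq> 0 \<Longrightarrow> fst v = r \<and> 1 \<le> snd v"
      "int (\<Sum>v\<in>Poly_Mapping.keys m. ?l v) = d"
    using assms by (auto simp: elem_sym_def split: if_splits)
  define D where "D = snd ` Poly_Mapping.keys m"
  have finD: "finite D" by (simp add: D_def)
  have keys: "Poly_Mapping.keys m = Pair r ` D"
  proof (rule set_eqI)
    fix v
    have v: "v \<in> Poly_Mapping.keys m \<Longrightarrow> fst v = r" for v using m(2)[of v] by (simp add: in_keys_iff)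
    show "v \<in> Poly_Mapping.keys m \<longleftrightarrow> v \<in> Pair r ` D"
    proof
      assume "v \<in> Poly_Mapping.keys m"
      then have "v = Pair r (snd v)" "snd v \<in> D" using v[of v] by (auto simp: D_def prod_eq_iff)
      then show "v \<in> Pair r ` D" by (rule image_eqI)
    next
      assume "v \<in> Pair r ` D"
      then obtain u where u: "u \<in> Poly_Mapping.keys m" "v = (r, snd u)" by (auto simp: D_def)
      then have "v = u" using v[OF u(1)] by (simp add: prod_eq_iff)
      with u show "v \<in> Poly_Mapping.keys m" by simp
    qed
  qed
  have one: "?l v = 1" if "v \<in> Poly_Mapping.keys m" for v
    using m(1)[of v] that by (simp add: in_keys_iff)
  have "(\<Sum>v\<in>Poly_Mapping.keys m. ?l v) = (\<Sum>v\<in>Poly_Mapping.keys m. 1)"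
    using one by (rule sum.cong[OF refl])
  also have "\<dots> = card D" by (simp add: keys card_image inj_on_def)
  finally have "(\<Sum>v\<in>Poly_Mapping.keys m. ?l v) = card D" .
  with m(3) have d: "d = int (card D)" by simp
  have D1: "1 \<le> y" if "y \<in> D" for y using m(2) that by (auto simp: D_def in_keys_iff)
  define X where "X y = c + int (card (D \<inter> {..y}))" for y
  have step: "X (Suc y) = X y + (if Suc y \<in> D then 1 else 0)" for y
  proof -
    have "D \<inter> {..Suc y} = (if Suc y \<in> D then insert (Suc y) (D \<inter> {..y}) else D \<inter> {..y})"
      by (auto simp: le_Suc_eq)
    then show ?thesis using finD by (auto simp: X_def)
  qed
  have path: "is_path (c + d) c X"
    unfolding is_path_def
  proof (intro conjI allI impI)
    fix y :: nat assume "1 \<le> y"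
    then obtain z where "y = Suc z" by (cases y) auto
    then show "X (y - 1) = X y \<or> X (y - 1) = X y - 1" using step[of z] by simp
  next
    have "D \<inter> {..y} = D" if "y \<ge> Max D" for y using that finD by (auto intro: order_trans[OF Max_ge])
    then show "\<exists>Y. \<forall>y\<ge>Y. X y = c + d" by (intro exI[of _ "Max D"]) (simp add: X_def d)
  next
    have "D \<inter> {..0} = {}" using D1 by fastforce
    then show "X 0 = c" by (simp add: X_def)
  qed
  have "sw_steps X = D"
  proof -
    have "y \<in> sw_steps X \<longleftrightarrow> y \<in> D" for y
      using step[of "y - 1"] D1[of y] by (cases y) (auto simp: sw_steps_def split: if_splits)
    then show ?thesis by blast
  qed
  moreover have "?l (q, y) = (if q = r \<and> y \<in> D then 1 else 0)" for q y
  proof -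
    have "(q, y) \<in> Poly_Mapping.keys m \<longleftrightarrow> q = r \<and> y \<in> D" unfolding keys by auto
    then show ?thesis using one[of "(q, y)"] in_keys_iff[of "(q, y)" m] by argo
  qed
  ultimately have "path_monom r X = m"
    using finD by (intro poly_mapping_eqI) (auto simp: lookup_path_monom)
  with path show ?thesis by blast
qed

lemma path_monom_inj:
  assumes "is_path a c X" "is_path a c Z" "path_monom r X = path_monom r Z" shows "X = Z"
proof -
  note P = path_from_steps[OF assms(1)] and Q = path_from_steps[OF assms(2)]
  have "y \<in> sw_steps X \<longleftrightarrow> Poly_Mapping.lookup (path_monom r X) (r, y) \<noteq> 0" for y
    by (simp add: lookup_path_monom[OF P(1)])
  moreover have "y \<in> sw_steps Z \<longleftrightarrow> Poly_Mapping.lookup (path_monom r Z) (r, y) \<noteq> 0" for y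
    by (simp add: lookup_path_monom[OF Q(1)])
  ultimately have eq: "sw_steps X = sw_steps Z" using assms(3) by auto
  show ?thesis by (rule ext) (simp only: P(2) Q(2) eq)
qed

text \<open>A path with given ends is the same as the set of heights of its southwest steps, of size
  a - c, and this set is the support of a square-free monomial. For a < c both sides vanish.\<close>

lemma elem_sym_gf:
  "elem_sym r (a - c) = gf {X. is_path a c X} (path_monom r)"
  "finite_fibres {X. is_path a c X} (path_monom r)"
proof -
  have fib: "{X \<in> {X. is_path a c X}. path_monom r X = m} = {} \<or> (\<exists>X. {X \<in> {X. is_path a c X}. path_monom r X = m} = {X})" for m
    using path_monom_inj[of a c _ _ r] by blast
  show "finite_fibres {X. is_path a c X} (path_monom r)"
    unfolding finite_fibres_def
  proof
    fix m
    from fib[of m] show "finite {X \<in> {X. is_path a c X}. path_monom r X = m}"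
      by (elim disjE exE) (simp_all only: finite.emptyI finite_insert)
  qed
  show "elem_sym r (a - c) = gf {X. is_path a c X} (path_monom r)"
  proof
    fix m
    show "elem_sym r (a - c) m = gf {X. is_path a c X} (path_monom r) m"
    proof (cases "\<exists>X. is_path a c X \<and> path_monom r X = m")
      case True
      then obtain X where X: "is_path a c X" "path_monom r X = m" by blast
      then have "{X \<in> {X. is_path a c X}. path_monom r X = m} = {X}"
      proof (intro equalityI subsetI)
        fix Z assume "Z \<in> {X \<in> {X. is_path a c X}. path_monom r X = m}"
        then have "Z = X" using X by (intro path_monom_inj[of a c Z X r]) simp_all
        then show "Z \<in> {X}" by simp
      qed simp
      then show ?thesis using path_monom_elem_sym[OF X(1), of r] X(2) by (simp add: gf_def)
    next
      case False
      then have "{X \<in> {X. is_path a c X}. path_monom r X = m} = {}" by blast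
      moreover have "elem_sym r (a - c) m = 0" using elem_sym_path[of r "a - c" m c] False by auto
      ultimately show ?thesis by (simp only: gf_def card.empty of_nat_0)
    qed
  qed
qed

section \<open>Tuples of families of a common type and their weights\<close>

definition fam_tuples :: "nat \<Rightarrow> nat \<Rightarrow> (nat \<Rightarrow> nat list) \<Rightarrow> (nat \<Rightarrow> nat list) \<Rightarrow> (nat \<Rightarrow> nat) \<Rightarrow> (nat \<Rightarrow> nat \<Rightarrow> nat \<Rightarrow> int) set" where
  "fam_tuples n k lam mu s = ext_funs {1..k} (\<lambda>r. {P. is_family n (lam r) (mu r) s P}) (\<lambda>_ _. 0)"

definition tuple_monom :: "nat \<Rightarrow> nat \<Rightarrow> (nat \<Rightarrow> nat \<Rightarrow> nat \<Rightarrow> int) \<Rightarrow> monom" where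
  "tuple_monom n k Ps = (\<Sum>r\<in>{1..k}. fam_monom r n (Ps r))"

lemma JT_prod_gf:
  assumes s: "s \<in> perms n"
  shows "fps_prod_list (map (\<lambda>i. hadamard_JT k lam mu i (s i)) [1..<n+1]) = gf (fam_tuples n k lam mu s) (tuple_monom n k)"
    and "finite_fibres (fam_tuples n k lam mu s) (tuple_monom n k)"
proof -
  let ?p = "\<lambda>i r. {X. is_path (Acoord n (lam r) i) (Bcoord n (mu r) (s i)) X}"
  let ?w = "\<lambda>g. \<Sum>r\<in>{1..k}. path_monom r (g r)"
  let ?z = "\<lambda>_::nat. 0::int"
  let ?G = "\<lambda>i. ext_funs {1..k} (?p i) ?z"
  have JT: "JT (lam r) (mu r) r i j = elem_sym r (Acoord n (lam r) i - Bcoord n (mu r) j)" for r i j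
    unfolding JT_def Acoord_def Bcoord_def by (rule arg_cong[where f = "elem_sym r"]) simp
  have sets: "set [1..<k+1] = {1..k}" for k by auto
  have had: "hadamard_JT k lam mu i (s i) = gf (?G i) ?w \<and> finite_fibres (?G i) ?w" for i
    using gf_prod_list[of "[1..<k+1]" "?p i" "\<lambda>r. path_monom r" ?z] elem_sym_gf(2)
    unfolding hadamard_JT_def JT elem_sym_gf(1) sets by auto
  have 1: "fps_prod_list (map (\<lambda>i. hadamard_JT k lam mu i (s i)) [1..<n+1])
      = gf (ext_funs {1..n} ?G (\<lambda>_. ?z)) (\<lambda>f. \<Sum>i\<in>{1..n}. ?w (f i))
     \<and> finite_fibres (ext_funs {1..n} ?G (\<lambda>_. ?z)) (\<lambda>f. \<Sum>i\<in>{1..n}. ?w (f i))"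
    using gf_prod_list[of "[1..<n+1]" ?G "\<lambda>_. ?w" "\<lambda>_. ?z"] had unfolding sets by auto
  have "{P. is_family n (lam r) (mu r) s P} = ext_funs {1..n} (\<lambda>i. ?p i r) ?z" for r
    using s unfolding is_family_def perms_def ext_funs_def by blast
  then have bij: "bij_betw (\<lambda>f r i. f i r) (ext_funs {1..n} ?G (\<lambda>_. ?z)) (fam_tuples n k lam mu s)"
    unfolding fam_tuples_def by (simp only: ext_funs_transpose)
  have weight: "tuple_monom n k (\<lambda>r i. f i r) = (\<Sum>i\<in>{1..n}. ?w (f i))" for f
    unfolding tuple_monom_def fam_monom_def by (rule sum.swap)
  show "fps_prod_list (map (\<lambda>i. hadamard_JT k lam mu i (s i)) [1..<n+1]) = gf (fam_tuples n k lam mu s) (tuple_monom n k)"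
    "finite_fibres (fam_tuples n k lam mu s) (tuple_monom n k)"
    using 1 gf_reindex[where w' = "tuple_monom n k", OF bij weight] by simp_all
qed

text \<open>The exponent of the variable at height y is the number of southwest edges leaving that
  height, counted with multiplicity, so the weight depends on the edge multiset alone. This makes
  the choice in \<open>wt_monom\<close> harmless.\<close>

lemma fam_monom_cong:
  assumes f: "is_family n lam mu s P" "is_family n lam mu s' P'" and e: "fam_edges n P = fam_edges n P'"
  shows "fam_monom r n P = fam_monom r n P'"
proof (rule poly_mapping_eqI)
  fix v :: "nat \<times> nat"
  obtain q y where v: "v = (q, y)" by (cases v)
  have lk: "Poly_Mapping.lookup (fam_monom r n P) (q, y) = (if q = r then card {i\<in>{1..n}. y \<in> sw_steps (P i)} else 0)"
    if f: "is_family n lam mu s P" for s P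
  proof -
    have "finite (sw_steps (P i))" if "i \<in> {1..n}" for i
      using f path_from_steps(1) that unfolding is_family_def by blast
    then have "Poly_Mapping.lookup (fam_monom r n P) (q, y) = (\<Sum>i\<in>{1..n}. if q = r \<and> y \<in> sw_steps (P i) then 1 else 0)"
      unfolding fam_monom_def lookup_sum by (intro sum.cong refl lookup_path_monom)
    then show ?thesis by (simp add: sum.If_cases Int_def)
  qed
  have "card {i\<in>{1..n}. y \<in> sw_steps (P i)} = card {i\<in>{1..n}. y \<in> sw_steps (P' i)}"
  proof (cases y)
    case 0 then show ?thesis by (simp add: sw_steps_def)
  next
    case (Suc z)
    define X where "X = (\<lambda>i. P i y) ` {1..n} \<union> (\<lambda>i. P' i y) ` {1..n}"
    have cnt: "card {i\<in>{1..n}. y \<in> sw_steps (Q i)} = (\<Sum>x\<in>X. fam_edges n Q (lev_edge x (x - 1) z))"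
      if "(\<lambda>i. Q i y) ` {1..n} \<subseteq> X" for Q
    proof -
      have inX: "Q i (Suc z) \<in> X" if "i \<in> {1..n}" for i
        using that \<open>(\<lambda>i. Q i y) ` {1..n} \<subseteq> X\<close> Suc by blast
      have "{i\<in>{1..n}. y \<in> sw_steps (Q i)} = (\<Union>x\<in>X. {i\<in>{1..n}. lev_edge x (x - 1) z \<in> path_edges (Q i)})"
        using inX unfolding lev_edge_in by (auto simp: sw_steps_def Suc)
      also have "card \<dots> = (\<Sum>x\<in>X. card {i\<in>{1..n}. lev_edge x (x - 1) z \<in> path_edges (Q i)})"
        by (intro card_UN_disjoint) (auto simp: X_def lev_edge_in)
      finally show ?thesis by (simp add: fam_edges_def)
    qed
    show ?thesis using cnt[of P] cnt[of P'] e by (simp add: X_def)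
  qed
  then show "Poly_Mapping.lookup (fam_monom r n P) v = Poly_Mapping.lookup (fam_monom r n P') v"
    using lk[OF f(1)] lk[OF f(2)] v by simp
qed

lemma wt_monom_eq:
  assumes "is_family n lam mu s P" shows "wt_monom r n lam mu (fam_edges n P) = fam_monom r n P"
proof -
  define Q where "Q = (SOME Q. \<exists>\<sigma>. is_family n lam mu \<sigma> Q \<and> fam_edges n Q = fam_edges n P)"
  have "\<exists>\<sigma>. is_family n lam mu \<sigma> Q \<and> fam_edges n Q = fam_edges n P"
    unfolding Q_def by (rule someI[of _ P]) (use assms in blast)
  then show ?thesis unfolding wt_monom_def Q_def[symmetric] using fam_monom_cong assms by blast
qed

lemma part_antimono:
  assumes "is_partition l" "1 \<le> i" "i \<le> j" shows "part l j \<le> part l i"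
  using assms sorted_rev_nth_mono[of l "i - 1" "j - 1"] by (auto simp: part_def is_partition_def)

lemma hess_shapeI:
  assumes p: "is_partition lam" "is_partition mu" and c: "\<not> contains_3x2 lam mu"
  shows "hess_shape n lam mu"
proof
  fix i j :: nat assume ij: "1 \<le> i" "i < j"
  show "Acoord n lam j < Acoord n lam i" "Bcoord n mu j < Bcoord n mu i"
    using part_antimono[OF p(1), of i j] part_antimono[OF p(2), of i j] ij by (auto simp: Acoord_def Bcoord_def)
next
  fix i :: nat assume i: "1 \<le> i"
  have "part lam (i + 2) < part mu i + 2"
  proof (rule ccontr)
    assume ge: "\<not> ?thesis"
    \<comment> \<open>The block in rows i to i + 2 sits directly to the right of row i of
      \<open>mu\<close>.\<close>
    have "(i + x, part mu i + 1 + y) \<in> skew_cells lam mu" if "x < 3" "y < 2" for x y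
    proof -
      have "part mu (i + x) \<le> part mu i" "part lam (i + 2) \<le> part lam (i + x)"
        using part_antimono[OF p(2), of i "i + x"] part_antimono[OF p(1), of "i + x" "i + 2"] i that by auto
      with ge that i show ?thesis by (simp add: skew_cells_def)
    qed
    with c i show False unfolding contains_3x2_def by (metis le_add2)
  qed
  then show "Acoord n lam (i + 2) < Bcoord n mu i" by (simp add: Acoord_def Bcoord_def)
qed

lemma BB_inj: assumes "I \<subseteq> {1..<n}" "J \<subseteq> {1..<n}" "BB n I = BB n J" shows "I = J"
proof -
  have "I \<subseteq> J" if "I \<subseteq> {1..<n}" "J \<subseteq> {1..<n}" "BB n I = BB n J" for I J
    using wperm_hess[OF that(1)] fun_cong[OF that(3), of "wperm I"] unfolding BB_eq[OF that(1)] BB_eq[OF that(2)]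
    by (auto split: if_splits)
  with assms show ?thesis by (metis subset_antisym)
qed

lemma eps_eq:
  assumes "I \<subseteq> {1..<n}" "type_sum n lam mu H = (\<lambda>s. 2 ^ e * BB n I s)"
  shows "eps n lam mu H = e"
  unfolding eps_def
proof (rule the_equality)
  have th: "theta_lin n (type_sum n lam mu H) = (\<lambda>D. 2 ^ e * tl_basis (tau_diag n I) D)"
    using assms by (intro theta_lin_BB) auto
  then show "\<exists>\<psi>\<in>diagrams n. theta_lin n (type_sum n lam mu H) = (\<lambda>D. 2 ^ e * tl_basis \<psi> D)"
    using tau_diag_diagram[OF assms(1)] by blast
  fix e' assume "\<exists>\<psi>\<in>diagrams n. theta_lin n (type_sum n lam mu H) = (\<lambda>D. 2 ^ e' * tl_basis \<psi> D)"
  then obtain \<psi> where "2 ^ e * tl_basis (tau_diag n I) D = 2 ^ e' * tl_basis \<psi> D" for D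
    unfolding th by metis
  \<comment> \<open>At this diagram the left side is a nonzero power of 2, so the right side does
    not vanish there and the exponents agree.\<close>
  from this[of "tau_diag n I"] show "e' = e"
    by (auto simp: tl_basis_def split: if_splits)
qed

section \<open>Multinetworks\<close>

definition edge_tuple :: "nat \<Rightarrow> nat \<Rightarrow> (nat \<Rightarrow> nat \<Rightarrow> nat \<Rightarrow> int) \<Rightarrow> nat \<Rightarrow> edge \<Rightarrow> nat" where
  "edge_tuple n k Ps = (\<lambda>r. if r \<in> {1..k} then fam_edges n (Ps r) else (\<lambda>_. 0))"

definition networks_of :: "nat \<Rightarrow> nat \<Rightarrow> (nat \<Rightarrow> nat list) \<Rightarrow> (nat \<Rightarrow> nat list) \<Rightarrow> monom \<Rightarrow> (nat \<Rightarrow> edge \<Rightarrow> nat) set" where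
  "networks_of n k lam mu m = {Hs. is_multinetwork n k lam mu Hs \<and> multi_monom n k lam mu Hs = m}"

lemma fam_tuples_family: "Ps \<in> fam_tuples n k lam mu s \<Longrightarrow> r \<in> {1..k} \<Longrightarrow> is_family n (lam r) (mu r) s (Ps r)"
  by (simp add: fam_tuples_def ext_funs_def)

lemma edge_tuple_network:
  assumes "Ps \<in> fam_tuples n k lam mu s"
  shows "edge_tuple n k Ps \<in> networks_of n k lam mu (tuple_monom n k Ps)"
proof -
  note fam = fam_tuples_family[OF assms]
  have "subnetwork n (lam r) (mu r) (fam_edges n (Ps r))" if "r \<in> {1..k}" for r
    using fam[OF that] unfolding subnetwork_def by blast
  then have "is_multinetwork n k lam mu (edge_tuple n k Ps)"
    unfolding is_multinetwork_def edge_tuple_def by simp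
  moreover have "multi_monom n k lam mu (edge_tuple n k Ps) = tuple_monom n k Ps"
    unfolding multi_monom_def tuple_monom_def
  proof (rule sum.cong[OF refl])
    fix r assume r: "r \<in> {1..k}"
    then have "edge_tuple n k Ps r = fam_edges n (Ps r)" by (simp add: edge_tuple_def)
    with wt_monom_eq[OF fam[OF r]] show "wt_monom r n (lam r) (mu r) (edge_tuple n k Ps r) = fam_monom r n (Ps r)"
      by simp
  qed
  ultimately show ?thesis by (simp add: networks_of_def)
qed

lemma beta_eq_card:
  assumes "is_multinetwork n k lam mu Hs"
  shows "beta n k lam mu Hs s = int (card {Ps \<in> fam_tuples n k lam mu s. edge_tuple n k Ps = Hs})"
proof -
  have out: "Hs r = (\<lambda>_. 0)" if "r \<notin> {1..k}" for r
    using assms that unfolding is_multinetwork_def by blast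
  have et: "edge_tuple n k Ps = Hs \<longleftrightarrow> (\<forall>r\<in>{1..k}. fam_edges n (Ps r) = Hs r)" for Ps
  proof
    assume "edge_tuple n k Ps = Hs"
    from this[symmetric] show "\<forall>r\<in>{1..k}. fam_edges n (Ps r) = Hs r" by (simp add: edge_tuple_def)
  next
    assume eq: "\<forall>r\<in>{1..k}. fam_edges n (Ps r) = Hs r"
    show "edge_tuple n k Ps = Hs"
    proof
      fix r show "edge_tuple n k Ps r = Hs r" using eq out[of r] by (simp add: edge_tuple_def)
    qed
  qed
  have "{Ps \<in> fam_tuples n k lam mu s. edge_tuple n k Ps = Hs}
      = ext_funs {1..k} (\<lambda>r. {P. is_family n (lam r) (mu r) s P \<and> fam_edges n P = Hs r}) (\<lambda>_ _. 0)"
    unfolding et fam_tuples_def ext_funs_def by blast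
  then show ?thesis by (simp add: card_ext_funs beta_def type_sum_def)
qed

lemma type_sum_shape:
  assumes "hess_shape n lam mu" "subnetwork n lam mu H"
  shows "\<exists>I. I \<subseteq> {1..<n} \<and> type_sum n lam mu H = (\<lambda>s. 2 ^ eps n lam mu H * BB n I s)"
  using hess_shape.type_sum_eq[OF assms] eps_eq by blast

text \<open>The identity has no drops and so occurs in every B(I). Every multinetwork is therefore
  covered by a tuple of type \<open>id\<close>, and those of weight \<open>m\<close> are images of a
  single finite fibre.\<close>

lemma finite_networks_of:
  assumes "\<forall>r\<in>{1..k}. hess_shape n (lam r) (mu r)"
  shows "finite (networks_of n k lam mu m)"
proof -
  have id: "id \<in> perms n" by (simp add: perms_def permutes_id)
  have "networks_of n k lam mu m \<subseteq> edge_tuple n k ` {Ps\<in>fam_tuples n k lam mu id. tuple_monom n k Ps = m}"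
  proof
    fix Hs assume Hs: "Hs \<in> networks_of n k lam mu m"
    then have net: "is_multinetwork n k lam mu Hs" by (simp add: networks_of_def)
    have "0 < type_sum n (lam r) (mu r) (Hs r) id" if r: "r \<in> {1..k}" for r
    proof -
      have "subnetwork n (lam r) (mu r) (Hs r)" using net r unfolding is_multinetwork_def by blast
      from type_sum_shape[OF bspec[OF assms r] this] obtain I where I: "I \<subseteq> {1..<n}"
          "type_sum n (lam r) (mu r) (Hs r) = (\<lambda>s. 2 ^ eps n (lam r) (mu r) (Hs r) * BB n I s)"
        by (elim exE conjE)
      have "hess n id" "drops n id = {}" by (auto simp: hess_def drops_def permutes_id)
      with I show ?thesis by (simp add: BB_eq)
    qed
    then have "0 < beta n k lam mu Hs id" unfolding beta_def by (intro prod_pos) blast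
    then obtain Ps where Ps: "Ps \<in> fam_tuples n k lam mu id" "edge_tuple n k Ps = Hs"
      unfolding beta_eq_card[OF net] by (metis (mono_tags, lifting) card.empty empty_Collect_eq less_irrefl of_nat_0)
    moreover from edge_tuple_network[OF Ps(1)] Ps(2) Hs have "tuple_monom n k Ps = m"
      by (simp add: networks_of_def)
    ultimately show "Hs \<in> edge_tuple n k ` {Ps\<in>fam_tuples n k lam mu id. tuple_monom n k Ps = m}" by blast
  qed
  then show ?thesis
    using JT_prod_gf(2)[OF id, of k lam mu] unfolding finite_fibres_def by (meson finite_imageI finite_subset)
qed

lemma JT_prod_coeff:
  assumes "\<forall>r\<in>{1..k}. hess_shape n (lam r) (mu r)" and s: "s \<in> perms n"
  shows "fps_prod_list (map (\<lambda>i. hadamard_JT k lam mu i (s i)) [1..<n+1]) m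
     = (\<Sum>Hs\<in>networks_of n k lam mu m. beta n k lam mu Hs s)"
proof -
  let ?F = "\<lambda>Hs. {Ps \<in> fam_tuples n k lam mu s. edge_tuple n k Ps = Hs}"
  have un: "{Ps\<in>fam_tuples n k lam mu s. tuple_monom n k Ps = m} = (\<Union>Hs\<in>networks_of n k lam mu m. ?F Hs)"
  proof (intro equalityI subsetI)
    fix Ps assume "Ps \<in> {Ps\<in>fam_tuples n k lam mu s. tuple_monom n k Ps = m}"
    then show "Ps \<in> (\<Union>Hs\<in>networks_of n k lam mu m. ?F Hs)"
      using edge_tuple_network[of Ps n k lam mu s] by auto
  next
    fix Ps assume "Ps \<in> (\<Union>Hs\<in>networks_of n k lam mu m. ?F Hs)"
    then show "Ps \<in> {Ps\<in>fam_tuples n k lam mu s. tuple_monom n k Ps = m}"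
      using edge_tuple_network[of Ps n k lam mu s] by (auto simp: networks_of_def)
  qed
  have fin: "finite (\<Union>Hs\<in>networks_of n k lam mu m. ?F Hs)"
    unfolding un[symmetric] using JT_prod_gf(2)[OF s, of k lam mu] by (simp only: finite_fibres_def)
  have "card (\<Union>Hs\<in>networks_of n k lam mu m. ?F Hs) = (\<Sum>Hs\<in>networks_of n k lam mu m. card (?F Hs))"
  proof (rule card_UN_disjoint)
    show "finite (networks_of n k lam mu m)" by (rule finite_networks_of[OF assms(1)])
    show "\<forall>Hs\<in>networks_of n k lam mu m. finite (?F Hs)"
    proof
      fix Hs assume "Hs \<in> networks_of n k lam mu m"
      from UN_upper[OF this, of ?F] fin show "finite (?F Hs)" by (rule finite_subset)
    qed
  qed auto
  then have "int (card (\<Union>Hs\<in>networks_of n k lam mu m. ?F Hs)) = (\<Sum>Hs\<in>networks_of n k lam mu m. int (card (?F Hs)))"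
    by simp
  also have "\<dots> = (\<Sum>Hs\<in>networks_of n k lam mu m. beta n k lam mu Hs s)"
    by (intro sum.cong refl) (simp add: beta_eq_card networks_of_def)
  finally show ?thesis
    unfolding JT_prod_gf(1)[OF s] gf_def un .
qed

lemma beta_shape:
  assumes k: "k \<ge> 1" and sh: "\<forall>r\<in>{1..k}. hess_shape n (lam r) (mu r)" and net: "is_multinetwork n k lam mu Hs"
  shows "\<exists>I. I \<subseteq> {1..<n} \<and> beta n k lam mu Hs = (\<lambda>s. 2 ^ multi_eps n k lam mu Hs * BB n I s)"
proof -
  have "\<exists>I. I \<subseteq> {1..<n} \<and> type_sum n (lam r) (mu r) (Hs r) = (\<lambda>s. 2 ^ eps n (lam r) (mu r) (Hs r) * BB n I s)"
    if r: "r \<in> {1..k}" for r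
  proof (rule type_sum_shape[OF bspec[OF sh r]])
    show "subnetwork n (lam r) (mu r) (Hs r)" using net r unfolding is_multinetwork_def by blast
  qed
  then obtain I where I: "\<And>r. r \<in> {1..k} \<Longrightarrow> I r \<subseteq> {1..<n}"
      "\<And>r. r \<in> {1..k} \<Longrightarrow> type_sum n (lam r) (mu r) (Hs r) = (\<lambda>s. 2 ^ eps n (lam r) (mu r) (Hs r) * BB n (I r) s)"
    by metis
  define J where "J = (\<Inter>r\<in>{1..k}. I r)"
  \<comment> \<open>For an empty index range the intersection would be the set of all numbers and
    not a subset of \<open>{1..<n}\<close>.\<close>
  have one: "1 \<in> {1..k}" using k by simp
  have J: "J \<subseteq> {1..<n}" using I(1)[OF one] one by (auto simp: J_def)
  have "beta n k lam mu Hs s = 2 ^ multi_eps n k lam mu Hs * BB n J s" for s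
  proof -
    have "beta n k lam mu Hs s = (\<Prod>r\<in>{1..k}. 2 ^ eps n (lam r) (mu r) (Hs r) * BB n (I r) s)"
      unfolding beta_def by (intro prod.cong refl) (simp add: I(2))
    also have "\<dots> = 2 ^ multi_eps n k lam mu Hs * (\<Prod>r\<in>{1..k}. BB n (I r) s)"
      by (simp add: prod.distrib multi_eps_def power_sum)
    also have "(\<Prod>r\<in>{1..k}. BB n (I r) s) = BB n J s"
    proof (cases "hess n s \<and> drops n s \<subseteq> J")
      case True
      then have "BB n (I r) s = 1" if "r \<in> {1..k}" for r
        using that unfolding BB_eq[OF I(1)[OF that]] J_def by auto
      with True show ?thesis by (simp add: BB_eq[OF J])
    next
      case False
      then obtain r where r: "r \<in> {1..k}" "\<not> (hess n s \<and> drops n s \<subseteq> I r)"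
        using one unfolding J_def by blast
      then have "BB n (I r) s = 0" by (simp only: BB_eq[OF I(1)[OF r(1)]] if_False)
      then have "(\<Prod>r\<in>{1..k}. BB n (I r) s) = 0" using r(1) by (intro prod_zero) auto
      then show ?thesis by (simp only: BB_eq[OF J] False if_False)
    qed
    finally show ?thesis .
  qed
  with J show ?thesis by blast
qed

lemma tl_basis_inj: "tl_basis d = tl_basis d' \<Longrightarrow> d = d'"
  unfolding tl_basis_def by (metis zero_neq_one)

theorem mainTheorem4:
  fixes n k :: nat and lam mu :: "nat \<Rightarrow> nat list" and \<tau> :: "pt \<Rightarrow> pt"
  assumes "k \<ge> 1"
    and "\<tau> \<in> diagrams n"
    and "\<forall>r\<in>{1..k}. is_partition (lam r) \<and> is_partition (mu r) \<and> subpart (mu r) (lam r)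
                     \<and> length (lam r) \<le> n \<and> \<not> contains_3x2 (lam r) (mu r)"
  shows "(\<forall>I. I \<subseteq> {1..<n} \<and> tl_basis \<tau> = tauI n I \<longrightarrow>
            Imm n (f_tau n \<tau>) (hadamard_JT k lam mu) = network_sum n k lam mu I)
       \<and> ((\<nexists>I. I \<subseteq> {1..<n} \<and> tl_basis \<tau> = tauI n I) \<longrightarrow>
            Imm n (f_tau n \<tau>) (hadamard_JT k lam mu) = (\<lambda>m. 0))
       \<and> (\<forall>m. Imm n (f_tau n \<tau>) (hadamard_JT k lam mu) m \<ge> 0)"
proof -
  let ?N = "networks_of n k lam mu" and ?e = "multi_eps n k lam mu" and ?\<beta> = "beta n k lam mu"
  have sh: "\<forall>r\<in>{1..k}. hess_shape n (lam r) (mu r)" using assms(3) hess_shapeI by blast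
  have "\<exists>I. I \<subseteq> {1..<n} \<and> ?\<beta> Hs = (\<lambda>s. 2 ^ ?e Hs * BB n I s)" if "is_multinetwork n k lam mu Hs" for Hs
    by (rule beta_shape[OF assms(1) sh that])
  then obtain J where J: "\<And>Hs. is_multinetwork n k lam mu Hs \<Longrightarrow> J Hs \<subseteq> {1..<n}"
      "\<And>Hs. is_multinetwork n k lam mu Hs \<Longrightarrow> ?\<beta> Hs = (\<lambda>s. 2 ^ ?e Hs * BB n (J Hs) s)"
    by metis
  \<comment> \<open>After exchanging sums, each multinetwork contributes the coefficient of \<tau>
    in theta(beta), and theta(beta) is a power of 2 times one diagram. All three claims are read off
    from this formula.\<close>
  have Imm: "Imm n (f_tau n \<tau>) (hadamard_JT k lam mu) m
      = (\<Sum>Hs\<in>?N m. 2 ^ ?e Hs * tl_basis (tau_diag n (J Hs)) \<tau>)" for m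
  proof -
    have "Imm n (f_tau n \<tau>) (hadamard_JT k lam mu) m
        = (\<Sum>s\<in>perms n. \<Sum>Hs\<in>?N m. ?\<beta> Hs s * theta_perm n s \<tau>)"
      unfolding Imm_def f_tau_def
    proof (rule sum.cong[OF refl])
      fix s assume "s \<in> perms n"
      from JT_prod_coeff[OF sh this, of m]
      show "theta_perm n s \<tau> * fps_prod_list (map (\<lambda>i. hadamard_JT k lam mu i (s i)) [1..<n+1]) m
          = (\<Sum>Hs\<in>?N m. ?\<beta> Hs s * theta_perm n s \<tau>)"
        by (simp only: sum_distrib_left mult.commute)
    qed
    also have "\<dots> = (\<Sum>Hs\<in>?N m. theta_lin n (?\<beta> Hs) \<tau>)"
      unfolding theta_lin_def by (rule sum.swap)
    also have "\<dots> = (\<Sum>Hs\<in>?N m. 2 ^ ?e Hs * tl_basis (tau_diag n (J Hs)) \<tau>)"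
    proof (rule sum.cong[OF refl])
      fix Hs assume "Hs \<in> ?N m"
      then have "is_multinetwork n k lam mu Hs" by (simp add: networks_of_def)
      from J[OF this] show "theta_lin n (?\<beta> Hs) \<tau> = 2 ^ ?e Hs * tl_basis (tau_diag n (J Hs)) \<tau>"
        using theta_lin_BB[of "J Hs" n "?\<beta> Hs" "2 ^ ?e Hs"] by simp
    qed
    finally show ?thesis .
  qed
  have "Imm n (f_tau n \<tau>) (hadamard_JT k lam mu) m = network_sum n k lam mu I m"
    if I: "I \<subseteq> {1..<n}" "tl_basis \<tau> = tauI n I" for I m
  proof -
    have \<tau>: "\<tau> = tau_diag n I" using I tl_basis_inj unfolding tauI_eq[OF I(1)] by blast
    \<comment> \<open>Both B(I) and tau(I) determine I, so the summation condition of
      \<open>network_sum\<close> selects precisely the multinetworks with a nonzero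
      contribution.\<close>
    have cond: "?\<beta> Hs = (\<lambda>s. 2 ^ ?e Hs * BB n I s) \<longleftrightarrow> \<tau> = tau_diag n (J Hs)" if Hs: "is_multinetwork n k lam mu Hs" for Hs
    proof
      assume "?\<beta> Hs = (\<lambda>s. 2 ^ ?e Hs * BB n I s)"
      with J(2)[OF Hs] have "BB n I = BB n (J Hs)" by (simp add: fun_eq_iff)
      then show "\<tau> = tau_diag n (J Hs)" using BB_inj[OF I(1) J(1)[OF Hs]] \<tau> by simp
    next
      assume "\<tau> = tau_diag n (J Hs)"
      then have "I = J Hs" using tau_diag_inj[OF I(1) J(1)[OF Hs]] \<tau> by simp
      with J(2)[OF Hs] show "?\<beta> Hs = (\<lambda>s. 2 ^ ?e Hs * BB n I s)" by simp
    qed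
    have "{Hs. is_multinetwork n k lam mu Hs \<and> ?\<beta> Hs = (\<lambda>s. 2 ^ ?e Hs * BB n I s) \<and> multi_monom n k lam mu Hs = m}
        = {Hs \<in> ?N m. \<tau> = tau_diag n (J Hs)}"
      using cond unfolding networks_of_def by blast
    then have "network_sum n k lam mu I m = (\<Sum>Hs\<in>{Hs \<in> ?N m. \<tau> = tau_diag n (J Hs)}. 2 ^ ?e Hs)"
      by (simp only: network_sum_def)
    also have "\<dots> = (\<Sum>Hs\<in>?N m. if \<tau> = tau_diag n (J Hs) then 2 ^ ?e Hs else 0)"
      by (rule sum.inter_filter[OF finite_networks_of[OF sh]])
    also have "\<dots> = Imm n (f_tau n \<tau>) (hadamard_JT k lam mu) m"
      unfolding Imm tl_basis_def by (intro sum.cong refl) simp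
    finally show ?thesis ..
  qed
  moreover have "Imm n (f_tau n \<tau>) (hadamard_JT k lam mu) m = 0"
    if none: "\<nexists>I. I \<subseteq> {1..<n} \<and> tl_basis \<tau> = tauI n I" for m
    unfolding Imm
  proof (rule sum.neutral, rule ballI)
    fix Hs assume "Hs \<in> ?N m"
    then have "J Hs \<subseteq> {1..<n}" using J(1) by (simp add: networks_of_def)
    with none have "\<tau> \<noteq> tau_diag n (J Hs)" using tauI_eq by metis
    then show "2 ^ ?e Hs * tl_basis (tau_diag n (J Hs)) \<tau> = 0" by (simp add: tl_basis_def)
  qed
  moreover have "0 \<le> Imm n (f_tau n \<tau>) (hadamard_JT k lam mu) m" for m
    unfolding Imm by (intro sum_nonneg) (simp add: tl_basis_def)
  ultimately show ?thesis by blast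
qed

end
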